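(* Let $\mathcal{E}^F$ be a regular and strongly local Dirichlet form on $L^2(F,m_F)$ admitting a carré du champ, and let $\mathcal{A}^F$ be an admissible algebra for $\mathcal{E}^F$. Let $K\in\mathbb{R}$ and $N\geq1$, and assume that the $(K,N)$-cone $\mathcal{E}^C$ over $\mathcal{E}^F$ satisfies $$\Gamma_2^C(u)\geq NK\,\Gamma^C(u)+\tfrac{1}{N+1}(L^Cu)^2\quad m_C\text{-a.e.}$$ for every $u\in C_0^\infty(\hat I_K)\otimes\mathcal{A}^F$. Then $\mathcal{E}^F$ satisfies the classical condition $BE(N-1,N)$, i.e. $\Gamma_2^F(u)\geq(N-1)\Gamma^F(u)+\frac1N(L^Fu)^2$ $m_F$-a.e. for all $u\in\mathcal{A}^F$.
   Context: $F$ is a locally compact separable Hausdorff space with a $\sigma$-finite Radon measure $m_F$ of full support; $L^F$ is the generator of $\mathcal{E}^F$ and $\Gamma^F$ its carré du champ. An admissible algebra is an algebra of bounded measurable functions, dense in the domain of $L^F$ (graph norm) and in every $L^p$, stable under $L^F$ and under composition with $C^\infty$ functions of several variables vanishing at $0$; on it $\Gamma^F(u)=\frac12L^F(u^2)-uL^Fu$ and $\Gamma_2^F(u)=\frac12L^F\Gamma^F(u)-\Gamma^F(u,L^Fu)$. Let $I_K=[0,\pi/\sqrt K]$ for $K>0$ and $[0,\infty)$ for $K\le0$, $\hat I_K$ its interior, $\sin_K(r)=\sin(\sqrt Kr)/\sqrt K$, $r$, $\sinh(\sqrt{-K}r)/\sqrt{-K}$ for $K>0,=0,<0$. The $(K,N)$-cone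 $\mathcal{E}^C$ is the closure in $L^2(I_K\times F,m_C)$, $m_C=\sin_K^N(r)dr\otimes m_F$, of $\mathcal{E}^C(u)=\int_F\int_{I_K}|\partial_ru(r,x)|^2\sin_K^N(r)\,dr\,dm_F(x)+\int_{I_K}\mathcal{E}^F(u(r,\cdot))\sin_K^{N-2}(r)\,dr$ defined on the algebraic tensor product $C_0^\infty(\hat I_K)\otimes D(\mathcal{E}^F)$; $L^C$, $\Gamma^C$ are its generator and carré du champ and $\Gamma_2^C(u)=\frac12L^C\Gamma^C(u)-\Gamma^C(u,L^Cu)$. *)

theory Defs
  imports "HOL-Analysis.Analysis" "HOL-Probability.Probability"
begin

text \<open>Elements of L2 are represented by measurable real functions; all notions below
are invariant under modification on null sets (this is part of the Dirichlet form axioms).\<close>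

definition L2 :: "'a measure \<Rightarrow> ('a \<Rightarrow> real) set" where
  "L2 M = {u. u \<in> borel_measurable M \<and> integrable M (\<lambda>x. (u x)\<^sup>2)}"

definition ess_bounded :: "'a measure \<Rightarrow> ('a \<Rightarrow> real) \<Rightarrow> bool" where
  "ess_bounded M u \<longleftrightarrow> (\<exists>C. AE x in M. \<bar>u x\<bar> \<le> C)"

definition radon_full_support :: "'a::t2_space measure \<Rightarrow> bool" where
  "radon_full_support M \<longleftrightarrow>
     locally_compact_space (euclidean :: 'a topology) \<and>
     (\<exists>S::'a set. countable S \<and> closure S = UNIV) \<and>
     sets M = sets borel \<and> space M = UNIV \<and> sigma_finite_measure M \<and>
     (\<forall>C. compact C \<longrightarrow> emeasure M C < \<infinity>) \<and>
     (\<forall>U. open U \<longrightarrow> emeasure M U = (SUP C\<in>{C. compact C \<and> C \<subseteq> U}. emeasure M C)) \<and>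
     (\<forall>B\<in>sets borel. emeasure M B = (INF U\<in>{U. open U \<and> B \<subseteq> U}. emeasure M U)) \<and>
     (\<forall>U. open U \<and> U \<noteq> {} \<longrightarrow> emeasure M U > 0)"

definition E1 :: "'a measure \<Rightarrow> (('a \<Rightarrow> real) \<Rightarrow> ('a \<Rightarrow> real) \<Rightarrow> real) \<Rightarrow> ('a \<Rightarrow> real) \<Rightarrow> real" where
  "E1 M E u = E u u + integral\<^sup>L M (\<lambda>x. (u x)\<^sup>2)"

definition dirichlet_form ::
  "'a measure \<Rightarrow> ('a \<Rightarrow> real) set \<Rightarrow> (('a \<Rightarrow> real) \<Rightarrow> ('a \<Rightarrow> real) \<Rightarrow> real) \<Rightarrow> bool" where
  "dirichlet_form M D E \<longleftrightarrow>
     D \<subseteq> L2 M \<and>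
     (\<lambda>x. 0) \<in> D \<and>
     (\<forall>u\<in>D. \<forall>v\<in>D. (\<lambda>x. u x + v x) \<in> D) \<and>
     (\<forall>u\<in>D. \<forall>a::real. (\<lambda>x. a * u x) \<in> D) \<and>
     \<comment> \<open>invariance under modification on null sets\<close>
     (\<forall>u\<in>D. \<forall>v. v \<in> borel_measurable M \<and> (AE x in M. u x = v x) \<longrightarrow>
         v \<in> D \<and> (\<forall>w\<in>D. E u w = E v w)) \<and>
     \<comment> \<open>symmetric, bilinear, nonnegative\<close>
     (\<forall>u\<in>D. \<forall>v\<in>D. E u v = E v u) \<and>
     (\<forall>u\<in>D. \<forall>v\<in>D. \<forall>w\<in>D. E (\<lambda>x. u x + v x) w = E u w + E v w) \<and>
     (\<forall>u\<in>D. \<forall>w\<in>D. \<forall>a. E (\<lambda>x. a * u x) w = a * E u w) \<and>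
     (\<forall>u\<in>D. E u u \<ge> 0) \<and>
     \<comment> \<open>densely defined\<close>
     (\<forall>f\<in>L2 M. \<forall>\<epsilon>>0. \<exists>u\<in>D. integral\<^sup>L M (\<lambda>x. (f x - u x)\<^sup>2) < \<epsilon>) \<and>
     \<comment> \<open>closed\<close>
     (\<forall>u. (\<forall>n. u n \<in> D) \<and>
          (\<forall>\<epsilon>>0. \<exists>n0. \<forall>n\<ge>n0. \<forall>m\<ge>n0. E1 M E (\<lambda>x. u n x - u m x) < \<epsilon>) \<longrightarrow>
          (\<exists>v\<in>D. (\<lambda>n. E1 M E (\<lambda>x. u n x - v x)) \<longlonglongrightarrow> 0)) \<and>
     \<comment> \<open>Markovian (unit contraction)\<close>
     (\<forall>u\<in>D. (\<lambda>x. min 1 (max 0 (u x))) \<in> D \<and>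
          E (\<lambda>x. min 1 (max 0 (u x))) (\<lambda>x. min 1 (max 0 (u x))) \<le> E u u)"

definition Cc :: "('a::topological_space \<Rightarrow> real) set" where
  "Cc = {f. continuous_on UNIV f \<and> compact (closure {x. f x \<noteq> 0})}"

definition regular_form ::
  "'a::topological_space measure \<Rightarrow> ('a \<Rightarrow> real) set \<Rightarrow> (('a \<Rightarrow> real) \<Rightarrow> ('a \<Rightarrow> real) \<Rightarrow> real) \<Rightarrow> bool" where
  "regular_form M D E \<longleftrightarrow>
     (\<forall>u\<in>D. \<forall>\<epsilon>>0. \<exists>v\<in>D \<inter> Cc. E1 M E (\<lambda>x. u x - v x) < \<epsilon>) \<and>
     (\<forall>f\<in>Cc. \<forall>\<epsilon>>0. \<exists>v\<in>D \<inter> Cc. \<forall>x. \<bar>f x - v x\<bar> < \<epsilon>)"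

text \<open>Support of (the class of) a function: support of the measure |u| m.\<close>
definition msupp :: "'a::topological_space measure \<Rightarrow> ('a \<Rightarrow> real) \<Rightarrow> 'a set" where
  "msupp M u = {x. \<forall>U. open U \<and> x \<in> U \<longrightarrow> \<not> (AE y in M. y \<in> U \<longrightarrow> u y = 0)}"

definition strongly_local ::
  "'a::topological_space measure \<Rightarrow> ('a \<Rightarrow> real) set \<Rightarrow> (('a \<Rightarrow> real) \<Rightarrow> ('a \<Rightarrow> real) \<Rightarrow> real) \<Rightarrow> bool" where
  "strongly_local M D E \<longleftrightarrow>
     (\<forall>u\<in>D. \<forall>v\<in>D. compact (msupp M u) \<and> compact (msupp M v) \<and>
        (\<exists>U c. open U \<and> msupp M u \<subseteq> U \<and> (AE y in M. y \<in> U \<longrightarrow> v y = c)) \<longrightarrow> E u v = 0)"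

definition is_cdc ::
  "'a measure \<Rightarrow> ('a \<Rightarrow> real) set \<Rightarrow> (('a \<Rightarrow> real) \<Rightarrow> ('a \<Rightarrow> real) \<Rightarrow> real) \<Rightarrow>
   ('a \<Rightarrow> real) \<Rightarrow> ('a \<Rightarrow> real) \<Rightarrow> ('a \<Rightarrow> real) \<Rightarrow> bool" where
  "is_cdc M D E u v g \<longleftrightarrow>
     u \<in> D \<and> v \<in> D \<and> ess_bounded M u \<and> ess_bounded M v \<and> integrable M g \<and>
     (\<forall>\<phi>\<in>D. ess_bounded M \<phi> \<longrightarrow>
        integral\<^sup>L M (\<lambda>x. g x * \<phi> x) =
          (E u (\<lambda>x. v x * \<phi> x) + E v (\<lambda>x. u x * \<phi> x) - E (\<lambda>x. u x * v x) \<phi>) / 2)"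

definition admits_cdc ::
  "'a measure \<Rightarrow> ('a \<Rightarrow> real) set \<Rightarrow> (('a \<Rightarrow> real) \<Rightarrow> ('a \<Rightarrow> real) \<Rightarrow> real) \<Rightarrow> bool" where
  "admits_cdc M D E \<longleftrightarrow> (\<forall>u\<in>D. ess_bounded M u \<longrightarrow> (\<exists>g. is_cdc M D E u u g))"

definition cdc ::
  "'a measure \<Rightarrow> ('a \<Rightarrow> real) set \<Rightarrow> (('a \<Rightarrow> real) \<Rightarrow> ('a \<Rightarrow> real) \<Rightarrow> real) \<Rightarrow>
   ('a \<Rightarrow> real) \<Rightarrow> ('a \<Rightarrow> real) \<Rightarrow> ('a \<Rightarrow> real)" where
  "cdc M D E u v = (SOME g. is_cdc M D E u v g)"

definition is_gen ::
  "'a measure \<Rightarrow> ('a \<Rightarrow> real) set \<Rightarrow> (('a \<Rightarrow> real) \<Rightarrow> ('a \<Rightarrow> real) \<Rightarrow> real) \<Rightarrow>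
   ('a \<Rightarrow> real) \<Rightarrow> ('a \<Rightarrow> real) \<Rightarrow> bool" where
  "is_gen M D E u f \<longleftrightarrow> u \<in> D \<and> f \<in> L2 M \<and>
     (\<forall>v\<in>D. E u v = - integral\<^sup>L M (\<lambda>x. f x * v x))"

definition gen_dom ::
  "'a measure \<Rightarrow> ('a \<Rightarrow> real) set \<Rightarrow> (('a \<Rightarrow> real) \<Rightarrow> ('a \<Rightarrow> real) \<Rightarrow> real) \<Rightarrow> ('a \<Rightarrow> real) set" where
  "gen_dom M D E = {u. \<exists>f. is_gen M D E u f}"

definition gen ::
  "'a measure \<Rightarrow> ('a \<Rightarrow> real) set \<Rightarrow> (('a \<Rightarrow> real) \<Rightarrow> ('a \<Rightarrow> real) \<Rightarrow> real) \<Rightarrow>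
   ('a \<Rightarrow> real) \<Rightarrow> ('a \<Rightarrow> real)" where
  "gen M D E u = (SOME f. is_gen M D E u f)"

text \<open>R^n is represented as the subspace of nat => real of functions vanishing from n on
(the product topology restricted to it is the Euclidean topology).\<close>
definition fin_coords :: "nat \<Rightarrow> (nat \<Rightarrow> real) set" where
  "fin_coords n = {x. \<forall>i\<ge>n. x i = 0}"

definition partial_deriv :: "nat \<Rightarrow> ((nat \<Rightarrow> real) \<Rightarrow> real) \<Rightarrow> (nat \<Rightarrow> real) \<Rightarrow> real" where
  "partial_deriv i f x = deriv (\<lambda>t. f (x(i := t))) (x i)"

fun Ck_fun :: "nat \<Rightarrow> nat \<Rightarrow> ((nat \<Rightarrow> real) \<Rightarrow> real) \<Rightarrow> bool" where
  "Ck_fun n 0 f = continuous_on (fin_coords n) f"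
| "Ck_fun n (Suc k) f = (continuous_on (fin_coords n) f \<and>
     (\<forall>i<n. (\<forall>x\<in>fin_coords n. (\<lambda>t. f (x(i := t))) differentiable (at (x i))) \<and>
            Ck_fun n k (partial_deriv i f)))"

definition smooth_fun :: "nat \<Rightarrow> ((nat \<Rightarrow> real) \<Rightarrow> real) \<Rightarrow> bool" where
  "smooth_fun n f \<longleftrightarrow> (\<forall>k. Ck_fun n k f)"

definition admissible_algebra ::
  "'a measure \<Rightarrow> ('a \<Rightarrow> real) set \<Rightarrow> (('a \<Rightarrow> real) \<Rightarrow> ('a \<Rightarrow> real) \<Rightarrow> real) \<Rightarrow>
   ('a \<Rightarrow> real) set \<Rightarrow> bool" where
  "admissible_algebra M D E A \<longleftrightarrow>
     \<comment> \<open>algebra of bounded measurable functions contained in the domain of the generator\<close>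
     (\<forall>u\<in>A. u \<in> borel_measurable M \<and> (\<exists>C. \<forall>x. \<bar>u x\<bar> \<le> C)) \<and>
     A \<subseteq> gen_dom M D E \<and>
     (\<lambda>x. 0) \<in> A \<and>
     (\<forall>u\<in>A. \<forall>v\<in>A. (\<lambda>x. u x + v x) \<in> A \<and> (\<lambda>x. u x * v x) \<in> A) \<and>
     (\<forall>u\<in>A. \<forall>a::real. (\<lambda>x. a * u x) \<in> A) \<and>
     \<comment> \<open>dense in D(L) for the graph norm\<close>
     (\<forall>u\<in>gen_dom M D E. \<forall>\<epsilon>>0. \<exists>a\<in>A.
        integral\<^sup>L M (\<lambda>x. (u x - a x)\<^sup>2) +
        integral\<^sup>L M (\<lambda>x. (gen M D E u x - gen M D E a x)\<^sup>2) < \<epsilon>) \<and>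
     \<comment> \<open>dense in every L^p, 1 <= p < infinity\<close>
     (\<forall>p::real. p \<ge> 1 \<longrightarrow> (\<forall>f\<in>borel_measurable M. integrable M (\<lambda>x. \<bar>f x\<bar> powr p) \<longrightarrow>
        (\<forall>\<epsilon>>0. \<exists>a\<in>A. integrable M (\<lambda>x. \<bar>f x - a x\<bar> powr p) \<and>
                     integral\<^sup>L M (\<lambda>x. \<bar>f x - a x\<bar> powr p) < \<epsilon>))) \<and>
     \<comment> \<open>stable under L\<close>
     (\<forall>u\<in>A. \<exists>w\<in>A. is_gen M D E u w) \<and>
     \<comment> \<open>stable under composition with smooth functions vanishing at 0\<close>
     (\<forall>n \<Phi> us. smooth_fun n \<Phi> \<and> \<Phi> (\<lambda>i. 0) = 0 \<and> (\<forall>i<n. us i \<in> A) \<longrightarrow>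
        (\<lambda>x. \<Phi> (\<lambda>i. if i < n then us i x else 0)) \<in> A)"

definition GammaA ::
  "'a measure \<Rightarrow> ('a \<Rightarrow> real) set \<Rightarrow> (('a \<Rightarrow> real) \<Rightarrow> ('a \<Rightarrow> real) \<Rightarrow> real) \<Rightarrow>
   ('a \<Rightarrow> real) \<Rightarrow> ('a \<Rightarrow> real) \<Rightarrow> ('a \<Rightarrow> real)" where
  "GammaA M D E u v = (\<lambda>x. (gen M D E (\<lambda>y. u y * v y) x
        - u x * gen M D E v x - v x * gen M D E u x) / 2)"

definition Gamma2A ::
  "'a measure \<Rightarrow> ('a \<Rightarrow> real) set \<Rightarrow> (('a \<Rightarrow> real) \<Rightarrow> ('a \<Rightarrow> real) \<Rightarrow> real) \<Rightarrow>
   ('a \<Rightarrow> real) \<Rightarrow> ('a \<Rightarrow> real)" where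
  "Gamma2A M D E u = (\<lambda>x. gen M D E (GammaA M D E u u) x / 2
        - GammaA M D E u (gen M D E u) x)"

definition sinK :: "real \<Rightarrow> real \<Rightarrow> real" where
  "sinK K r = (if K > 0 then sin (sqrt K * r) / sqrt K
               else if K = 0 then r else sinh (sqrt (- K) * r) / sqrt (- K))"

definition IK :: "real \<Rightarrow> real set" where
  "IK K = (if K > 0 then {0 .. pi / sqrt K} else {0 ..})"

definition IK_int :: "real \<Rightarrow> real set" where
  "IK_int K = (if K > 0 then {0 <..< pi / sqrt K} else {0 <..})"

definition Cc_smooth_on :: "real set \<Rightarrow> (real \<Rightarrow> real) set" where
  "Cc_smooth_on S = {\<phi>. (\<forall>k x. ((deriv ^^ k) \<phi>) differentiable (at x)) \<and>
      compact (closure {r. \<phi> r \<noteq> 0}) \<and> closure {r. \<phi> r \<noteq> 0} \<subseteq> S}"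

definition tensor_dom :: "real \<Rightarrow> ('a \<Rightarrow> real) set \<Rightarrow> (real \<times> 'a \<Rightarrow> real) set" where
  "tensor_dom K B = {u. \<exists>(n::nat) \<phi> f. (\<forall>i<n. \<phi> i \<in> Cc_smooth_on (IK_int K) \<and> f i \<in> B) \<and>
                        u = (\<lambda>(r, x). \<Sum>i<n. \<phi> i r * f i x)}"

definition cone_measure :: "real \<Rightarrow> real \<Rightarrow> 'a measure \<Rightarrow> (real \<times> 'a) measure" where
  "cone_measure K N M =
     density lborel (\<lambda>r. ennreal (indicator (IK K) r * sinK K r powr N)) \<Otimes>\<^sub>M M"

definition cone_Q0 ::
  "real \<Rightarrow> real \<Rightarrow> 'a measure \<Rightarrow> (('a \<Rightarrow> real) \<Rightarrow> ('a \<Rightarrow> real) \<Rightarrow> real) \<Rightarrow>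
   (real \<times> 'a \<Rightarrow> real) \<Rightarrow> real" where
  "cone_Q0 K N M E u =
     integral\<^sup>L (cone_measure K N M) (\<lambda>(r, x). (deriv (\<lambda>s. u (s, x)) r)\<^sup>2) +
     integral\<^sup>L lborel (\<lambda>r. indicator (IK K) r *
        E (\<lambda>x. u (r, x)) (\<lambda>x. u (r, x)) * sinK K r powr (N - 2))"

definition approx_seq ::
  "real \<Rightarrow> real \<Rightarrow> 'a measure \<Rightarrow> ('a \<Rightarrow> real) set \<Rightarrow> (('a \<Rightarrow> real) \<Rightarrow> ('a \<Rightarrow> real) \<Rightarrow> real) \<Rightarrow>
   (real \<times> 'a \<Rightarrow> real) \<Rightarrow> (nat \<Rightarrow> real \<times> 'a \<Rightarrow> real) \<Rightarrow> bool" where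
  "approx_seq K N M D E u s \<longleftrightarrow>
     (\<forall>n. s n \<in> tensor_dom K D) \<and>
     (\<lambda>n. integral\<^sup>L (cone_measure K N M) (\<lambda>z. (s n z - u z)\<^sup>2)) \<longlonglongrightarrow> 0 \<and>
     (\<forall>\<epsilon>>0. \<exists>n0. \<forall>n\<ge>n0. \<forall>m\<ge>n0. cone_Q0 K N M E (\<lambda>z. s n z - s m z) < \<epsilon>)"

definition cone_dom ::
  "real \<Rightarrow> real \<Rightarrow> 'a measure \<Rightarrow> ('a \<Rightarrow> real) set \<Rightarrow> (('a \<Rightarrow> real) \<Rightarrow> ('a \<Rightarrow> real) \<Rightarrow> real) \<Rightarrow>
   (real \<times> 'a \<Rightarrow> real) set" where
  "cone_dom K N M D E = {u. u \<in> L2 (cone_measure K N M) \<and> (\<exists>s. approx_seq K N M D E u s)}"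

definition cone_Q ::
  "real \<Rightarrow> real \<Rightarrow> 'a measure \<Rightarrow> ('a \<Rightarrow> real) set \<Rightarrow> (('a \<Rightarrow> real) \<Rightarrow> ('a \<Rightarrow> real) \<Rightarrow> real) \<Rightarrow>
   (real \<times> 'a \<Rightarrow> real) \<Rightarrow> real" where
  "cone_Q K N M D E u = (SOME l. \<exists>s. approx_seq K N M D E u s \<and>
                              (\<lambda>n. cone_Q0 K N M E (s n)) \<longlonglongrightarrow> l)"

definition cone_E ::
  "real \<Rightarrow> real \<Rightarrow> 'a measure \<Rightarrow> ('a \<Rightarrow> real) set \<Rightarrow> (('a \<Rightarrow> real) \<Rightarrow> ('a \<Rightarrow> real) \<Rightarrow> real) \<Rightarrow>
   (real \<times> 'a \<Rightarrow> real) \<Rightarrow> (real \<times> 'a \<Rightarrow> real) \<Rightarrow> real" where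
  "cone_E K N M D E u v = (cone_Q K N M D E (\<lambda>z. u z + v z) - cone_Q K N M D E (\<lambda>z. u z - v z)) / 4"

end

theory Submission
  imports Defs
begin

text \<open>
  On tensors \<open>u = \<Sum> \<phi>\<^sub>i \<otimes> f\<^sub>i\<close> with \<open>f\<^sub>i\<close> in the algebra, the cone generator is
  \<open>L u = u\<^sub>r\<^sub>r + N (s'/s) u\<^sub>r + s\<^sup>-\<^sup>2 L\<^sup>F u\<close>, where \<open>s\<close> is the radial profile; all cone quantities are
  therefore explicit, and the third radial derivatives cancel in the iterated carre du champ.
  For \<open>u = \<phi> \<otimes> f + \<psi> \<otimes> g\<close> and a radius \<open>r\<^sub>0\<close>, prescribe \<open>\<phi> = s\<close>, \<open>\<phi>' = s'\<close> and
  \<open>\<psi> = \<psi>' = 0\<close>, \<open>\<psi>'' = 1\<close> at \<open>r\<^sub>0\<close>: the mixed Hessian terms vanish, and \<open>g\<close> can be chosen so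
  that \<open>u\<^sub>r\<^sub>r = L u / (N + 1)\<close> there, which is the equality case of the Cauchy-Schwarz inequality
  between radial and fibre parts. The cone inequality at \<open>r\<^sub>0\<close> then is, by \<open>s'\<^sup>2 + K s\<^sup>2 = 1\<close>, the
  fibre inequality times \<open>s\<^sup>-\<^sup>2\<close>.
\<close>

text \<open>Why the prescribed values work: the mixed radial-fibre Hessian of \<phi> \<otimes> f is
  a multiple of the derivative of \<phi>/s, which the values s and s' make zero; a factor with
  vanishing first-order jet adds only its second derivative. With h the second radial derivative and
  t the rest of the cone generator, (h + t)^2/(N + 1) \<le> h^2 + t^2/N is an equality exactly when
  h = t/N. As h is affine in g, this is solved for g at all points of the fibre at once, by a linear
  combination of f and its fibre generator, hence inside the algebra. The obstacle is that no cone
  object comes with a formula. The form is a limit picked by Hilbert choice among all approximating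
  sequences, so its value on tensors requires closability. Generator and carre du champ are picked
  by choice as well, hence known only almost everywhere and only after testing against a class that
  separates functions. Finally the hypothesis holds off a null set that depends on u, while the
  argument needs one given radius; continuity in r of the explicit expressions bridges this.\<close>

section \<open>Smooth functions of one variable\<close>

text \<open>The successive derivatives are existential witnesses instead of iterates of
  \<open>deriv\<close>: closure under sums, products and inverses is then an induction on
  \<open>k\<close> that never computes a higher derivative. \<open>smooth_real_iff\<close>
  translates back.\<close>

fun ndiff :: "real set \<Rightarrow> nat \<Rightarrow> (real \<Rightarrow> real) \<Rightarrow> bool" where
  "ndiff S 0 f = True"
| "ndiff S (Suc k) f = (\<exists>g. (\<forall>x\<in>S. (f has_real_derivative g x) (at x)) \<and> ndiff S k g)"

definition smooth_real :: "real set \<Rightarrow> (real \<Rightarrow> real) \<Rightarrow> bool" where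
  "smooth_real S f \<longleftrightarrow> (\<forall>k. ndiff S k f)"

lemma ndiff_cong:
  assumes "open S" "\<And>x. x \<in> S \<Longrightarrow> f x = g x" "ndiff S k f"
  shows "ndiff S k g"
proof (cases k)
  case (Suc n)
  with assms obtain f' where f': "\<forall>x\<in>S. (f has_real_derivative f' x) (at x)" "ndiff S n f'" by auto
  have "\<forall>x\<in>S. (g has_real_derivative f' x) (at x)"
    using f'(1) assms(1,2) has_field_derivative_transform_within_open by blast
  with f' Suc show ?thesis by auto
qed auto

lemma ndiff_Suc: "ndiff S (Suc k) f \<Longrightarrow> ndiff S k f"
proof (induction k arbitrary: f)
  case (Suc k) then show ?case by (metis ndiff.simps(2))
qed auto

lemma ndiff_mono_set: "ndiff S k f \<Longrightarrow> T \<subseteq> S \<Longrightarrow> ndiff T k f"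
proof (induction k arbitrary: f)
  case (Suc k) then show ?case by (metis ndiff.simps(2) subsetD)
qed auto

lemma ndiff_const: "ndiff S k (\<lambda>x. c)"
proof (induction k arbitrary: c)
  case (Suc k)
  show ?case using Suc[of 0] by (auto intro!: exI[of _ "\<lambda>x. 0"])
qed auto

lemma ndiff_add: "ndiff S k f \<Longrightarrow> ndiff S k g \<Longrightarrow> ndiff S k (\<lambda>x. f x + g x)"
proof (induction k arbitrary: f g)
  case (Suc k)
  then obtain f' g' where f': "\<forall>x\<in>S. (f has_real_derivative f' x) (at x)" "ndiff S k f'"
    and g': "\<forall>x\<in>S. (g has_real_derivative g' x) (at x)" "ndiff S k g'" by auto
  then have "\<forall>x\<in>S. ((\<lambda>x. f x + g x) has_real_derivative f' x + g' x) (at x)"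
    by (auto intro: DERIV_add)
  with Suc.IH[OF f'(2) g'(2)] show ?case by auto
qed auto

lemma ndiff_mult: "ndiff S k f \<Longrightarrow> ndiff S k g \<Longrightarrow> ndiff S k (\<lambda>x. f x * g x)"
proof (induction k arbitrary: f g)
  case (Suc k)
  then obtain f' g' where f': "\<forall>x\<in>S. (f has_real_derivative f' x) (at x)" "ndiff S k f'"
    and g': "\<forall>x\<in>S. (g has_real_derivative g' x) (at x)" "ndiff S k g'" by auto
  then have "\<forall>x\<in>S. ((\<lambda>x. f x * g x) has_real_derivative f' x * g x + g' x * f x) (at x)"
    by (auto intro: DERIV_mult)
  moreover have "ndiff S k (\<lambda>x. f' x * g x + g' x * f x)"
    by (intro ndiff_add Suc.IH f' g' ndiff_Suc[OF Suc.prems(1)] ndiff_Suc[OF Suc.prems(2)])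
  ultimately show ?case by (auto intro!: exI[of _ "\<lambda>x. f' x * g x + g' x * f x"])
qed auto

lemma ndiff_inverse:
  "ndiff S k f \<Longrightarrow> (\<And>x. x \<in> S \<Longrightarrow> f x \<noteq> 0) \<Longrightarrow> ndiff S k (\<lambda>x. inverse (f x))"
proof (induction k arbitrary: f)
  case (Suc k)
  then obtain f' where f': "\<forall>x\<in>S. (f has_real_derivative f' x) (at x)" "ndiff S k f'" by auto
  \<comment> \<open>Written with a factor -1 and repeated products, because the closure rules cover
    constants, sums and products; the same shape replaces subtraction and powers in later
    proofs.\<close>
  let ?d = "\<lambda>x. (-1) * (f' x * (inverse (f x) * inverse (f x)))"
  have "\<forall>x\<in>S. ((\<lambda>x. inverse (f x)) has_real_derivative ?d x) (at x)"
    using f' Suc.prems(2) by (auto intro!: derivative_eq_intros)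
  moreover have "ndiff S k ?d"
    by (intro ndiff_mult ndiff_const f' Suc.IH Suc.prems(2) ndiff_Suc[OF Suc.prems(1)])
  ultimately show ?case by (auto intro!: exI[of _ ?d])
qed auto

lemma ndiff_affine: "ndiff UNIV k f \<Longrightarrow> ndiff UNIV k (\<lambda>x. f (a * x + b))"
proof (induction k arbitrary: f)
  case (Suc k)
  then obtain f' where f': "\<forall>x. (f has_real_derivative f' x) (at x)" "ndiff UNIV k f'" by auto
  have "\<forall>x. ((\<lambda>x. f (a * x + b)) has_real_derivative a * f' (a * x + b)) (at x)"
  proof
    fix x
    have "((\<lambda>x. a * x + b) has_real_derivative a) (at x)" by (auto intro!: derivative_eq_intros)
    from DERIV_chain2[OF f'(1)[rule_format] this]
    show "((\<lambda>x. f (a * x + b)) has_real_derivative a * f' (a * x + b)) (at x)"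
      by (simp add: mult.commute)
  qed
  moreover have "ndiff UNIV k (\<lambda>x. a * f' (a * x + b))"
    by (intro ndiff_mult ndiff_const Suc.IH f')
  ultimately show ?case by auto
qed auto

lemma smooth_real_mono: "smooth_real S f \<Longrightarrow> T \<subseteq> S \<Longrightarrow> smooth_real T f"
  unfolding smooth_real_def using ndiff_mono_set by blast

lemma smooth_real_const: "smooth_real S (\<lambda>x. c)"
  by (simp add: smooth_real_def ndiff_const)

lemma smooth_real_add: "smooth_real S f \<Longrightarrow> smooth_real S g \<Longrightarrow> smooth_real S (\<lambda>x. f x + g x)"
  by (simp add: smooth_real_def ndiff_add)

lemma smooth_real_mult: "smooth_real S f \<Longrightarrow> smooth_real S g \<Longrightarrow> smooth_real S (\<lambda>x. f x * g x)"
  by (simp add: smooth_real_def ndiff_mult)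

lemma smooth_real_inverse:
  "smooth_real S f \<Longrightarrow> (\<And>x. x \<in> S \<Longrightarrow> f x \<noteq> 0) \<Longrightarrow> smooth_real S (\<lambda>x. inverse (f x))"
  by (simp add: smooth_real_def ndiff_inverse)

lemma smooth_real_ident: "smooth_real S (\<lambda>x. x)"
  unfolding smooth_real_def
proof
  fix k show "ndiff S k (\<lambda>x. x)"
  proof (cases k)
    case (Suc n)
    have "\<forall>x\<in>S. ((\<lambda>x. x) has_real_derivative 1) (at x)" by auto
    with Suc show ?thesis by (auto intro!: exI[of _ "\<lambda>x. 1"] simp: ndiff_const)
  qed auto
qed

lemma smooth_real_has_deriv:
  assumes "smooth_real S f" "x \<in> S"
  shows "(f has_real_derivative deriv f x) (at x)"
proof -
  from assms(1) have "ndiff S (Suc 0) f" by (simp only: smooth_real_def)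
  with assms(2) obtain d where "(f has_real_derivative d) (at x)" by auto
  with DERIV_imp_deriv[OF this] show ?thesis by simp
qed

lemma smooth_real_deriv:
  assumes "open S" "smooth_real S f"
  shows "smooth_real S (deriv f)"
  unfolding smooth_real_def
proof
  fix k
  from assms(2) have "ndiff S (Suc k) f" by (simp only: smooth_real_def)
  then obtain g where g: "\<forall>x\<in>S. (f has_real_derivative g x) (at x)" "ndiff S k g" by auto
  show "ndiff S k (deriv f)"
    by (rule ndiff_cong[OF assms(1) _ g(2)]) (use g(1) DERIV_imp_deriv in force)
qed

lemma smooth_real_iff:
  assumes "open S"
  shows "smooth_real S f \<longleftrightarrow> (\<forall>k. \<forall>x\<in>S. (deriv ^^ k) f differentiable (at x))"
proof
  assume "smooth_real S f"
  then have "smooth_real S ((deriv ^^ k) f)" for k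
    by (induction k) (auto intro: smooth_real_deriv[OF assms])
  then show "\<forall>k. \<forall>x\<in>S. (deriv ^^ k) f differentiable (at x)"
    using smooth_real_has_deriv real_differentiable_def by blast
next
  assume a: "\<forall>k. \<forall>x\<in>S. (deriv ^^ k) f differentiable (at x)"
  have "(\<forall>k. \<forall>x\<in>S. (deriv ^^ k) f differentiable (at x)) \<Longrightarrow> ndiff S n f" for n
  proof (induction n arbitrary: f)
    case (Suc n)
    have "(deriv ^^ k) (deriv f) = (deriv ^^ Suc k) f" for k by (simp add: funpow_swap1)
    with Suc.prems have "\<forall>k. \<forall>x\<in>S. (deriv ^^ k) (deriv f) differentiable (at x)" by presburger
    from Suc.IH[OF this] have "ndiff S n (deriv f)" .
    moreover have "\<forall>x\<in>S. (f has_real_derivative deriv f x) (at x)"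
      using Suc.prems[rule_format, of _ 0] by (simp add: DERIV_deriv_iff_real_differentiable)
    ultimately show ?case by auto
  qed auto
  with a show "smooth_real S f" by (simp add: smooth_real_def)
qed

lemma smooth_real_Un:
  "open S \<Longrightarrow> open T \<Longrightarrow> smooth_real S f \<Longrightarrow> smooth_real T f \<Longrightarrow> smooth_real (S \<union> T) f"
  by (simp add: smooth_real_iff open_Un) blast

lemma smooth_real_cong:
  "open S \<Longrightarrow> (\<And>x. x \<in> S \<Longrightarrow> f x = g x) \<Longrightarrow> smooth_real S f \<Longrightarrow> smooth_real S g"
  unfolding smooth_real_def using ndiff_cong by blast

text \<open>Any compact set off which the function vanishes will do: such sets combine under sums
  and products more easily than the closure of the nonzero set.\<close>

lemma Cc_smooth_on_iff:
  "\<phi> \<in> Cc_smooth_on S \<longleftrightarrow> smooth_real UNIV \<phi> \<and>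
     (\<exists>T. compact T \<and> T \<subseteq> S \<and> (\<forall>r. r \<notin> T \<longrightarrow> \<phi> r = 0))"
proof -
  have "(compact (closure {r. \<phi> r \<noteq> 0}) \<and> closure {r. \<phi> r \<noteq> 0} \<subseteq> S) \<longleftrightarrow>
     (\<exists>T. compact T \<and> T \<subseteq> S \<and> (\<forall>r. r \<notin> T \<longrightarrow> \<phi> r = 0))" (is "?L \<longleftrightarrow> ?R")
  proof
    assume ?L
    then show ?R using closure_subset[of "{r. \<phi> r \<noteq> 0}"] by blast
  next
    assume ?R
    then obtain T where T: "compact T" "T \<subseteq> S" "\<forall>r. r \<notin> T \<longrightarrow> \<phi> r = 0" by auto
    then have "closure {r. \<phi> r \<noteq> 0} \<subseteq> T" by (intro closure_minimal compact_imp_closed) auto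
    with T show ?L by (metis compact_Int_closed closed_closure inf.absorb_iff2 order_trans)
  qed
  then show ?thesis by (auto simp: Cc_smooth_on_def smooth_real_iff)
qed

lemma Cc_smooth_on_add:
  assumes "\<phi> \<in> Cc_smooth_on S" "\<psi> \<in> Cc_smooth_on S"
  shows "(\<lambda>r. \<phi> r + \<psi> r) \<in> Cc_smooth_on S"
proof -
  obtain T U where "compact T" "T \<subseteq> S" "\<forall>r. r \<notin> T \<longrightarrow> \<phi> r = 0" "compact U" "U \<subseteq> S" "\<forall>r. r \<notin> U \<longrightarrow> \<psi> r = 0"
    using assms unfolding Cc_smooth_on_iff by blast
  then have "compact (T \<union> U)" "T \<union> U \<subseteq> S" "\<forall>r. r \<notin> T \<union> U \<longrightarrow> \<phi> r + \<psi> r = 0" by auto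
  with assms show ?thesis
    unfolding Cc_smooth_on_iff by (blast intro: smooth_real_add)
qed

text \<open>The factor \<open>g\<close> may be singular at the ends of \<open>S\<close>: the product
  vanishes on the open complement of the support, and this complement and \<open>S\<close> cover the
  line. This admits the weights \<open>wK\<close> and \<open>bK\<close>.\<close>

lemma Cc_smooth_on_mult_smooth:
  assumes "open S" "smooth_real S g" "\<phi> \<in> Cc_smooth_on S"
  shows "(\<lambda>r. g r * \<phi> r) \<in> Cc_smooth_on S"
proof -
  obtain T where T: "compact T" "T \<subseteq> S" "\<forall>r. r \<notin> T \<longrightarrow> \<phi> r = 0"
    using assms unfolding Cc_smooth_on_iff by blast
  have o: "open (- T)" using T(1) by (simp add: compact_imp_closed open_Compl)
  have "smooth_real (- T) (\<lambda>r. g r * \<phi> r)"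
    by (rule smooth_real_cong[OF o _ smooth_real_const[of _ 0]]) (use T in auto)
  moreover have "smooth_real S (\<lambda>r. g r * \<phi> r)"
    using assms smooth_real_mono[of UNIV \<phi> S]
    by (auto intro!: smooth_real_mult simp: Cc_smooth_on_iff)
  ultimately have "smooth_real (S \<union> - T) (\<lambda>r. g r * \<phi> r)"
    using smooth_real_Un assms(1) o by blast
  moreover have "S \<union> - T = UNIV" using T by auto
  ultimately show ?thesis using T unfolding Cc_smooth_on_iff by auto
qed

lemma Cc_smooth_on_mult:
  "open S \<Longrightarrow> \<phi> \<in> Cc_smooth_on S \<Longrightarrow> \<psi> \<in> Cc_smooth_on S \<Longrightarrow> (\<lambda>r. \<phi> r * \<psi> r) \<in> Cc_smooth_on S"
  using Cc_smooth_on_mult_smooth[of S \<phi> \<psi>] smooth_real_mono[of UNIV \<phi> S] by (auto simp: Cc_smooth_on_iff)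

lemma Cc_smooth_on_cmult:
  "open S \<Longrightarrow> \<phi> \<in> Cc_smooth_on S \<Longrightarrow> (\<lambda>r. c * \<phi> r) \<in> Cc_smooth_on S"
  by (rule Cc_smooth_on_mult_smooth) (auto intro: smooth_real_const)

lemma Cc_smooth_on_has_deriv:
  "\<phi> \<in> Cc_smooth_on S \<Longrightarrow> (\<phi> has_real_derivative deriv \<phi> r) (at r)"
  by (auto simp: Cc_smooth_on_iff intro: smooth_real_has_deriv)

lemma Cc_smooth_on_deriv:
  assumes "\<phi> \<in> Cc_smooth_on S"
  shows "deriv \<phi> \<in> Cc_smooth_on S"
proof -
  obtain T where T: "compact T" "T \<subseteq> S" "\<forall>r. r \<notin> T \<longrightarrow> \<phi> r = 0"
    using assms unfolding Cc_smooth_on_iff by blast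
  have "deriv \<phi> r = 0" if "r \<notin> T" for r
  proof -
    have "((\<lambda>x. 0) has_real_derivative 0) (at r)" by auto
    then have "(\<phi> has_real_derivative 0) (at r)"
      by (rule has_field_derivative_transform_within_open[where S = "- T"])
         (use T that in \<open>auto simp: compact_imp_closed open_Compl\<close>)
    then show ?thesis by (rule DERIV_imp_deriv)
  qed
  with T assms show ?thesis unfolding Cc_smooth_on_iff using smooth_real_deriv[of UNIV] by auto
qed

lemma Cc_smooth_on_continuous: "\<phi> \<in> Cc_smooth_on S \<Longrightarrow> continuous_on T \<phi>"
  using Cc_smooth_on_has_deriv[of \<phi>] by (meson DERIV_isCont continuous_at_imp_continuous_on)

section \<open>Flat functions, bumps and functions with a prescribed jet\<close>

definition flat_exp :: "nat \<Rightarrow> real \<Rightarrow> real" where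
  "flat_exp k x = (if x > 0 then (1 / x) ^ k * exp (- (1 / x)) else 0)"

text \<open>The power of 1/x in front of exp(-1/x) is kept as an index so that differentiation stays
  inside the family, and smoothness follows by induction. At 0 the substitution t = 1/y turns the
  difference quotient into y^(k+1)/exp y.\<close>

lemma flat_exp_has_deriv:
  "(flat_exp k has_real_derivative (flat_exp (k + 2) x + (- real k) * flat_exp (k + 1) x)) (at x)"
proof -
  consider "x > 0" | "x < 0" | "x = 0" by linarith
  then show ?thesis
  proof cases
    case 1
    have "((\<lambda>x. (1 / x) ^ k * exp (- (1 / x))) has_real_derivative
        (flat_exp (k + 2) x + (- real k) * flat_exp (k + 1) x)) (at x)"
      using 1
      apply (auto intro!: derivative_eq_intros simp: flat_exp_def)
      apply (cases k)
       apply (auto simp: field_simps power2_eq_square)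
      done
    then show ?thesis
      by (rule has_field_derivative_transform_within_open[where S = "{0<..}"])
         (use 1 in \<open>auto simp: flat_exp_def\<close>)
  next
    case 2
    have "((\<lambda>x. 0) has_real_derivative 0) (at x)" by auto
    then have "(flat_exp k has_real_derivative 0) (at x)"
      by (rule has_field_derivative_transform_within_open[where S = "{..<0}"])
         (use 2 in \<open>auto simp: flat_exp_def\<close>)
    then show ?thesis using 2 by (simp add: flat_exp_def)
  next
    case 3
    have "((\<lambda>y::real. y ^ (k + 1) / exp y) \<longlongrightarrow> 0) at_top" by (rule tendsto_power_div_exp_0)
    then have "((\<lambda>t::real. (inverse t) ^ (k + 1) / exp (inverse t)) \<longlongrightarrow> 0) (at_right 0)"
      by (rule filterlim_compose) (rule filterlim_inverse_at_top_right)
    then have R: "((\<lambda>t. flat_exp k t / t) \<longlongrightarrow> 0) (at_right 0)"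
      by (rule Lim_transform_eventually)
         (auto simp: eventually_at_right_less flat_exp_def exp_minus field_simps
           intro!: eventually_at_rightI[of 0 1])
    have L: "((\<lambda>t. flat_exp k t / t) \<longlongrightarrow> 0) (at_left 0)"
      by (rule Lim_transform_eventually[OF tendsto_const])
         (auto simp: flat_exp_def intro!: eventually_at_leftI[of "-1" 0])
    from R L have "((\<lambda>t. flat_exp k t / t) \<longlongrightarrow> 0) (at 0)" by (simp add: filterlim_split_at)
    then show ?thesis using 3
      by (simp add: flat_exp_def has_field_derivative_iff)
  qed
qed

lemma smooth_flat_exp: "smooth_real UNIV (flat_exp k)"
proof -
  have "ndiff UNIV n (flat_exp k)" for n
  proof (induction n arbitrary: k)
    case (Suc n)
    show ?case
      using flat_exp_has_deriv
      by (auto intro!: exI[of _ "\<lambda>x. flat_exp (k + 2) x + (- real k) * flat_exp (k + 1) x"]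
          ndiff_add ndiff_mult ndiff_const Suc simp del: add_2_eq_Suc' Suc_eq_plus1[symmetric])
  qed auto
  then show ?thesis by (simp add: smooth_real_def)
qed

definition bump :: "real \<Rightarrow> real \<Rightarrow> real \<Rightarrow> real" where
  "bump a b r = flat_exp 0 (r - a) * flat_exp 0 (b - r)"

lemma smooth_bump: "smooth_real UNIV (bump a b)"
proof -
  have "ndiff UNIV k (flat_exp 0)" for k using smooth_flat_exp by (simp add: smooth_real_def)
  from ndiff_mult[OF ndiff_affine[OF this, of _ 1 "-a"] ndiff_affine[OF this, of _ "-1" b]]
  show ?thesis unfolding smooth_real_def bump_def[abs_def] by (simp add: algebra_simps)
qed

lemma bump_bounds: "0 \<le> bump a b r" "bump a b r \<le> 1" "bump a b r > 0 \<longleftrightarrow> r \<in> {a<..<b}"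
  "r \<notin> {a<..<b} \<Longrightarrow> bump a b r = 0"
  by (auto simp: bump_def flat_exp_def mult_le_one)

lemma bump_Cc_smooth: "{a..b} \<subseteq> S \<Longrightarrow> bump a b \<in> Cc_smooth_on S"
  unfolding Cc_smooth_on_iff using smooth_bump bump_bounds(4)
  by (auto intro!: exI[of _ "{a..b}"])

text \<open>Polynomials in r - r0 times a bump; the coefficients are solved from the value and the
  first derivative of the bump at r0.\<close>

lemma Cc_smooth_on_jet:
  assumes S: "open S" "r0 \<in> S"
  shows "\<exists>\<phi>\<in>Cc_smooth_on S. \<phi> r0 = a \<and> deriv \<phi> r0 = b"
    and "\<exists>\<psi>\<in>Cc_smooth_on S. \<psi> r0 = 0 \<and> deriv \<psi> r0 = 0 \<and> deriv (deriv \<psi>) r0 = 1"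
proof -
  from S obtain e where e: "e > 0" "cball r0 e \<subseteq> S" using open_contains_cball by blast
  define \<beta> where "\<beta> = bump (r0 - e) (r0 + e)"
  have "{r0 - e..r0 + e} \<subseteq> S" using e(2) by (auto simp: cball_def dist_real_def abs_le_iff subset_iff)
  then have \<beta>: "\<beta> \<in> Cc_smooth_on S" unfolding \<beta>_def by (rule bump_Cc_smooth)
  have pos: "\<beta> r0 > 0" using e bump_bounds(3) unfolding \<beta>_def by auto
  note d = Cc_smooth_on_has_deriv[OF \<beta>] Cc_smooth_on_has_deriv[OF Cc_smooth_on_deriv[OF \<beta>]]
  note sm = smooth_real_add smooth_real_mult smooth_real_const smooth_real_ident
  define \<alpha> \<gamma> where "\<alpha> = a / \<beta> r0" and "\<gamma> = (b - \<alpha> * deriv \<beta> r0) / \<beta> r0"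
  let ?p = "\<lambda>r. (\<alpha> + \<gamma> * (r + (- r0))) * \<beta> r"
  have "?p \<in> Cc_smooth_on S" by (intro Cc_smooth_on_mult_smooth S \<beta> sm)
  moreover have "(?p has_real_derivative \<gamma> * \<beta> r0 + \<alpha> * deriv \<beta> r0) (at r0)"
    by (auto intro!: derivative_eq_intros d)
  then have "deriv ?p r0 = b" using pos by (auto simp: \<gamma>_def dest!: DERIV_imp_deriv)
  moreover have "?p r0 = a" using pos by (simp add: \<alpha>_def)
  ultimately show "\<exists>\<phi>\<in>Cc_smooth_on S. \<phi> r0 = a \<and> deriv \<phi> r0 = b"
    by (intro bexI[of _ ?p] conjI)
  \<comment> \<open>At a double zero the second derivative is 2 \<beta>(r0) times the coefficient of
    the square, hence this constant.\<close>
  let ?c = "1 / (2 * \<beta> r0)"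
  let ?q = "\<lambda>r. (?c * ((r + (- r0)) * (r + (- r0)))) * \<beta> r"
  let ?q' = "\<lambda>r. ?c * (2 * (r - r0) * \<beta> r + (r - r0)\<^sup>2 * deriv \<beta> r)"
  have "?q \<in> Cc_smooth_on S" by (intro Cc_smooth_on_mult_smooth S \<beta> sm)
  moreover have "(?q has_real_derivative ?q' r) (at r)" for r
    using pos by (auto intro!: derivative_eq_intros d simp: field_simps power2_eq_square)
  then have q': "deriv ?q = ?q'" by (auto dest!: DERIV_imp_deriv)
  moreover have "(?q' has_real_derivative 1) (at r0)"
    using pos by (auto intro!: derivative_eq_intros d)
  then have "deriv ?q' r0 = 1" by (rule DERIV_imp_deriv)
  ultimately show "\<exists>\<psi>\<in>Cc_smooth_on S. \<psi> r0 = 0 \<and> deriv \<psi> r0 = 0 \<and> deriv (deriv \<psi>) r0 = 1"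
    by (intro bexI[of _ ?q]) auto
qed

section \<open>The radial weight\<close>

definition cosK :: "real \<Rightarrow> real \<Rightarrow> real" where
  "cosK K r = (if K > 0 then cos (sqrt K * r) else if K = 0 then 1 else cosh (sqrt (- K) * r))"

lemma sinK_has_deriv: "(sinK K has_real_derivative cosK K r) (at r)"
proof -
  consider "K > 0" | "K = 0" | "K < 0" by linarith
  then show ?thesis
  proof cases
    case 1
    have "((\<lambda>r. sin (sqrt K * r) / sqrt K) has_real_derivative (cos (sqrt K * r) * sqrt K) / sqrt K) (at r)"
      by (intro DERIV_cdivide) (auto intro!: derivative_eq_intros)
    with 1 show ?thesis by (simp add: sinK_def[abs_def] cosK_def)
  next
    case 3
    have "((\<lambda>r. sinh (sqrt (- K) * r) / sqrt (- K)) has_real_derivative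
        (cosh (sqrt (- K) * r) * sqrt (- K)) / sqrt (- K)) (at r)"
      by (intro DERIV_cdivide) (auto intro!: derivative_eq_intros)
    with 3 show ?thesis by (simp add: sinK_def[abs_def] cosK_def)
  qed (auto simp: sinK_def[abs_def] cosK_def)
qed

lemma cosK_has_deriv: "(cosK K has_real_derivative - K * sinK K r) (at r)"
proof -
  consider "K > 0" | "K = 0" | "K < 0" by linarith
  then show ?thesis
  proof cases
    case 1
    then have "sqrt K * sqrt K = K" by simp
    then have "sin (sqrt K * r) * sqrt K = K * sin (sqrt K * r) / sqrt K"
      using 1 by (simp add: field_simps)
    with 1 show ?thesis unfolding sinK_def cosK_def[abs_def]
      by (auto intro!: derivative_eq_intros)
  next
    case 3
    then have "sqrt (- K) * sqrt (- K) = - K" by simp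
    then have "sqrt (- K) = - K / sqrt (- K)" using 3 by (metis nonzero_mult_div_cancel_right real_sqrt_eq_zero_cancel_iff neg_equal_0_iff_equal less_irrefl)
    then have "sinh (sqrt (- K) * r) * sqrt (- K) = - (K * sinh (sqrt (- K) * r) / sqrt (- K))"
      by (metis minus_divide_left mult.commute mult_minus_right times_divide_eq_right)
    with 3 show ?thesis unfolding sinK_def cosK_def[abs_def]
      by (auto intro!: derivative_eq_intros)
  qed (auto simp: sinK_def cosK_def[abs_def])
qed

lemma cosK_sinK_pythagoras: "(cosK K r)\<^sup>2 + K * (sinK K r)\<^sup>2 = 1"
proof -
  consider "K > 0" | "K = 0" | "K < 0" by linarith
  then show ?thesis
  proof cases
    case 3
    have "(sqrt (-K))\<^sup>2 = - K" using 3 by simp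
    then have "K * (sinh (sqrt (- K) * r))\<^sup>2 / (sqrt (-K))\<^sup>2 = - (sinh (sqrt (- K) * r))\<^sup>2" using 3
      by (simp add: field_simps)
    then show ?thesis using 3 by (simp add: sinK_def cosK_def power_divide cosh_square_eq)
  qed (auto simp: sinK_def cosK_def power_divide)
qed

lemma open_IK_int: "open (IK_int K)"
  by (simp add: IK_int_def)

lemma IK_int_subset: "IK_int K \<subseteq> IK K"
  by (auto simp: IK_int_def IK_def)

lemma IK_int_nonempty: "\<exists>r. r \<in> IK_int K"
  by (cases "K > 0") (auto simp: IK_int_def intro: dense exI[of _ 1])

lemma sinK_pos: "r \<in> IK_int K \<Longrightarrow> sinK K r > 0"
proof -
  assume r: "r \<in> IK_int K"
  show ?thesis
  proof (cases "K > 0")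
    case True
    then have "0 < sqrt K * r" "sqrt K * r < pi" using r by (auto simp: IK_int_def field_simps)
    then show ?thesis using True by (simp add: sinK_def sin_gt_zero)
  next
    case False
    then show ?thesis using r by (auto simp: IK_int_def sinK_def)
  qed
qed

lemma smooth_sinK_cosK: "smooth_real UNIV (sinK K)" "smooth_real UNIV (cosK K)"
proof -
  have "ndiff UNIV n (sinK K) \<and> ndiff UNIV n (cosK K)" for n
  proof (induction n)
    case (Suc n)
    have "ndiff UNIV n (\<lambda>r. - K * sinK K r)" using Suc by (intro ndiff_mult ndiff_const) auto
    with Suc sinK_has_deriv[of K] cosK_has_deriv[of K] show ?case
      unfolding ndiff.simps by (intro conjI exI[of _ "cosK K"] exI[of _ "\<lambda>r. - K * sinK K r"]) auto
  qed auto
  then show "smooth_real UNIV (sinK K)" "smooth_real UNIV (cosK K)" by (auto simp: smooth_real_def)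
qed

text \<open>The quotient of the densities with powers N - 2 and N: with it the fibre energy is
  integrated against the same measure as the radial one.\<close>

definition wK :: "real \<Rightarrow> real \<Rightarrow> real" where
  "wK K r = inverse (sinK K r * sinK K r)"

text \<open>The logarithmic derivative of the density \<open>sinK K r powr N\<close> (see
  \<open>sinK_powr_has_deriv\<close>), hence the drift that integration by parts against this
  density produces.\<close>

definition bK :: "real \<Rightarrow> real \<Rightarrow> real \<Rightarrow> real" where
  "bK K N r = N * (cosK K r * inverse (sinK K r))"

lemma smooth_wK: "smooth_real (IK_int K) (wK K)"
  unfolding wK_def[abs_def] using sinK_pos[of _ K]
  by (intro smooth_real_inverse smooth_real_mult smooth_real_mono[OF smooth_sinK_cosK(1)]) force+

lemma smooth_bK: "smooth_real (IK_int K) (bK K N)"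
  unfolding bK_def[abs_def] using sinK_pos[of _ K]
  by (intro smooth_real_mult smooth_real_const smooth_real_inverse smooth_real_mono[OF smooth_sinK_cosK(1)]
      smooth_real_mono[OF smooth_sinK_cosK(2)]) force+

abbreviation CS :: "real \<Rightarrow> (real \<Rightarrow> real) set" where
  "CS K \<equiv> Cc_smooth_on (IK_int K)"

lemma CS_wK: "\<phi> \<in> CS K \<Longrightarrow> (\<lambda>r. wK K r * \<phi> r) \<in> CS K"
  by (rule Cc_smooth_on_mult_smooth[OF open_IK_int smooth_wK])

lemma CS_bK: "\<phi> \<in> CS K \<Longrightarrow> (\<lambda>r. bK K N r * \<phi> r) \<in> CS K"
  by (rule Cc_smooth_on_mult_smooth[OF open_IK_int smooth_bK])

lemmas CS_closed = Cc_smooth_on_add Cc_smooth_on_mult[OF open_IK_int] Cc_smooth_on_cmult[OF open_IK_int]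
  Cc_smooth_on_deriv CS_wK CS_bK

text \<open>Puts a compact support into a closed interval on which the density is differentiable, so
  that the fundamental theorem of calculus applies. The margins are midpoints towards the ends, or
  an arbitrary 1 when there is no right end.\<close>

lemma compact_in_IK_int:
  assumes "compact T" "T \<subseteq> IK_int K"
  shows "\<exists>a b. a < b \<and> {a..b} \<subseteq> IK_int K \<and> T \<subseteq> {a<..<b}"
proof (cases "T = {}")
  case True
  obtain r where "r \<in> IK_int K" using IK_int_nonempty by blast
  then obtain e where e: "e > 0" "cball r e \<subseteq> IK_int K" using open_IK_int open_contains_cball by blast
  have "{r..r + e} \<subseteq> IK_int K" using e by (auto simp: subset_iff dist_real_def)
  with True e show ?thesis by (intro exI[of _ r] exI[of _ "r + e"]) auto
next
  case False
  obtain p where p: "p \<in> T" "\<forall>t\<in>T. p \<le> t" using compact_attains_inf[OF assms(1) False] by blast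
  obtain q where q: "q \<in> T" "\<forall>t\<in>T. t \<le> q" using compact_attains_sup[OF assms(1) False] by blast
  have pq: "p \<in> IK_int K" "q \<in> IK_int K" "p \<le> q" using p q assms by auto
  show ?thesis
  proof (cases "K > 0")
    case True
    define P where "P = pi / sqrt K"
    have I: "IK_int K = {0<..<P}" using True by (simp add: IK_int_def P_def)
    then have *: "0 < p" "q < P" using pq by auto
    then have "T \<subseteq> {p/2<..<(q + P)/2}" using p q by fastforce
    with * pq show ?thesis unfolding I by (intro exI[of _ "p/2"] exI[of _ "(q + P)/2"]) auto
  next
    case False
    then have I: "IK_int K = {0<..}" by (simp add: IK_int_def)
    then have *: "0 < p" using pq by auto
    then have "T \<subseteq> {p/2<..<q + 1}" using p q by fastforce
    with * pq show ?thesis unfolding I by (intro exI[of _ "p/2"] exI[of _ "q + 1"]) auto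
  qed
qed

section \<open>The weighted radial measure\<close>

definition muK :: "real \<Rightarrow> real \<Rightarrow> real measure" where
  "muK K N = density lborel (\<lambda>r. ennreal (indicator (IK K) r * sinK K r powr N))"

lemma sinK_measurable[measurable]: "sinK K \<in> borel_measurable borel"
  using sinK_has_deriv by (intro borel_measurable_continuous_onI)
    (meson DERIV_isCont continuous_at_imp_continuous_on)

lemma IK_measurable[measurable]: "IK K \<in> sets borel" "IK_int K \<in> sets borel"
  by (auto simp: IK_def IK_int_def)

lemma CS_measurable: "\<phi> \<in> CS K \<Longrightarrow> \<phi> \<in> borel_measurable borel"
  by (intro borel_measurable_continuous_onI Cc_smooth_on_continuous)

lemma sets_muK[simp, measurable_cong]: "sets (muK K N) = sets borel"
  by (simp add: muK_def)

lemma space_muK[simp]: "space (muK K N) = UNIV"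
  by (simp add: muK_def)

lemma sigma_finite_muK: "sigma_finite_measure (muK K N)"
  unfolding muK_def by (subst sigma_finite_measure.sigma_finite_iff_density_finite[OF lborel.sigma_finite_measure_axioms]) auto

text \<open>The density is positive in the open interval, and the at most two endpoints are Lebesgue
  null.\<close>

lemma AE_muK_iff:
  "(AE r in muK K N. P r) \<longleftrightarrow> (AE r in lborel. r \<in> IK_int K \<longrightarrow> P r)"
proof -
  have fin: "finite (IK K - IK_int K)"
    by (rule finite_subset[of _ "{0, pi / sqrt K}"]) (auto simp: IK_def IK_int_def)
  have ae: "AE r in lborel. r \<notin> IK K - IK_int K"
    by (rule AE_not_in) (simp add: fin finite_imp_null_set_lborel)
  have "(AE r in muK K N. P r) \<longleftrightarrow>
    (AE r in lborel. 0 < ennreal (indicator (IK K) r * sinK K r powr N) \<longrightarrow> P r)"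
    unfolding muK_def by (rule AE_density) measurable
  also have "\<dots> \<longleftrightarrow> (AE r in lborel. r \<in> IK_int K \<longrightarrow> P r)"
  proof
    assume "AE r in lborel. 0 < ennreal (indicator (IK K) r * sinK K r powr N) \<longrightarrow> P r"
    then show "AE r in lborel. r \<in> IK_int K \<longrightarrow> P r"
    proof eventually_elim
      case (elim r)
      then show ?case using sinK_pos[of r K] IK_int_subset[of K] by auto
    qed
  next
    assume "AE r in lborel. r \<in> IK_int K \<longrightarrow> P r"
    with ae show "AE r in lborel. 0 < ennreal (indicator (IK K) r * sinK K r powr N) \<longrightarrow> P r"
      by eventually_elim (auto simp: indicator_def split: if_splits)
  qed
  finally show ?thesis .
qed

lemma integral_muK:
  "\<phi> \<in> borel_measurable borel \<Longrightarrow>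
    integral\<^sup>L (muK K N) \<phi> = integral\<^sup>L lborel (\<lambda>r. indicator (IK K) r * sinK K r powr N * \<phi> r)"
  unfolding muK_def by (subst integral_density) auto

lemma integrable_muK_iff:
  "\<phi> \<in> borel_measurable borel \<Longrightarrow>
    integrable (muK K N) \<phi> \<longleftrightarrow> integrable lborel (\<lambda>r. indicator (IK K) r * sinK K r powr N * \<phi> r)"
  unfolding muK_def by (subst integrable_density) auto

lemma CS_support:
  assumes "\<phi> \<in> CS K"
  obtains a b where "a < b" "{a..b} \<subseteq> IK_int K" "\<And>r. r \<notin> {a<..<b} \<Longrightarrow> \<phi> r = 0"
proof -
  obtain T where T: "compact T" "T \<subseteq> IK_int K" "\<forall>r. r \<notin> T \<longrightarrow> \<phi> r = 0"
    using assms unfolding Cc_smooth_on_iff by blast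
  from compact_in_IK_int[OF T(1,2)] obtain a b where "a < b" "{a..b} \<subseteq> IK_int K" "T \<subseteq> {a<..<b}" by blast
  with T(3) show ?thesis by (intro that[of a b]) blast+
qed

lemma CS_bounded:
  assumes "\<phi> \<in> CS K"
  shows "\<exists>C. \<forall>r. \<bar>\<phi> r\<bar> \<le> C"
proof -
  obtain a b where ab: "a < b" "\<And>r. r \<notin> {a<..<b} \<Longrightarrow> \<phi> r = 0" using CS_support[OF assms] by metis
  have "compact (\<phi> ` {a..b})" by (intro compact_continuous_image Cc_smooth_on_continuous[OF assms]) auto
  then obtain C where C: "\<forall>y\<in>\<phi> ` {a..b}. norm y \<le> C" using compact_imp_bounded bounded_iff by metis
  have "\<bar>\<phi> r\<bar> \<le> max C 0" for r 
  proof (cases "r \<in> {a<..<b}")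
    case True
    then have "norm (\<phi> r) \<le> C" using C by auto
    then show ?thesis by simp
  next
    case False then show ?thesis using ab(2)[OF False] by simp
  qed
  then show ?thesis by blast
qed

lemma sinK_powr_has_deriv:
  assumes "r \<in> IK_int K"
  shows "((\<lambda>r. sinK K r powr N) has_real_derivative bK K N r * sinK K r powr N) (at r)"
proof -
  have p: "sinK K r > 0" using sinK_pos assms by auto
  have "((\<lambda>r. sinK K r powr N) has_real_derivative N * sinK K r powr (N - 1) * cosK K r) (at r)"
    using DERIV_fun_powr[OF sinK_has_deriv p, of N] by simp
  moreover have "sinK K r powr (N - 1) = sinK K r powr N * inverse (sinK K r)"
    using p by (simp add: powr_diff field_simps)
  ultimately show ?thesis by (simp add: bK_def mult_ac)
qed

lemma integrable_CS:
  assumes "\<phi> \<in> CS K"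
  shows "integrable (muK K N) \<phi>"
proof -
  obtain a b where ab: "a < b" "{a..b} \<subseteq> IK_int K" "\<And>r. r \<notin> {a<..<b} \<Longrightarrow> \<phi> r = 0"
    using CS_support[OF assms] by metis
  have "continuous_on {a..b} (\<lambda>r. sinK K r powr N * \<phi> r)"
    using ab(2) sinK_powr_has_deriv
    by (intro continuous_on_mult Cc_smooth_on_continuous[OF assms] continuous_at_imp_continuous_on)
      (meson DERIV_isCont subsetD)
  then have "set_integrable lborel {a..b} (\<lambda>r. sinK K r powr N * \<phi> r)"
    by (rule borel_integrable_atLeastAtMost')
  moreover have "(\<lambda>r. indicator {a..b} r *\<^sub>R (sinK K r powr N * \<phi> r)) =
      (\<lambda>r. indicator (IK K) r * sinK K r powr N * \<phi> r)"
  proof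
    fix r show "indicator {a..b} r *\<^sub>R (sinK K r powr N * \<phi> r) = indicator (IK K) r * sinK K r powr N * \<phi> r"
      using ab(2) ab(3)[of r] IK_int_subset[of K]
      by (cases "r \<in> {a<..<b}") (auto simp: indicator_def subset_iff)
  qed
  ultimately show ?thesis
    unfolding integrable_muK_iff[OF CS_measurable[OF assms]] set_integrable_def by simp
qed

text \<open>The fundamental theorem for the product of both functions with the density:
  \<open>bK\<close> arises from differentiating the density, and the boundary terms vanish by
  compact support.\<close>

lemma integral_by_parts_muK:
  assumes "\<phi> \<in> CS K" "\<psi> \<in> CS K"
  shows "(\<integral>r. deriv \<phi> r * \<psi> r \<partial>muK K N) = - (\<integral>r. \<phi> r * (deriv \<psi> r + bK K N r * \<psi> r) \<partial>muK K N)"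
proof -
  obtain a b where ab: "a < b" "{a..b} \<subseteq> IK_int K" "\<And>r. r \<notin> {a<..<b} \<Longrightarrow> \<phi> r = 0"
    using CS_support[OF assms(1)] by metis
  let ?f = "\<lambda>r. deriv \<phi> r * \<psi> r + \<phi> r * (deriv \<psi> r + bK K N r * \<psi> r)"
  note cs = CS_closed assms
  have f: "?f \<in> CS K" by (intro cs)
  \<comment> \<open>That \<phi> vanishes passes to its derivative on open sets only, hence the
    closed interval here; the boundary values at a and b use the open one.\<close>
  have "deriv \<phi> r = 0" if "r \<notin> {a..b}" for r
  proof -
    have "((\<lambda>x. 0) has_real_derivative 0) (at r)" by auto
    then have "(\<phi> has_real_derivative 0) (at r)"
      by (rule has_field_derivative_transform_within_open[where S = "- {a..b}"])
         (use ab(3) that in \<open>auto intro!: open_Compl\<close>)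
    then show ?thesis by (rule DERIV_imp_deriv)
  qed
  then have f0: "?f r = 0" if "r \<notin> {a..b}" for r using that ab(3)[of r] by auto
  let ?F = "\<lambda>r. sinK K r powr N * (\<phi> r * \<psi> r)"
  have "(\<integral>r. (sinK K r powr N * ?f r) * indicator {a..b} r \<partial>lborel) = ?F b - ?F a"
  proof (rule integral_FTC_Icc_real)
    show "a \<le> b" using ab by simp
    fix r assume "a \<le> r" "r \<le> b"
    then have r: "r \<in> IK_int K" using ab(2) by auto
    show "(?F has_real_derivative sinK K r powr N * ?f r) (at r)"
      using DERIV_mult[OF sinK_powr_has_deriv[OF r] DERIV_mult[OF Cc_smooth_on_has_deriv[OF assms(1)]
          Cc_smooth_on_has_deriv[OF assms(2)]], of N] by (simp add: algebra_simps)
    show "isCont (\<lambda>r. sinK K r powr N * ?f r) r"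
      using DERIV_isCont[OF sinK_powr_has_deriv[OF r]] DERIV_isCont[OF Cc_smooth_on_has_deriv[OF f]]
      by (rule continuous_mult)
  qed
  moreover have "?F b = 0" "?F a = 0" using ab(3) by auto
  moreover have "(\<lambda>r. (sinK K r powr N * ?f r) * indicator {a..b} r) = (\<lambda>r. indicator (IK K) r * sinK K r powr N * ?f r)"
  proof
    fix r show "(sinK K r powr N * ?f r) * indicator {a..b} r = indicator (IK K) r * sinK K r powr N * ?f r"
    proof (cases "r \<in> {a..b}")
      case True then show ?thesis using ab(2) IK_int_subset[of K] by (auto simp: subset_iff)
    next
      case False then show ?thesis using f0[OF False] by simp
    qed
  qed
  ultimately have "(\<integral>r. ?f r \<partial>muK K N) = 0" using integral_muK[OF CS_measurable[OF f]] by simp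
  moreover have "(\<integral>r. ?f r \<partial>muK K N) = (\<integral>r. deriv \<phi> r * \<psi> r \<partial>muK K N) +
      (\<integral>r. \<phi> r * (deriv \<psi> r + bK K N r * \<psi> r) \<partial>muK K N)"
    by (intro Bochner_Integration.integral_add integrable_CS cs)
  ultimately show ?thesis by simp
qed

section \<open>Tensors on the cone\<close>

lemma L2_mult_integrable:
  assumes "u \<in> L2 M" "v \<in> L2 M"
  shows "integrable M (\<lambda>x. u x * v x)"
proof (rule Bochner_Integration.integrable_bound[where f = "\<lambda>x. (u x)\<^sup>2 + (v x)\<^sup>2"])
  show "AE x in M. norm (u x * v x) \<le> norm ((u x)\<^sup>2 + (v x)\<^sup>2)"
  proof (rule AE_I2)
    fix x
    have "2 * (\<bar>u x\<bar> * \<bar>v x\<bar>) \<le> (u x)\<^sup>2 + (v x)\<^sup>2"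
      using sum_squares_bound[of "\<bar>u x\<bar>" "\<bar>v x\<bar>"] by (simp add: mult.assoc)
    moreover have "0 \<le> \<bar>u x\<bar> * \<bar>v x\<bar>" by simp
    ultimately have "\<bar>u x\<bar> * \<bar>v x\<bar> \<le> (u x)\<^sup>2 + (v x)\<^sup>2" by linarith
    then show "norm (u x * v x) \<le> norm ((u x)\<^sup>2 + (v x)\<^sup>2)" by (simp add: abs_mult)
  qed
qed (use assms in \<open>auto simp: L2_def\<close>)

lemma L2_measurable: "u \<in> L2 M \<Longrightarrow> u \<in> borel_measurable M"
  by (simp add: L2_def)

lemma L2_add: "u \<in> L2 M \<Longrightarrow> v \<in> L2 M \<Longrightarrow> (\<lambda>x. u x + v x) \<in> L2 M"
  using L2_mult_integrable[of u M v] by (auto simp: L2_def power2_sum mult.assoc)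

lemma L2_cmult: "u \<in> L2 M \<Longrightarrow> (\<lambda>x. a * u x) \<in> L2 M"
  by (auto simp: L2_def power_mult_distrib)

lemma L2_zero: "(\<lambda>x. 0) \<in> L2 M"
  by (auto simp: L2_def)

lemma L2_diff: "u \<in> L2 M \<Longrightarrow> v \<in> L2 M \<Longrightarrow> (\<lambda>x. u x - v x) \<in> L2 M"
  using L2_add[of u M "\<lambda>x. -1 * v x"] L2_cmult[of v M "-1"] by simp

lemma AE_zero_if_integral_square_zero:
  assumes "u \<in> L2 M" "integral\<^sup>L M (\<lambda>x. (u x)\<^sup>2) = 0"
  shows "AE x in M. u x = 0"
proof -
  have "AE x in M. (u x)\<^sup>2 = 0"
    using assms by (subst integral_nonneg_eq_0_iff_AE[symmetric]) (auto simp: L2_def)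
  then show ?thesis by simp
qed

text \<open>The discriminant criterion, shared by the Cauchy-Schwarz inequalities for the L2 product
  and for \<open>E\<close>.\<close>

lemma nonneg_quadratic_bound:
  fixes a b c :: real
  assumes q: "\<And>t. 0 \<le> a + 2 * t * b + t\<^sup>2 * c" and "0 \<le> a" "0 \<le> c"
  shows "\<bar>b\<bar> \<le> sqrt a * sqrt c"
proof -
  have "b\<^sup>2 \<le> a * c"
  proof (cases "c = 0")
    case True
    have "b = 0"
    proof (rule ccontr)
      assume "b \<noteq> 0"
      \<comment> \<open>For c = 0 the expression is affine in t, and this t gives it the value
        -1.\<close>
      then show False using q[of "- (a + 1) / (2 * b)"] True by (simp add: field_simps)
    qed
    with True show ?thesis by simp
  next
    case False
    with assms have "c > 0" by simp
    have "0 \<le> (a + 2 * (- b / c) * b + (- b / c)\<^sup>2 * c) * c" using q[of "- b / c"] \<open>0 \<le> c\<close> by simp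
    also have "\<dots> = a * c - b\<^sup>2" using \<open>c > 0\<close> by (simp add: field_simps power2_eq_square)
    finally show ?thesis by simp
  qed
  then show ?thesis by (metis real_sqrt_abs real_sqrt_le_mono real_sqrt_mult)
qed

lemma L2_cauchy_schwarz:
  assumes "u \<in> L2 M" "v \<in> L2 M"
  shows "\<bar>integral\<^sup>L M (\<lambda>x. u x * v x)\<bar>
    \<le> sqrt (integral\<^sup>L M (\<lambda>x. (u x)\<^sup>2)) * sqrt (integral\<^sup>L M (\<lambda>x. (v x)\<^sup>2))"
proof (rule nonneg_quadratic_bound)
  fix t :: real
  have i: "integrable M (\<lambda>x. (u x)\<^sup>2)" "integrable M (\<lambda>x. (v x)\<^sup>2)" "integrable M (\<lambda>x. u x * v x)"
    using assms L2_mult_integrable by (auto simp: L2_def)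
  have "0 \<le> integral\<^sup>L M (\<lambda>x. (u x + t * v x)\<^sup>2)" by simp
  also have "(\<lambda>x. (u x + t * v x)\<^sup>2) = (\<lambda>x. (u x)\<^sup>2 + 2 * t * (u x * v x) + t\<^sup>2 * (v x)\<^sup>2)"
    by (auto simp: fun_eq_iff power2_eq_square algebra_simps)
  also have "integral\<^sup>L M \<dots> = integral\<^sup>L M (\<lambda>x. (u x)\<^sup>2) + 2 * t * integral\<^sup>L M (\<lambda>x. u x * v x)
      + t\<^sup>2 * integral\<^sup>L M (\<lambda>x. (v x)\<^sup>2)"
    using i by simp
  finally show "0 \<le> integral\<^sup>L M (\<lambda>x. (u x)\<^sup>2) + 2 * t * integral\<^sup>L M (\<lambda>x. u x * v x)
      + t\<^sup>2 * integral\<^sup>L M (\<lambda>x. (v x)\<^sup>2)" .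
qed auto

lemma L2_integral_add:
  assumes "u \<in> L2 m" "v \<in> L2 m" "w \<in> L2 m"
  shows "integral\<^sup>L m (\<lambda>z. (u z + v z) * w z) = integral\<^sup>L m (\<lambda>z. u z * w z) + integral\<^sup>L m (\<lambda>z. v z * w z)"
    "integral\<^sup>L m (\<lambda>z. w z * (u z + v z)) = integral\<^sup>L m (\<lambda>z. w z * u z) + integral\<^sup>L m (\<lambda>z. w z * v z)"
  using L2_mult_integrable[OF assms(1,3)] L2_mult_integrable[OF assms(2,3)]
  by (simp_all add: algebra_simps)

lemma L2_norm_add_bound:
  assumes "u \<in> L2 m" "v \<in> L2 m"
  shows "integral\<^sup>L m (\<lambda>x. (u x - v x)\<^sup>2) \<le> 2 * integral\<^sup>L m (\<lambda>x. (u x)\<^sup>2) + 2 * integral\<^sup>L m (\<lambda>x. (v x)\<^sup>2)"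
proof -
  have i: "integrable m (\<lambda>x. (u x)\<^sup>2)" "integrable m (\<lambda>x. (v x)\<^sup>2)" using assms by (auto simp: L2_def)
  have "integral\<^sup>L m (\<lambda>x. (u x - v x)\<^sup>2) \<le> integral\<^sup>L m (\<lambda>x. 2 * (u x)\<^sup>2 + 2 * (v x)\<^sup>2)"
  proof (rule integral_mono)
    show "integrable m (\<lambda>x. (u x - v x)\<^sup>2)" using L2_diff[OF assms] by (simp add: L2_def)
    fix x show "(u x - v x)\<^sup>2 \<le> 2 * (u x)\<^sup>2 + 2 * (v x)\<^sup>2"
      using zero_le_power2[of "u x + v x"] by (simp add: power2_eq_square algebra_simps)
  qed (use i in auto)
  with i show ?thesis by simp
qed

lemma (in pair_sigma_finite) product_integral:
  fixes f :: "'a \<Rightarrow> real" and g :: "'b \<Rightarrow> real"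
  assumes f: "integrable M1 f" and g: "integrable M2 g"
  shows "integrable (M1 \<Otimes>\<^sub>M M2) (\<lambda>z. f (fst z) * g (snd z))"
    and "integral\<^sup>L (M1 \<Otimes>\<^sub>M M2) (\<lambda>z. f (fst z) * g (snd z)) = integral\<^sup>L M1 f * integral\<^sup>L M2 g"
proof -
  have [measurable]: "f \<in> borel_measurable M1" "g \<in> borel_measurable M2" using f g by auto
  show i: "integrable (M1 \<Otimes>\<^sub>M M2) (\<lambda>z. f (fst z) * g (snd z))"
  proof (rule Fubini_integrable)
    have "(\<lambda>x. \<integral>y. norm (f (fst (x, y)) * g (snd (x, y))) \<partial>M2) = (\<lambda>x. norm (f x) * (\<integral>y. norm (g y) \<partial>M2))"
      by (simp add: abs_mult)
    then show "integrable M1 (\<lambda>x. \<integral>y. norm (f (fst (x, y)) * g (snd (x, y))) \<partial>M2)"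
      using f by simp
  qed (use g in auto)
  show "integral\<^sup>L (M1 \<Otimes>\<^sub>M M2) (\<lambda>z. f (fst z) * g (snd z)) = integral\<^sup>L M1 f * integral\<^sup>L M2 g"
    using integral_fst'[OF i] by simp
qed

section \<open>Finite tensor sums and their radial derivative\<close>

lemma tensor_dom_zero: "(\<lambda>z. 0) \<in> tensor_dom K B"
  unfolding tensor_dom_def by (auto intro!: exI[of _ "0::nat"])

lemma tensor_dom_Cons:
  assumes "\<phi> \<in> CS K" "f \<in> B" "u \<in> tensor_dom K B"
  shows "(\<lambda>z. \<phi> (fst z) * f (snd z) + u z) \<in> tensor_dom K B"
proof -
  obtain n :: nat and \<psi> g where g: "\<forall>i<n. \<psi> i \<in> CS K \<and> g i \<in> B" "u = (\<lambda>(r, x). \<Sum>i<n. \<psi> i r * g i x)"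
    using assms(3) unfolding tensor_dom_def by blast
  let ?p = "\<psi>(n := \<phi>)" and ?g = "g(n := f)"
  have "(\<Sum>i<n. ?p i r * ?g i x) = (\<Sum>i<n. \<psi> i r * g i x)" for r x by (rule sum.cong) auto
  then have "(\<lambda>z. \<phi> (fst z) * f (snd z) + u z) = (\<lambda>(r, x). \<Sum>i<Suc n. ?p i r * ?g i x)"
    by (auto simp: g fun_eq_iff)
  moreover have "\<forall>i<Suc n. ?p i \<in> CS K \<and> ?g i \<in> B" using g assms by auto
  ultimately show ?thesis unfolding tensor_dom_def by blast
qed

text \<open>Most quantities below are linear in each tensor, so splitting off one pure factor at a
  time reduces them to a radial and a fibre computation.\<close>

lemma tensor_dom_induct[consumes 1, case_names zero Cons]:
  assumes "u \<in> tensor_dom K B"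
    and "P (\<lambda>z. 0)"
    and "\<And>\<phi> f u. \<phi> \<in> CS K \<Longrightarrow> f \<in> B \<Longrightarrow> u \<in> tensor_dom K B \<Longrightarrow> P u \<Longrightarrow>
            P (\<lambda>z. \<phi> (fst z) * f (snd z) + u z)"
  shows "P u"
proof -
  obtain n :: nat and \<psi> g where g: "\<forall>i<n. \<psi> i \<in> CS K \<and> g i \<in> B" "u = (\<lambda>(r, x). \<Sum>i<n. \<psi> i r * g i x)"
    using assms(1) unfolding tensor_dom_def by blast
  have "P (\<lambda>(r, x). \<Sum>i<m. \<psi> i r * g i x) \<and> (\<lambda>(r, x). \<Sum>i<m. \<psi> i r * g i x) \<in> tensor_dom K B" if "m \<le> n" for m
    using that
  proof (induction m)
    case 0 then show ?case using assms(2) tensor_dom_zero by (simp add: split_beta')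
  next
    case (Suc m)
    have "(\<lambda>(r, x). \<Sum>i<Suc m. \<psi> i r * g i x) = (\<lambda>z. \<psi> m (fst z) * g m (snd z) + (\<lambda>(r, x). \<Sum>i<m. \<psi> i r * g i x) z)"
      by (auto simp: fun_eq_iff)
    with Suc g show ?case using assms(3) tensor_dom_Cons[of "\<psi> m" K "g m" B] by simp
  qed
  with g show ?thesis by auto
qed

lemma tensor_dom_pure:
  assumes "\<phi> \<in> CS K" "f \<in> B"
  shows "(\<lambda>z. \<phi> (fst z) * f (snd z)) \<in> tensor_dom K B"
  using tensor_dom_Cons[OF assms tensor_dom_zero] by simp

lemma tensor_dom_mono: "B \<subseteq> C \<Longrightarrow> tensor_dom K B \<subseteq> tensor_dom K C"
  unfolding tensor_dom_def by blast

lemma tensor_dom_add: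
  assumes "u \<in> tensor_dom K B" "v \<in> tensor_dom K B"
  shows "(\<lambda>z. u z + v z) \<in> tensor_dom K B"
  using assms(1)
proof (induction rule: tensor_dom_induct)
  case (Cons \<phi> f u)
  then show ?case using tensor_dom_Cons[OF Cons(1,2) Cons(4)] by (simp add: add.assoc)
qed (use assms in simp)

lemma tensor_dom_mult_radial:
  assumes "u \<in> tensor_dom K B" "\<And>\<phi>. \<phi> \<in> CS K \<Longrightarrow> (\<lambda>r. g r * \<phi> r) \<in> CS K"
  shows "(\<lambda>z. g (fst z) * u z) \<in> tensor_dom K B"
  using assms(1)
proof (induction rule: tensor_dom_induct)
  case (Cons \<phi> f u)
  then show ?case using tensor_dom_Cons[OF assms(2)[OF Cons(1)] Cons(2) Cons(4)]
    by (simp add: algebra_simps)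
qed (use tensor_dom_zero in simp)

lemma tensor_dom_cmult: "u \<in> tensor_dom K B \<Longrightarrow> (\<lambda>z. a * u z) \<in> tensor_dom K B"
  using tensor_dom_mult_radial[of u K B "\<lambda>r. a"] CS_closed(3) by simp

lemma tensor_dom_diff:
  "u \<in> tensor_dom K B \<Longrightarrow> v \<in> tensor_dom K B \<Longrightarrow> (\<lambda>z. u z - v z) \<in> tensor_dom K B"
  using tensor_dom_add[of u K B "\<lambda>z. -1 * v z"] tensor_dom_cmult[of v K B "-1"] by simp

lemma tensor_dom_outside: "u \<in> tensor_dom K B \<Longrightarrow> r \<notin> IK_int K \<Longrightarrow> u (r, x) = 0"
proof (induction rule: tensor_dom_induct)
  case (Cons \<phi> f u)
  then have "\<phi> r = 0" unfolding Cc_smooth_on_iff by blast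
  with Cons show ?case by simp
qed simp

lemma tensor_dom_radial_CS: "u \<in> tensor_dom K B \<Longrightarrow> (\<lambda>r. u (r, x)) \<in> CS K"
proof (induction rule: tensor_dom_induct)
  case zero
  then show ?case by (auto simp: Cc_smooth_on_iff smooth_real_const)
next
  case (Cons \<phi> f u)
  then show ?case using CS_closed(1)[OF CS_closed(3)[OF Cons(1), of "f x"] Cons(4)] by (simp add: mult.commute)
qed

text \<open>The fibre variable is frozen inside \<open>deriv\<close>, so that the square of this is
  literally the radial integrand of \<open>cone_Q0\<close>.\<close>

definition dr :: "(real \<times> 'a \<Rightarrow> real) \<Rightarrow> real \<times> 'a \<Rightarrow> real" where
  "dr u z = deriv (\<lambda>s. u (s, snd z)) (fst z)"

lemma tensor_dom_has_deriv:
  assumes "u \<in> tensor_dom K B"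
  shows "((\<lambda>s. u (s, x)) has_real_derivative dr u (r, x)) (at r)"
  using assms
proof (induction rule: tensor_dom_induct)
  case (Cons \<phi> f u)
  have "((\<lambda>s. \<phi> s * f x + u (s, x)) has_real_derivative deriv \<phi> r * f x + dr u (r, x)) (at r)"
    by (intro DERIV_add DERIV_cmult_right Cc_smooth_on_has_deriv[OF Cons(1)] Cons(4))
  then show ?case using DERIV_imp_deriv by (force simp: dr_def)
qed (auto simp: dr_def)

lemma dr_zero: "dr (\<lambda>z. 0) = (\<lambda>z. 0)"
  by (auto simp: dr_def fun_eq_iff)

lemma dr_Cons:
  assumes "\<phi> \<in> CS K" "u \<in> tensor_dom K B"
  shows "dr (\<lambda>z. \<phi> (fst z) * f (snd z) + u z) = (\<lambda>z. deriv \<phi> (fst z) * f (snd z) + dr u z)"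
proof
  fix z
  have "((\<lambda>s. \<phi> s * f (snd z) + u (s, snd z)) has_real_derivative deriv \<phi> (fst z) * f (snd z) + dr u (fst z, snd z)) (at (fst z))"
    by (intro DERIV_add DERIV_cmult_right Cc_smooth_on_has_deriv[OF assms(1)] tensor_dom_has_deriv[OF assms(2)])
  from DERIV_imp_deriv[OF this]
  show "dr (\<lambda>z. \<phi> (fst z) * f (snd z) + u z) z = deriv \<phi> (fst z) * f (snd z) + dr u z"
    by (simp add: dr_def)
qed

lemma dr_add:
  assumes "u \<in> tensor_dom K B" "v \<in> tensor_dom K B"
  shows "dr (\<lambda>z. u z + v z) = (\<lambda>z. dr u z + dr v z)"
proof
  fix z
  from DERIV_imp_deriv[OF DERIV_add[OF tensor_dom_has_deriv[OF assms(1), of "snd z" "fst z"]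
      tensor_dom_has_deriv[OF assms(2), of "snd z" "fst z"]]]
  show "dr (\<lambda>z. u z + v z) z = dr u z + dr v z" by (simp add: dr_def)
qed

lemma dr_cmult:
  assumes "u \<in> tensor_dom K B"
  shows "dr (\<lambda>z. a * u z) = (\<lambda>z. a * dr u z)"
proof
  fix z
  from DERIV_imp_deriv[OF DERIV_cmult[OF tensor_dom_has_deriv[OF assms(1)]], of a "snd z" "fst z"]
  show "dr (\<lambda>z. a * u z) z = a * dr u z" by (simp add: dr_def)
qed

lemma dr_tensor_dom: "u \<in> tensor_dom K B \<Longrightarrow> dr u \<in> tensor_dom K B"
proof (induction rule: tensor_dom_induct)
  case (Cons \<phi> f u)
  then show ?case using tensor_dom_Cons[OF CS_closed(4)[OF Cons(1)] Cons(2,4)] dr_Cons[OF Cons(1,3)] by simp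
qed (simp add: dr_zero tensor_dom_zero)

section \<open>The pre-form of the cone on tensors\<close>

locale cone_form =
  fixes M :: "'a measure" and D :: "('a \<Rightarrow> real) set"
    and E :: "('a \<Rightarrow> real) \<Rightarrow> ('a \<Rightarrow> real) \<Rightarrow> real" and K N :: real
  assumes sigma_finite_M: "sigma_finite_measure M"
    and form: "dirichlet_form M D E"
begin

abbreviation "mC \<equiv> cone_measure K N M"

sublocale pair_sigma_finite "muK K N" M
  using sigma_finite_muK sigma_finite_M by (simp add: pair_sigma_finite_def)

lemma mC_eq: "mC = muK K N \<Otimes>\<^sub>M M"
  by (simp add: cone_measure_def muK_def)

lemma D_L2: "u \<in> D \<Longrightarrow> u \<in> L2 M"
  using form unfolding dirichlet_form_def by (elim conjE) blast

lemma D_zero: "(\<lambda>x. 0) \<in> D"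
  using form unfolding dirichlet_form_def by (elim conjE)

lemma D_add: "u \<in> D \<Longrightarrow> v \<in> D \<Longrightarrow> (\<lambda>x. u x + v x) \<in> D"
  using form unfolding dirichlet_form_def by (elim conjE) blast

lemma D_cmult: "u \<in> D \<Longrightarrow> (\<lambda>x. a * u x) \<in> D"
  using form unfolding dirichlet_form_def by (elim conjE) blast

lemma D_diff: "u \<in> D \<Longrightarrow> v \<in> D \<Longrightarrow> (\<lambda>x. u x - v x) \<in> D"
  using D_add[of u "\<lambda>x. -1 * v x"] D_cmult[of v "-1"] by simp

lemma D_AE_cong:
  assumes "u \<in> D" "v \<in> borel_measurable M" "AE x in M. u x = v x"
  shows "v \<in> D" "w \<in> D \<Longrightarrow> E u w = E v w"
proof -
  have "\<forall>u\<in>D. \<forall>v. v \<in> borel_measurable M \<and> (AE x in M. u x = v x) \<longrightarrow>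
         v \<in> D \<and> (\<forall>w\<in>D. E u w = E v w)"
    using form unfolding dirichlet_form_def by (elim conjE)
  with assms show "v \<in> D" "w \<in> D \<Longrightarrow> E u w = E v w" by blast+
qed

lemma E_sym: "u \<in> D \<Longrightarrow> v \<in> D \<Longrightarrow> E u v = E v u"
  using form unfolding dirichlet_form_def by (elim conjE) blast

lemma E_add: "u \<in> D \<Longrightarrow> v \<in> D \<Longrightarrow> w \<in> D \<Longrightarrow> E (\<lambda>x. u x + v x) w = E u w + E v w"
  using form unfolding dirichlet_form_def by (elim conjE) blast

lemma E_cmult: "u \<in> D \<Longrightarrow> w \<in> D \<Longrightarrow> E (\<lambda>x. a * u x) w = a * E u w"
  using form unfolding dirichlet_form_def by (elim conjE) blast

lemma E_nonneg: "u \<in> D \<Longrightarrow> E u u \<ge> 0"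
  using form unfolding dirichlet_form_def by (elim conjE) blast

lemma D_dense: "f \<in> L2 M \<Longrightarrow> \<epsilon> > 0 \<Longrightarrow> \<exists>u\<in>D. integral\<^sup>L M (\<lambda>x. (f x - u x)\<^sup>2) < \<epsilon>"
  using form unfolding dirichlet_form_def by (elim conjE) blast

lemma D_closed:
  assumes "\<And>n. u n \<in> D" "\<And>\<epsilon>. \<epsilon> > 0 \<Longrightarrow> \<exists>n0. \<forall>n\<ge>n0. \<forall>m\<ge>n0. E1 M E (\<lambda>x. u n x - u m x) < \<epsilon>"
  shows "\<exists>v\<in>D. (\<lambda>n. E1 M E (\<lambda>x. u n x - v x)) \<longlonglongrightarrow> 0"
proof -
  have "\<forall>u. (\<forall>n. u n \<in> D) \<and>
          (\<forall>\<epsilon>>0. \<exists>n0. \<forall>n\<ge>n0. \<forall>m\<ge>n0. E1 M E (\<lambda>x. u n x - u m x) < \<epsilon>) \<longrightarrow>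
          (\<exists>v\<in>D. (\<lambda>n. E1 M E (\<lambda>x. u n x - v x)) \<longlonglongrightarrow> 0)"
    using form unfolding dirichlet_form_def by (elim conjE)
  with assms show ?thesis by blast
qed

lemma E_zero: "u \<in> D \<Longrightarrow> E (\<lambda>x. 0) u = 0"
  using E_cmult[of u u 0] by simp

lemma E_add_right: "u \<in> D \<Longrightarrow> v \<in> D \<Longrightarrow> w \<in> D \<Longrightarrow> E w (\<lambda>x. u x + v x) = E w u + E w v"
  using E_add[of u v w] E_sym[of w u] E_sym[of w v] E_sym[of w "\<lambda>x. u x + v x"] D_add by simp

lemma E_cmult_right: "u \<in> D \<Longrightarrow> w \<in> D \<Longrightarrow> E w (\<lambda>x. a * u x) = a * E w u"
  using E_cmult[of u w a] E_sym[of w u] E_sym[of w "\<lambda>x. a * u x"] D_cmult by simp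

lemma E_cauchy_schwarz:
  assumes "u \<in> D" "v \<in> D"
  shows "\<bar>E u v\<bar> \<le> sqrt (E u u) * sqrt (E v v)"
proof (rule nonneg_quadratic_bound)
  fix t :: real
  have tv: "(\<lambda>x. t * v x) \<in> D" using assms D_cmult by blast
  have "0 \<le> E (\<lambda>x. u x + t * v x) (\<lambda>x. u x + t * v x)" by (intro E_nonneg D_add assms tv)
  also have "\<dots> = E u u + 2 * t * E u v + t\<^sup>2 * E v v"
    using assms tv D_add[OF assms(1) tv] E_sym[OF assms]
    by (simp add: E_add E_add_right E_cmult E_cmult_right power2_eq_square algebra_simps)
  finally show "0 \<le> E u u + 2 * t * E u v + t\<^sup>2 * E v v" .
qed (use assms E_nonneg in auto)

abbreviation "T \<equiv> tensor_dom K D"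

lemma T_slice: "u \<in> T \<Longrightarrow> (\<lambda>x. u (r, x)) \<in> D"
proof (induction rule: tensor_dom_induct)
  case (Cons \<phi> f u)
  then show ?case using D_add[OF D_cmult[OF Cons(2), of "\<phi> r"] Cons(4)] by simp
qed (simp add: D_zero)

lemma T_form_CS1:
  assumes "u \<in> T" "g \<in> D"
  shows "(\<lambda>r. E (\<lambda>x. u (r, x)) g) \<in> CS K"
  using assms(1)
proof (induction rule: tensor_dom_induct)
  case zero
  have "(\<lambda>r. 0) \<in> CS K" by (auto simp: Cc_smooth_on_iff smooth_real_const)
  then show ?case using E_zero assms by simp
next
  case (Cons \<phi> f u)
  have "(\<lambda>r. E (\<lambda>x. \<phi> r * f x + u (r, x)) g) = (\<lambda>r. E f g * \<phi> r + E (\<lambda>x. u (r, x)) g)"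
    using E_add[OF D_cmult[OF Cons(2)] T_slice[OF Cons(3)] assms(2)] E_cmult[OF Cons(2) assms(2)]
    by (simp add: mult.commute)
  with Cons show ?case using CS_closed by simp
qed

text \<open>By bilinearity the fibre energy of the slices is a finite combination of products of
  radial factors; this settles its measurability and integrability in r.\<close>

lemma T_form_CS:
  assumes "u \<in> T" "v \<in> T"
  shows "(\<lambda>r. E (\<lambda>x. u (r, x)) (\<lambda>x. v (r, x))) \<in> CS K"
  using assms(2)
proof (induction rule: tensor_dom_induct)
  case zero
  have "(\<lambda>r. 0) \<in> CS K" by (auto simp: Cc_smooth_on_iff smooth_real_const)
  moreover have "E (\<lambda>x. u (r, x)) (\<lambda>x. 0) = 0" for r
    using E_zero[OF T_slice[OF assms(1)]] E_sym[OF T_slice[OF assms(1)] D_zero] by simp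
  ultimately show ?case by simp
next
  case (Cons \<phi> f v)
  have "(\<lambda>r. E (\<lambda>x. u (r, x)) (\<lambda>x. \<phi> r * f x + v (r, x))) =
     (\<lambda>r. \<phi> r * E (\<lambda>x. u (r, x)) f + E (\<lambda>x. u (r, x)) (\<lambda>x. v (r, x)))"
    using E_add_right[OF D_cmult[OF Cons(2)] T_slice[OF Cons(3)] T_slice[OF assms(1)]]
      E_cmult_right[OF Cons(2) T_slice[OF assms(1)]] by simp
  with Cons T_form_CS1[OF assms(1) Cons(2)] show ?case using CS_closed by simp
qed

lemma pure_L2:
  assumes "\<phi> \<in> CS K" "f \<in> L2 M"
  shows "(\<lambda>z. \<phi> (fst z) * f (snd z)) \<in> L2 mC"
proof -
  have "integrable (muK K N) (\<lambda>r. (\<phi> r)\<^sup>2)" 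
    unfolding power2_eq_square by (intro integrable_CS CS_closed assms)
  moreover have "integrable M (\<lambda>x. (f x)\<^sup>2)" using assms by (simp add: L2_def)
  ultimately have "integrable (muK K N \<Otimes>\<^sub>M M) (\<lambda>z. (\<phi> (fst z) * f (snd z))\<^sup>2)"
    using product_integral(1) by (simp add: power_mult_distrib)
  moreover have [measurable]: "\<phi> \<in> borel_measurable (muK K N)" "f \<in> borel_measurable M"
    using assms CS_measurable by (auto simp: L2_def cong: measurable_cong_sets)
  ultimately show ?thesis by (simp add: L2_def mC_eq)
qed

lemma tensor_L2: "B \<subseteq> L2 M \<Longrightarrow> u \<in> tensor_dom K B \<Longrightarrow> u \<in> L2 mC"
proof (rotate_tac 1, induction rule: tensor_dom_induct)
  case (Cons \<phi> f u)
  then show ?case using L2_add[OF pure_L2] by blast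
qed (auto simp: L2_zero)

lemma T_L2: "u \<in> T \<Longrightarrow> u \<in> L2 mC"
  using tensor_L2[of D] D_L2 by blast

lemma integral_pure_pure:
  assumes "\<phi> \<in> CS K" "\<psi> \<in> CS K" "f \<in> L2 M" "g \<in> L2 M"
  shows "integral\<^sup>L mC (\<lambda>z. (\<phi> (fst z) * f (snd z)) * (\<psi> (fst z) * g (snd z))) =
    (\<integral>r. \<phi> r * \<psi> r \<partial>muK K N) * (\<integral>x. f x * g x \<partial>M)"
proof -
  have "integrable (muK K N) (\<lambda>r. \<phi> r * \<psi> r)" by (intro integrable_CS CS_closed assms)
  from product_integral(2)[OF this L2_mult_integrable[OF assms(3,4)]]
  show ?thesis by (simp add: mC_eq mult_ac)
qed

text \<open>Minus the adjoint of \<open>dr\<close> in the weighted L2 space (see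
  \<open>radial_by_parts\<close>); applied to \<open>dr u\<close> it is the radial Laplacian of
  u.\<close>

definition rad :: "(real \<times> 'a \<Rightarrow> real) \<Rightarrow> real \<times> 'a \<Rightarrow> real" where
  "rad v z = dr v z + bK K N (fst z) * v z"

lemma rad_tensor_dom: "v \<in> tensor_dom K B \<Longrightarrow> rad v \<in> tensor_dom K B"
  unfolding rad_def[abs_def] using dr_tensor_dom tensor_dom_mult_radial CS_bK tensor_dom_add by blast

lemma rad_Cons:
  assumes "\<phi> \<in> CS K" "u \<in> tensor_dom K B"
  shows "rad (\<lambda>z. \<phi> (fst z) * f (snd z) + u z) =
    (\<lambda>z. (deriv \<phi> (fst z) + bK K N (fst z) * \<phi> (fst z)) * f (snd z) + rad u z)"
  unfolding rad_def[abs_def] dr_Cons[OF assms] by (simp add: algebra_simps)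

text \<open>Induction on both tensors leaves a product of a radial and a fibre integral, where
  \<open>integral_by_parts_muK\<close> applies.\<close>

lemma radial_by_parts:
  assumes "u \<in> T" "v \<in> T"
  shows "integral\<^sup>L mC (\<lambda>z. dr u z * v z) = - integral\<^sup>L mC (\<lambda>z. u z * rad v z)"
  using assms(1)
proof (induction rule: tensor_dom_induct)
  case zero
  then show ?case by (simp add: dr_zero)
next
  case (Cons \<phi> f u)
  have "integral\<^sup>L mC (\<lambda>z. (deriv \<phi> (fst z) * f (snd z)) * v z) =
      - integral\<^sup>L mC (\<lambda>z. (\<phi> (fst z) * f (snd z)) * rad v z)"
    using assms(2)
  proof (induction rule: tensor_dom_induct)
    case zero
    then show ?case by (simp add: rad_def dr_zero)
  next
    case IH: (Cons \<psi> g v)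
    have c: "deriv \<phi> \<in> CS K" "(\<lambda>r. deriv \<psi> r + bK K N r * \<psi> r) \<in> CS K" using Cons IH CS_closed by auto
    have l2: "f \<in> L2 M" "g \<in> L2 M" using Cons IH D_L2 by auto
    note p = pure_L2[OF c(1) l2(1)] pure_L2[OF Cons(1) l2(1)] pure_L2[OF IH(1) l2(2)] pure_L2[OF c(2) l2(2)]
      T_L2[OF IH(3)] T_L2[OF rad_tensor_dom[OF IH(3)]]
    have "integral\<^sup>L mC (\<lambda>z. (deriv \<phi> (fst z) * f (snd z)) * (\<psi> (fst z) * g (snd z))) =
      - integral\<^sup>L mC (\<lambda>z. (\<phi> (fst z) * f (snd z)) * ((deriv \<psi> (fst z) + bK K N (fst z) * \<psi> (fst z)) * g (snd z)))"
      using integral_pure_pure[OF c(1) IH(1) l2] integral_pure_pure[OF Cons(1) c(2) l2]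
        integral_by_parts_muK[OF Cons(1) IH(1), of N] by simp
    then show ?case unfolding rad_Cons[OF IH(1,3)]
      using L2_integral_add(2)[OF p(3) p(5) p(1)] L2_integral_add(2)[OF p(4) p(6) p(2)] IH(4) by simp
  qed
  moreover have "f \<in> L2 M" "deriv \<phi> \<in> CS K" using Cons D_L2 CS_closed by auto
  ultimately show ?case unfolding dr_Cons[OF Cons(1,3)] using Cons(4)
      L2_integral_add(1)[OF pure_L2 T_L2[OF dr_tensor_dom[OF Cons(3)]] T_L2[OF assms(2)], of "deriv \<phi>" f]
      L2_integral_add(1)[OF pure_L2 T_L2[OF Cons(3)] T_L2[OF rad_tensor_dom[OF assms(2)]], of \<phi> f] Cons(1)
    by simp
qed

text \<open>The bilinear version of \<open>cone_Q0\<close> (see \<open>cone_Q0_eq_B0\<close>), with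
  both parts integrated for the weight of power N. It is explicit on tensors and therefore the known
  side when \<open>cone_Q\<close> is evaluated.\<close>

definition B0 :: "(real \<times> 'a \<Rightarrow> real) \<Rightarrow> (real \<times> 'a \<Rightarrow> real) \<Rightarrow> real" where
  "B0 u v = integral\<^sup>L mC (\<lambda>z. dr u z * dr v z) +
     (\<integral>r. wK K r * E (\<lambda>x. u (r, x)) (\<lambda>x. v (r, x)) \<partial>muK K N)"

lemma B0_sym: "u \<in> T \<Longrightarrow> v \<in> T \<Longrightarrow> B0 u v = B0 v u"
  unfolding B0_def using E_sym[OF T_slice T_slice] by (simp add: mult.commute)

lemma B0_add:
  assumes "u \<in> T" "v \<in> T" "w \<in> T"
  shows "B0 (\<lambda>z. u z + v z) w = B0 u w + B0 v w"
proof -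
  have "(\<integral>r. wK K r * E (\<lambda>x. u (r, x) + v (r, x)) (\<lambda>x. w (r, x)) \<partial>muK K N) =
    (\<integral>r. wK K r * E (\<lambda>x. u (r, x)) (\<lambda>x. w (r, x)) + wK K r * E (\<lambda>x. v (r, x)) (\<lambda>x. w (r, x)) \<partial>muK K N)"
    using E_add[OF T_slice T_slice T_slice, OF assms] by (simp add: algebra_simps)
  also have "\<dots> = (\<integral>r. wK K r * E (\<lambda>x. u (r, x)) (\<lambda>x. w (r, x)) \<partial>muK K N)
     + (\<integral>r. wK K r * E (\<lambda>x. v (r, x)) (\<lambda>x. w (r, x)) \<partial>muK K N)"
    by (intro Bochner_Integration.integral_add integrable_CS CS_wK T_form_CS assms)
  finally show ?thesis
    using L2_integral_add(1)[OF T_L2 T_L2 T_L2, OF dr_tensor_dom dr_tensor_dom dr_tensor_dom, OF assms]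
    by (simp add: B0_def dr_add[OF assms(1,2)])
qed

lemma B0_cmult:
  assumes "u \<in> T" "w \<in> T"
  shows "B0 (\<lambda>z. a * u z) w = a * B0 u w"
  using E_cmult[OF T_slice T_slice, OF assms]
  by (simp add: B0_def dr_cmult[OF assms(1)] algebra_simps mult.left_commute[of _ a])

lemma muK_wK_nonneg:
  assumes "\<eta> \<in> CS K" "\<And>r. r \<in> IK_int K \<Longrightarrow> 0 \<le> \<eta> r"
  shows "0 \<le> (\<integral>r. wK K r * \<eta> r \<partial>muK K N)"
proof -
  have [measurable]: "\<eta> \<in> borel_measurable borel" using assms CS_measurable by blast
  have "AE r in muK K N. 0 \<le> wK K r * \<eta> r"
    by (subst AE_muK_iff) (use assms sinK_pos in \<open>auto simp: wK_def\<close>)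
  then show ?thesis by (rule integral_nonneg_AE)
qed

lemma B0_fibre_le:
  assumes "u \<in> T"
  shows "0 \<le> (\<integral>r. wK K r * E (\<lambda>x. u (r, x)) (\<lambda>x. u (r, x)) \<partial>muK K N)"
    and "(\<integral>r. wK K r * E (\<lambda>x. u (r, x)) (\<lambda>x. u (r, x)) \<partial>muK K N) \<le> B0 u u"
    and "0 \<le> B0 u u"
proof -
  show f: "0 \<le> (\<integral>r. wK K r * E (\<lambda>x. u (r, x)) (\<lambda>x. u (r, x)) \<partial>muK K N)"
    by (intro muK_wK_nonneg T_form_CS assms E_nonneg T_slice)
  have "0 \<le> integral\<^sup>L mC (\<lambda>z. dr u z * dr u z)" by simp
  with f show "(\<integral>r. wK K r * E (\<lambda>x. u (r, x)) (\<lambda>x. u (r, x)) \<partial>muK K N) \<le> B0 u u" "0 \<le> B0 u u"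
    by (auto simp: B0_def)
qed

lemma cone_Q0_eq_B0:
  assumes "u \<in> T"
  shows "cone_Q0 K N M E u = B0 u u"
proof -
  let ?e = "\<lambda>r. E (\<lambda>x. u (r, x)) (\<lambda>x. u (r, x))"
  have e: "(\<lambda>r. wK K r * ?e r) \<in> CS K" by (intro CS_wK T_form_CS assms)
  have "(\<lambda>r. indicator (IK K) r * ?e r * sinK K r powr (N - 2)) =
     (\<lambda>r. indicator (IK K) r * sinK K r powr N * (wK K r * ?e r))"
  proof
    fix r show "indicator (IK K) r * ?e r * sinK K r powr (N - 2) =
      indicator (IK K) r * sinK K r powr N * (wK K r * ?e r)"
    proof (cases "r \<in> IK_int K")
      case True
      then have s: "sinK K r > 0" by (rule sinK_pos)
      then have "sinK K r powr (N - 2) = sinK K r powr N * wK K r"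
        by (simp add: powr_diff wK_def power2_eq_square divide_inverse)
      then show ?thesis by simp
    next
      case False
      \<comment> \<open>The power identity is used only where the profile is positive; outside the
        open interval the slices of u are zero.\<close>
      then have "?e r = 0" using tensor_dom_outside[OF assms False] E_zero[OF D_zero] by simp
      then show ?thesis by simp
    qed
  qed
  then show ?thesis
    unfolding cone_Q0_def B0_def integral_muK[OF CS_measurable[OF e]]
    by (simp add: dr_def power2_eq_square split_beta')
qed

end

context cone_form
begin

end

section \<open>Closability of the cone form\<close>

context cone_form
begin

text \<open>The adjoint of f \<mapsto> \<eta> \<otimes> f (see \<open>radial_avg_L2\<close>). On a
  tensor it is a finite combination of the fibre factors, so it stays in \<open>D\<close>, and
  \<open>E\<close> may be pulled under the radial integral.\<close>

definition radial_avg :: "(real \<Rightarrow> real) \<Rightarrow> (real \<times> 'a \<Rightarrow> real) \<Rightarrow> 'a \<Rightarrow> real" where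
  "radial_avg \<eta> u = (\<lambda>x. \<integral>r. \<eta> r * u (r, x) \<partial>muK K N)"

lemma radial_avg_Cons:
  assumes "\<eta> \<in> CS K" "\<phi> \<in> CS K" "u \<in> tensor_dom K B"
  shows "radial_avg \<eta> (\<lambda>z. \<phi> (fst z) * f (snd z) + u z) = (\<lambda>x. (\<integral>r. \<eta> r * \<phi> r \<partial>muK K N) * f x + radial_avg \<eta> u x)"
proof
  fix x
  have "(\<integral>r. (\<eta> r * \<phi> r) * f x + \<eta> r * u (r, x) \<partial>muK K N) =
    (\<integral>r. (\<eta> r * \<phi> r) * f x \<partial>muK K N) + (\<integral>r. \<eta> r * u (r, x) \<partial>muK K N)"
    by (intro Bochner_Integration.integral_add integrable_mult_left impI integrable_CS CS_closed assms
        tensor_dom_radial_CS[OF assms(3)])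
  then show "radial_avg \<eta> (\<lambda>z. \<phi> (fst z) * f (snd z) + u z) x = (\<integral>r. \<eta> r * \<phi> r \<partial>muK K N) * f x + radial_avg \<eta> u x"
    unfolding radial_avg_def by (simp add: distrib_left mult.assoc[symmetric])
qed

lemma radial_avg_zero: "radial_avg \<eta> (\<lambda>z. 0) = (\<lambda>x. 0)"
  by (simp add: radial_avg_def)

lemma radial_avg_diff:
  assumes "\<eta> \<in> CS K" "u \<in> T" "v \<in> T"
  shows "radial_avg \<eta> (\<lambda>z. u z - v z) = (\<lambda>x. radial_avg \<eta> u x - radial_avg \<eta> v x)"
proof
  fix x
  have "(\<integral>r. \<eta> r * u (r, x) - \<eta> r * v (r, x) \<partial>muK K N) =
    (\<integral>r. \<eta> r * u (r, x) \<partial>muK K N) - (\<integral>r. \<eta> r * v (r, x) \<partial>muK K N)"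
    by (intro Bochner_Integration.integral_diff integrable_CS CS_closed assms tensor_dom_radial_CS[OF assms(2)] tensor_dom_radial_CS[OF assms(3)])
  then show "radial_avg \<eta> (\<lambda>z. u z - v z) x = radial_avg \<eta> u x - radial_avg \<eta> v x"
    by (simp add: radial_avg_def right_diff_distrib)
qed

lemma radial_avg_D:
  assumes "\<eta> \<in> CS K" "u \<in> T"
  shows "radial_avg \<eta> u \<in> D"
  using assms(2)
proof (induction rule: tensor_dom_induct)
  case (Cons \<phi> f u)
  then show ?case unfolding radial_avg_Cons[OF assms(1) Cons(1,3)] by (intro D_add D_cmult)
qed (simp add: radial_avg_zero D_zero)

lemma radial_avg_form:
  assumes "\<eta> \<in> CS K" "u \<in> T" "g \<in> D"
  shows "E (radial_avg \<eta> u) g = (\<integral>r. \<eta> r * E (\<lambda>x. u (r, x)) g \<partial>muK K N)"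
  using assms(2)
proof (induction rule: tensor_dom_induct)
  case zero
  then show ?case using E_zero[OF assms(3)] by (simp add: radial_avg_zero)
next
  case (Cons \<phi> f u)
  have "(\<integral>r. \<eta> r * E (\<lambda>x. \<phi> r * f x + u (r, x)) g \<partial>muK K N) =
    (\<integral>r. (\<eta> r * \<phi> r) * E f g + \<eta> r * E (\<lambda>x. u (r, x)) g \<partial>muK K N)"
    using E_add[OF D_cmult[OF Cons(2)] T_slice[OF Cons(3)] assms(3)] E_cmult[OF Cons(2) assms(3)]
    by (simp add: distrib_left mult.assoc)
  also have "\<dots> = (\<integral>r. (\<eta> r * \<phi> r) * E f g \<partial>muK K N) + (\<integral>r. \<eta> r * E (\<lambda>x. u (r, x)) g \<partial>muK K N)"
    by (intro Bochner_Integration.integral_add integrable_mult_left impI integrable_CS CS_closed assms Cons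
        T_form_CS1)
  finally show ?case unfolding radial_avg_Cons[OF assms(1) Cons(1,3)]
    using E_add[OF D_cmult[OF Cons(2)] radial_avg_D[OF assms(1) Cons(3)] assms(3)] E_cmult[OF Cons(2) assms(3)] Cons(4)
    by simp
qed

lemma radial_avg_L2:
  assumes "\<eta> \<in> CS K" "u \<in> T" "g \<in> L2 M"
  shows "integral\<^sup>L M (\<lambda>x. radial_avg \<eta> u x * g x) = integral\<^sup>L mC (\<lambda>z. u z * (\<eta> (fst z) * g (snd z)))"
  using assms(2)
proof (induction rule: tensor_dom_induct)
  case zero
  then show ?case by (simp add: radial_avg_zero)
next
  case (Cons \<phi> f u)
  have f: "f \<in> L2 M" using D_L2 Cons by blast
  have "integral\<^sup>L mC (\<lambda>z. (\<phi> (fst z) * f (snd z)) * (\<eta> (fst z) * g (snd z))) =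
      (\<integral>r. \<eta> r * \<phi> r \<partial>muK K N) * (\<integral>x. f x * g x \<partial>M)"
    using integral_pure_pure[OF Cons(1) assms(1) f assms(3)] by (simp add: mult.commute)
  with Cons(4) show ?case unfolding radial_avg_Cons[OF assms(1) Cons(1,3)]
    using L2_integral_add(1)[OF L2_cmult[OF f] D_L2[OF radial_avg_D[OF assms(1) Cons(3)]] assms(3)]
      L2_integral_add(1)[OF pure_L2[OF Cons(1) f] T_L2[OF Cons(3)] pure_L2[OF assms(1,3)]]
    by (simp add: mult.assoc)
qed

text \<open>Duality: the squared norm of the average Z is the pairing of u with \<eta> \<otimes> Z;
  Cauchy-Schwarz bounds it by a multiple of the norm of Z, which is then cancelled.\<close>

lemma radial_avg_L2_bound:
  assumes "\<eta> \<in> CS K" "u \<in> T"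
  shows "integral\<^sup>L M (\<lambda>x. (radial_avg \<eta> u x)\<^sup>2) \<le> (\<integral>r. \<eta> r * \<eta> r \<partial>muK K N) * integral\<^sup>L mC (\<lambda>z. (u z)\<^sup>2)"
proof -
  let ?a = "integral\<^sup>L M (\<lambda>x. (radial_avg \<eta> u x)\<^sup>2)" and ?U = "integral\<^sup>L mC (\<lambda>z. (u z)\<^sup>2)"
    and ?C = "\<integral>r. \<eta> r * \<eta> r \<partial>muK K N"
  have z: "radial_avg \<eta> u \<in> L2 M" by (intro D_L2 radial_avg_D assms)
  have "?a = integral\<^sup>L mC (\<lambda>z. u z * (\<eta> (fst z) * radial_avg \<eta> u (snd z)))"
    using radial_avg_L2[OF assms z] by (simp add: power2_eq_square)
  also have "\<dots> \<le> sqrt ?U * sqrt (integral\<^sup>L mC (\<lambda>z. (\<eta> (fst z) * radial_avg \<eta> u (snd z))\<^sup>2))"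
    using L2_cauchy_schwarz[OF T_L2[OF assms(2)] pure_L2[OF assms(1) z]] by linarith
  also have "integral\<^sup>L mC (\<lambda>z. (\<eta> (fst z) * radial_avg \<eta> u (snd z))\<^sup>2) = ?C * ?a"
    using integral_pure_pure[OF assms(1,1) z z] by (simp add: power2_eq_square)
  finally have a: "?a \<le> sqrt (?U * (?C * ?a))" by (simp add: real_sqrt_mult)
  have nn: "0 \<le> ?a" "0 \<le> ?U" "0 \<le> ?C" by simp_all
  have "?a\<^sup>2 \<le> ?U * (?C * ?a)"
    using power_mono[OF a nn(1), of 2] nn by (simp add: mult_nonneg_nonneg del: real_sqrt_mult)
  then have "?a * ?a \<le> (?C * ?U) * ?a" by (simp add: power2_eq_square mult_ac)
  then show ?thesis using nn by (cases "?a = 0") (auto simp: mult_le_cancel_right)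
qed

text \<open>The same duality for the energy, obtained by expanding the nonnegative fibre energy of u
  - t \<phi> \<otimes> Z. With t = 1/(c + 1) the quadratic term is at most t E(Z, Z), half of the
  linear one; taking c + 1 instead of c keeps t defined when c = 0.\<close>

lemma radial_avg_form_bound:
  assumes "\<phi> \<in> CS K" "u \<in> T"
  defines "Z \<equiv> radial_avg (\<lambda>r. wK K r * \<phi> r) u" and "c \<equiv> (\<integral>r. wK K r * (\<phi> r * \<phi> r) \<partial>muK K N)"
  shows "E Z Z \<le> (c + 1) * (\<integral>r. wK K r * E (\<lambda>x. u (r, x)) (\<lambda>x. u (r, x)) \<partial>muK K N)"
proof -
  let ?A = "\<integral>r. wK K r * E (\<lambda>x. u (r, x)) (\<lambda>x. u (r, x)) \<partial>muK K N"
  have w: "(\<lambda>r. wK K r * \<phi> r) \<in> CS K" by (intro CS_closed assms)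
  have Z: "Z \<in> D" unfolding Z_def by (intro radial_avg_D w assms)
  have c: "0 \<le> c" unfolding c_def by (intro muK_wK_nonneg CS_closed assms) auto
  define t where "t = 1 / (c + 1)"
  have t: "0 < t" "t * c \<le> 1" "t * (c + 1) = 1" using c by (auto simp: t_def field_simps)
  let ?v = "\<lambda>z. (- t * \<phi> (fst z)) * Z (snd z) + u z"
  have v: "?v \<in> T" by (intro tensor_dom_Cons CS_closed assms Z)
  have exp: "E (\<lambda>x. ?v (r, x)) (\<lambda>x. ?v (r, x)) =
     E (\<lambda>x. u (r, x)) (\<lambda>x. u (r, x)) + (- 2 * t) * (\<phi> r * E (\<lambda>x. u (r, x)) Z) + (t * t * E Z Z) * (\<phi> r * \<phi> r)" for r
  proof -
    let ?u = "\<lambda>x. u (r, x)" and ?a = "- t * \<phi> r"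
    have u: "?u \<in> D" by (rule T_slice[OF assms(2)])
    have aZ: "(\<lambda>x. ?a * Z x) \<in> D" by (rule D_cmult[OF Z])
    have "E (\<lambda>x. ?a * Z x + ?u x) (\<lambda>x. ?a * Z x + ?u x) = E ?u ?u + 2 * (?a * E ?u Z) + ?a * ?a * E Z Z"
      unfolding E_add[OF aZ u D_add[OF aZ u]] E_add_right[OF aZ u u] E_add_right[OF aZ u aZ]
        E_cmult[OF Z u] E_cmult_right[OF Z u] E_cmult[OF Z aZ] E_cmult_right[OF Z Z] E_sym[OF Z u] by simp
    then show ?thesis by (simp add: algebra_simps)
  qed
  have "(\<integral>r. wK K r * E (\<lambda>x. ?v (r, x)) (\<lambda>x. ?v (r, x)) \<partial>muK K N) =
    (\<integral>r. (wK K r * E (\<lambda>x. u (r, x)) (\<lambda>x. u (r, x)) + (- 2 * t) * (wK K r * \<phi> r * E (\<lambda>x. u (r, x)) Z))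
      + (t * t * E Z Z) * (wK K r * (\<phi> r * \<phi> r)) \<partial>muK K N)"
    by (rule Bochner_Integration.integral_cong[OF refl], unfold exp) (simp add: algebra_simps)
  also have "\<dots> = (?A + (\<integral>r. (- 2 * t) * (wK K r * \<phi> r * E (\<lambda>x. u (r, x)) Z) \<partial>muK K N))
      + (\<integral>r. (t * t * E Z Z) * (wK K r * (\<phi> r * \<phi> r)) \<partial>muK K N)"
    by (subst Bochner_Integration.integral_add Bochner_Integration.integral_add,
        (intro Bochner_Integration.integrable_add integrable_CS CS_closed assms w T_form_CS T_form_CS1 Z)+)+ simp
  also have "\<dots> = ?A + (- 2 * t) * E Z Z + (t * t * E Z Z) * c"
    using radial_avg_form[OF w assms(2) Z] by (simp add: Z_def c_def)
  finally have "0 \<le> ?A + (- 2 * t) * E Z Z + (t * t * E Z Z) * c" using B0_fibre_le(1)[OF v] by simp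
  moreover have "(t * t * E Z Z) * c \<le> t * E Z Z"
    using mult_right_mono[OF t(2), of "t * E Z Z"] t(1) E_nonneg[OF Z] by (simp add: mult_ac)
  ultimately have "t * E Z Z \<le> ?A" by linarith
  then have "(c + 1) * (t * E Z Z) \<le> (c + 1) * ?A" using c by (intro mult_left_mono) auto
  with t(3) show ?thesis by (simp add: mult.assoc[symmetric] mult.commute)
qed

text \<open>Pairing a tensor sequence with \<open>\<phi> \<otimes> f\<close> only sees its radial average against \<open>\<phi>\<close>, which
  stays in \<open>D\<close>; so closability of the cone form reduces to closedness of the form on the fibre.\<close>

lemma fibre_average_tendsto_zero:
  assumes d: "\<And>n. d n \<in> T" and null: "(\<lambda>n. integral\<^sup>L mC (\<lambda>z. (d n z)\<^sup>2)) \<longlonglongrightarrow> 0"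
    and cauchy: "\<And>\<epsilon>. \<epsilon> > 0 \<Longrightarrow> \<exists>n0. \<forall>n\<ge>n0. \<forall>m\<ge>n0. B0 (\<lambda>z. d n z - d m z) (\<lambda>z. d n z - d m z) < \<epsilon>"
    and \<phi>: "\<phi> \<in> CS K" and f: "f \<in> D"
  shows "(\<lambda>n. E (radial_avg (\<lambda>r. wK K r * \<phi> r) (d n)) f) \<longlonglongrightarrow> 0"
proof -
  define \<eta> where "\<eta> = (\<lambda>r. wK K r * \<phi> r)"
  have \<eta>: "\<eta> \<in> CS K" unfolding \<eta>_def by (intro CS_closed \<phi>)
  define z where "z n = radial_avg \<eta> (d n)" for n
  have z: "z n \<in> D" for n unfolding z_def by (intro radial_avg_D \<eta> d)
  define c where "c = (\<integral>r. wK K r * (\<phi> r * \<phi> r) \<partial>muK K N)"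
  define C where "C = (\<integral>r. \<eta> r * \<eta> r \<partial>muK K N)"
  have c: "0 \<le> c" unfolding c_def by (intro muK_wK_nonneg CS_closed \<phi>) auto
  have C: "0 \<le> C" unfolding C_def by simp
  let ?n = "\<lambda>n. integral\<^sup>L mC (\<lambda>z. (d n z)\<^sup>2)"
  have bound: "E1 M E (\<lambda>x. z n x - z m x) \<le> (c + 1) * B0 (\<lambda>z. d n z - d m z) (\<lambda>z. d n z - d m z)
      + C * (2 * ?n n + 2 * ?n m)" for n m
  proof -
    have dd: "(\<lambda>z. d n z - d m z) \<in> T" by (intro tensor_dom_diff d)
    have zz: "(\<lambda>x. z n x - z m x) = radial_avg \<eta> (\<lambda>z. d n z - d m z)"
      unfolding z_def by (rule radial_avg_diff[OF \<eta> d d, symmetric])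
    have "E (\<lambda>x. z n x - z m x) (\<lambda>x. z n x - z m x) \<le> (c + 1) * B0 (\<lambda>z. d n z - d m z) (\<lambda>z. d n z - d m z)"
      unfolding zz \<eta>_def c_def
      by (rule order_trans[OF radial_avg_form_bound[OF \<phi> dd]], rule mult_left_mono[OF B0_fibre_le(2)[OF dd]])
         (use c in \<open>simp add: c_def\<close>)
    moreover have "integral\<^sup>L M (\<lambda>x. (z n x - z m x)\<^sup>2) \<le> C * (2 * ?n n + 2 * ?n m)"
      using radial_avg_L2_bound[OF \<eta> dd] mult_left_mono[OF L2_norm_add_bound[OF T_L2[OF d] T_L2[OF d], of n m] C]
      by (simp add: fun_cong[OF zz] C_def)
    ultimately show ?thesis by (simp add: E1_def)
  qed
  have "\<exists>v\<in>D. (\<lambda>n. E1 M E (\<lambda>x. z n x - v x)) \<longlonglongrightarrow> 0"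
  proof (rule D_closed[OF z])
    fix \<epsilon> :: real assume "\<epsilon> > 0"
    \<comment> \<open>Each half of \<open>bound\<close> is to be at most \<epsilon>/2: the 8 pays
      for the coefficients 2 + 2 and for the halving, and C + 1 replaces C, which may be 0.\<close>
    then have e: "\<epsilon> / (2 * (c + 1)) > 0" "\<epsilon> / (8 * (C + 1)) > 0" using c C by auto
    obtain n1 where n1: "\<forall>n\<ge>n1. \<forall>m\<ge>n1. B0 (\<lambda>z. d n z - d m z) (\<lambda>z. d n z - d m z) < \<epsilon> / (2 * (c + 1))"
      using cauchy[OF e(1)] by blast
    obtain n2 where n2: "\<forall>n\<ge>n2. ?n n < \<epsilon> / (8 * (C + 1))"
      using order_tendstoD(2)[OF null e(2)] unfolding eventually_sequentially by blast
    have "E1 M E (\<lambda>x. z n x - z m x) < \<epsilon>" if "n \<ge> max n1 n2" "m \<ge> max n1 n2" for n m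
    proof -
      have "(c + 1) * B0 (\<lambda>z. d n z - d m z) (\<lambda>z. d n z - d m z) < (c + 1) * (\<epsilon> / (2 * (c + 1)))"
        using n1 that c by (intro mult_strict_left_mono) auto
      also have "\<dots> = \<epsilon> / 2" using c by (simp add: field_simps)
      finally have 1: "(c + 1) * B0 (\<lambda>z. d n z - d m z) (\<lambda>z. d n z - d m z) < \<epsilon> / 2" .
      have "?n n < \<epsilon> / (8 * (C + 1))" "?n m < \<epsilon> / (8 * (C + 1))" using n2 that by auto
      then have "2 * ?n n + 2 * ?n m \<le> 4 * (\<epsilon> / (8 * (C + 1)))" by linarith
      then have "C * (2 * ?n n + 2 * ?n m) \<le> C * (4 * (\<epsilon> / (8 * (C + 1))))"
        using C by (rule mult_left_mono)
      also have "\<dots> \<le> \<epsilon> / 2" using C \<open>\<epsilon> > 0\<close> by (simp add: field_simps)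
      finally show ?thesis using 1 bound[of n m] by linarith
    qed
    then show "\<exists>n0. \<forall>n\<ge>n0. \<forall>m\<ge>n0. E1 M E (\<lambda>x. z n x - z m x) < \<epsilon>" by blast
  qed
  then obtain v where v: "v \<in> D" "(\<lambda>n. E1 M E (\<lambda>x. z n x - v x)) \<longlonglongrightarrow> 0" by blast
  have zv: "(\<lambda>x. z n x - v x) \<in> D" for n by (intro D_diff z v)
  have zL: "integral\<^sup>L M (\<lambda>x. (z n x)\<^sup>2) \<le> C * ?n n" for n
    using radial_avg_L2_bound[OF \<eta> d] by (simp add: z_def C_def)
  \<comment> \<open>The averages tend to 0 in L2, which forces the limit found by closedness to
    vanish almost everywhere.\<close>
  have "integral\<^sup>L M (\<lambda>x. (v x)\<^sup>2) \<le> 2 * (C * ?n n) + 2 * E1 M E (\<lambda>x. z n x - v x)" for n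
  proof -
    have "integral\<^sup>L M (\<lambda>x. (z n x - (z n x - v x))\<^sup>2) \<le> 2 * integral\<^sup>L M (\<lambda>x. (z n x)\<^sup>2) +
       2 * integral\<^sup>L M (\<lambda>x. (z n x - v x)\<^sup>2)"
      by (rule L2_norm_add_bound[OF D_L2[OF z] D_L2[OF zv]])
    also have "\<dots> \<le> 2 * (C * ?n n) + 2 * E1 M E (\<lambda>x. z n x - v x)"
      using zL[of n] E_nonneg[OF zv, of n] by (simp add: E1_def)
    finally show ?thesis by simp
  qed
  moreover have "(\<lambda>n. 2 * (C * ?n n) + 2 * E1 M E (\<lambda>x. z n x - v x)) \<longlonglongrightarrow> 2 * (C * 0) + 2 * 0"
    by (intro tendsto_intros null v)
  ultimately have "integral\<^sup>L M (\<lambda>x. (v x)\<^sup>2) \<le> 2 * (C * 0) + 2 * 0"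
    by (intro LIMSEQ_le_const) auto
  then have "integral\<^sup>L M (\<lambda>x. (v x)\<^sup>2) = 0" by (simp add: order_antisym)
  then have v0: "AE x in M. v x = 0" by (rule AE_zero_if_integral_square_zero[OF D_L2[OF v(1)]])
  \<comment> \<open>Since v is null, \<open>E\<close> does not distinguish z n - v from z n, so
    convergence to v in the energy norm means that the energy of z n tends to 0.\<close>
  have "E (z n) (z n) \<le> E1 M E (\<lambda>x. z n x - v x)" for n
  proof -
    have zm: "z n \<in> borel_measurable M" using D_L2[OF z] by (simp add: L2_def)
    have ae: "AE x in M. z n x - v x = z n x" using v0 by eventually_elim simp
    have "E (\<lambda>x. z n x - v x) (\<lambda>x. z n x - v x) = E (z n) (z n)"
      using D_AE_cong(2)[OF zv zm ae] z zv E_sym[OF z zv] by metis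
    then show ?thesis by (simp add: E1_def)
  qed
  then have "(\<lambda>n. E (z n) (z n)) \<longlonglongrightarrow> 0"
    by (intro tendsto_sandwich[OF _ _ tendsto_const v(2)]) (auto simp: E_nonneg[OF z])
  then have "(\<lambda>n. sqrt (E (z n) (z n)) * sqrt (E f f)) \<longlonglongrightarrow> sqrt 0 * sqrt (E f f)"
    by (intro tendsto_intros)
  then have "(\<lambda>n. sqrt (E (z n) (z n)) * sqrt (E f f)) \<longlonglongrightarrow> 0" by simp
  then have "(\<lambda>n. E (z n) f) \<longlonglongrightarrow> 0"
    by (rule Lim_null_comparison[rotated]) (use E_cauchy_schwarz[OF z f] in auto)
  then show ?thesis by (simp add: z_def \<eta>_def)
qed

text \<open>In the radial part both derivatives are moved onto v, leaving an L2 pairing with a null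
  sequence; in the fibre part each pure factor of v produces a radial average of d n, handled by
  \<open>fibre_average_tendsto_zero\<close>.\<close>

lemma B0_weak_null:
  assumes d: "\<And>n. d n \<in> T" and null: "(\<lambda>n. integral\<^sup>L mC (\<lambda>z. (d n z)\<^sup>2)) \<longlonglongrightarrow> 0"
    and cauchy: "\<And>\<epsilon>. \<epsilon> > 0 \<Longrightarrow> \<exists>n0. \<forall>n\<ge>n0. \<forall>m\<ge>n0. B0 (\<lambda>z. d n z - d m z) (\<lambda>z. d n z - d m z) < \<epsilon>"
    and v: "v \<in> T"
  shows "(\<lambda>n. B0 (d n) v) \<longlonglongrightarrow> 0"
proof -
  let ?r = "rad (dr v)"
  have r: "?r \<in> T" by (intro rad_tensor_dom dr_tensor_dom v)
  have "(\<lambda>n. sqrt (integral\<^sup>L mC (\<lambda>z. (d n z)\<^sup>2)) * sqrt (integral\<^sup>L mC (\<lambda>z. (?r z)\<^sup>2)))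
     \<longlonglongrightarrow> sqrt 0 * sqrt (integral\<^sup>L mC (\<lambda>z. (?r z)\<^sup>2))"
    by (intro tendsto_intros null)
  then have "(\<lambda>n. sqrt (integral\<^sup>L mC (\<lambda>z. (d n z)\<^sup>2)) * sqrt (integral\<^sup>L mC (\<lambda>z. (?r z)\<^sup>2))) \<longlonglongrightarrow> 0" by simp
  then have 1: "(\<lambda>n. integral\<^sup>L mC (\<lambda>z. dr (d n) z * dr v z)) \<longlonglongrightarrow> 0"
    by (rule Lim_null_comparison[rotated])
       (use L2_cauchy_schwarz[OF T_L2[OF d] T_L2[OF r]] in \<open>auto simp: radial_by_parts[OF d dr_tensor_dom[OF v]]\<close>)
  have 2: "(\<lambda>n. \<integral>r. wK K r * E (\<lambda>x. d n (r, x)) (\<lambda>x. v (r, x)) \<partial>muK K N) \<longlonglongrightarrow> 0"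
    using v
  proof (induction rule: tensor_dom_induct)
    case zero
    have "E (\<lambda>x. d n (r, x)) (\<lambda>x. 0) = 0" for n r
      using E_zero[OF T_slice[OF d]] E_sym[OF T_slice[OF d] D_zero] by simp
    then show ?case by simp
  next
    case (Cons \<phi> f v)
    have w: "(\<lambda>r. wK K r * \<phi> r) \<in> CS K" by (intro CS_closed Cons)
    have "(\<integral>r. wK K r * E (\<lambda>x. d n (r, x)) (\<lambda>x. \<phi> r * f x + v (r, x)) \<partial>muK K N) =
      E (radial_avg (\<lambda>r. wK K r * \<phi> r) (d n)) f + (\<integral>r. wK K r * E (\<lambda>x. d n (r, x)) (\<lambda>x. v (r, x)) \<partial>muK K N)" for n
    proof -
      have "(\<integral>r. wK K r * E (\<lambda>x. d n (r, x)) (\<lambda>x. \<phi> r * f x + v (r, x)) \<partial>muK K N) =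
        (\<integral>r. (wK K r * \<phi> r) * E (\<lambda>x. d n (r, x)) f + wK K r * E (\<lambda>x. d n (r, x)) (\<lambda>x. v (r, x)) \<partial>muK K N)"
        using E_add_right[OF D_cmult[OF Cons(2)] T_slice[OF Cons(3)] T_slice[OF d]]
          E_cmult_right[OF Cons(2) T_slice[OF d]] by (simp add: distrib_left mult.assoc)
      also have "\<dots> = (\<integral>r. (wK K r * \<phi> r) * E (\<lambda>x. d n (r, x)) f \<partial>muK K N) +
          (\<integral>r. wK K r * E (\<lambda>x. d n (r, x)) (\<lambda>x. v (r, x)) \<partial>muK K N)"
        by (intro Bochner_Integration.integral_add integrable_CS CS_closed w T_form_CS1 T_form_CS d Cons)
      finally show ?thesis using radial_avg_form[OF w d Cons(2)] by simp
    qed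
    with tendsto_add[OF fibre_average_tendsto_zero[OF d null cauchy Cons(1,2)] Cons(4)]
    show ?case by simp
  qed
  show ?thesis using tendsto_add[OF 1 2] by (simp add: B0_def)
qed

lemma B0_diff_expand:
  assumes "u \<in> T" "v \<in> T"
  shows "B0 (\<lambda>z. u z - v z) (\<lambda>z. u z - v z) = B0 u u - 2 * B0 u v + B0 v v"
    and "B0 (\<lambda>z. u z + v z) (\<lambda>z. u z + v z) = B0 u u + 2 * B0 u v + B0 v v"
proof -
  have gen: "B0 (\<lambda>z. u z + a * v z) (\<lambda>z. u z + a * v z) = B0 u u + 2 * a * B0 u v + a * a * B0 v v" for a
  proof -
    have av: "(\<lambda>z. a * v z) \<in> T" using tensor_dom_cmult[OF assms(2)] .
    have s: "(\<lambda>z. u z + a * v z) \<in> T" by (intro tensor_dom_add assms av)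
    have r: "B0 w (\<lambda>z. u z + a * v z) = B0 w u + a * B0 w v" if "w \<in> T" for w
      using B0_add[OF assms(1) av that] B0_cmult[OF assms(2) that] B0_sym[OF that s] B0_sym[OF that] assms by simp
    show ?thesis
      using B0_add[OF assms(1) av s] B0_cmult[OF assms(2) s] r[OF assms(1)] r[OF assms(2)] B0_sym[OF assms]
      by (simp add: algebra_simps)
  qed
  show "B0 (\<lambda>z. u z - v z) (\<lambda>z. u z - v z) = B0 u u - 2 * B0 u v + B0 v v" using gen[of "-1"] by simp
  show "B0 (\<lambda>z. u z + v z) (\<lambda>z. u z + v z) = B0 u u + 2 * B0 u v + B0 v v" using gen[of 1] by simp
qed

lemma B0_closable:
  assumes d: "\<And>n. d n \<in> T" and null: "(\<lambda>n. integral\<^sup>L mC (\<lambda>z. (d n z)\<^sup>2)) \<longlonglongrightarrow> 0"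
    and cauchy: "\<And>\<epsilon>. \<epsilon> > 0 \<Longrightarrow> \<exists>n0. \<forall>n\<ge>n0. \<forall>m\<ge>n0. B0 (\<lambda>z. d n z - d m z) (\<lambda>z. d n z - d m z) < \<epsilon>"
  shows "(\<lambda>n. B0 (d n) (d n)) \<longlonglongrightarrow> 0"
proof (rule LIMSEQ_I)
  \<comment> \<open>\<open>B0 d\<^sub>n d\<^sub>n \<le> B0 (d\<^sub>n - d\<^sub>m) (d\<^sub>n - d\<^sub>m) + 2 * B0 d\<^sub>n d\<^sub>m\<close>, and the last term tends to \<open>0\<close> for fixed \<open>m\<close>.\<close>
  fix \<epsilon> :: real assume "0 < \<epsilon>"
  then obtain n0 where n0: "\<forall>n\<ge>n0. \<forall>m\<ge>n0. B0 (\<lambda>z. d n z - d m z) (\<lambda>z. d n z - d m z) < \<epsilon> / 2"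
    using cauchy[of "\<epsilon> / 2"] by auto
  have "(\<lambda>n. B0 (d n) (d n0)) \<longlonglongrightarrow> 0" by (rule B0_weak_null[OF d null cauchy d])
  from order_tendstoD(2)[OF this, of "\<epsilon> / 4"] \<open>0 < \<epsilon>\<close>
  obtain n1 where n1: "\<forall>n\<ge>n1. B0 (d n) (d n0) < \<epsilon> / 4" unfolding eventually_sequentially by auto
  have "norm (B0 (d n) (d n) - 0) < \<epsilon>" if "n \<ge> max n0 n1" for n
  proof -
    have "B0 (\<lambda>z. d n z - d n0 z) (\<lambda>z. d n z - d n0 z) < \<epsilon> / 2" "B0 (d n) (d n0) < \<epsilon> / 4" using n0 n1 that by auto
    then show ?thesis using B0_diff_expand(1)[OF d d, of n n0] B0_fibre_le(3)[OF d, of n] B0_fibre_le(3)[OF d, of n0]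
      by simp
  qed
  then show "\<exists>no. \<forall>n\<ge>no. norm (B0 (d n) (d n) - 0) < \<epsilon>" by blast
qed

section \<open>The cone form evaluated on tensors\<close>

lemma B0_zero: "B0 (\<lambda>z. 0) (\<lambda>z. 0) = 0"
  using E_zero[OF D_zero] by (simp add: B0_def dr_zero)

lemma approx_seq_const: "u \<in> T \<Longrightarrow> approx_seq K N M D E u (\<lambda>n. u)"
  by (auto simp: approx_seq_def cone_Q0_eq_B0[OF tensor_dom_zero] B0_zero)

text \<open>\<open>cone_Q\<close> is some limit along some approximating sequence, so every such
  limit has to be identified. The difference from the constant sequence u is Cauchy and L2-null, and
  closability removes its contribution.\<close>

lemma cone_Q_eq_B0:
  assumes u: "u \<in> T"
  shows "cone_Q K N M D E u = B0 u u"
proof -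
  have uniq: "l = B0 u u" if s: "approx_seq K N M D E u s" and l: "(\<lambda>n. cone_Q0 K N M E (s n)) \<longlonglongrightarrow> l" for l s
  proof -
    have sT: "s n \<in> T" for n using s by (simp add: approx_seq_def)
    define d where "d n = (\<lambda>z. s n z - u z)" for n
    have d: "d n \<in> T" for n unfolding d_def by (intro tensor_dom_diff sT u)
    have dd: "(\<lambda>z. d n z - d m z) = (\<lambda>z. s n z - s m z)" for n m by (simp add: d_def)
    have "(\<lambda>n. B0 (d n) (d n)) \<longlonglongrightarrow> 0"
    proof (rule B0_closable[OF d])
      show "(\<lambda>n. integral\<^sup>L mC (\<lambda>z. (d n z)\<^sup>2)) \<longlonglongrightarrow> 0" using s by (simp add: approx_seq_def d_def)
      fix \<epsilon> :: real assume "\<epsilon> > 0"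
      with s show "\<exists>n0. \<forall>n\<ge>n0. \<forall>m\<ge>n0. B0 (\<lambda>z. d n z - d m z) (\<lambda>z. d n z - d m z) < \<epsilon>"
        unfolding dd by (simp add: approx_seq_def cone_Q0_eq_B0[OF tensor_dom_diff[OF sT sT]])
    qed
    moreover have "(\<lambda>n. B0 (d n) u) \<longlonglongrightarrow> 0"
    proof (rule B0_weak_null[OF d _ _ u])
      show "(\<lambda>n. integral\<^sup>L mC (\<lambda>z. (d n z)\<^sup>2)) \<longlonglongrightarrow> 0" using s by (simp add: approx_seq_def d_def)
      fix \<epsilon> :: real assume "\<epsilon> > 0"
      with s show "\<exists>n0. \<forall>n\<ge>n0. \<forall>m\<ge>n0. B0 (\<lambda>z. d n z - d m z) (\<lambda>z. d n z - d m z) < \<epsilon>"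
        unfolding dd by (simp add: approx_seq_def cone_Q0_eq_B0[OF tensor_dom_diff[OF sT sT]])
    qed
    ultimately have "(\<lambda>n. B0 (d n) (d n) + 2 * B0 (d n) u + B0 u u) \<longlonglongrightarrow> 0 + 2 * 0 + B0 u u"
      by (intro tendsto_intros)
    moreover have "cone_Q0 K N M E (s n) = B0 (d n) (d n) + 2 * B0 (d n) u + B0 u u" for n
      using B0_diff_expand(2)[OF d u, of n] by (simp add: cone_Q0_eq_B0[OF sT] d_def)
    ultimately have "(\<lambda>n. cone_Q0 K N M E (s n)) \<longlonglongrightarrow> B0 u u" by simp
    with l show ?thesis by (rule LIMSEQ_unique)
  qed
  have "\<exists>s. approx_seq K N M D E u s \<and> (\<lambda>n. cone_Q0 K N M E (s n)) \<longlonglongrightarrow> B0 u u"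
    by (intro exI[of _ "\<lambda>n. u"]) (simp add: approx_seq_const u cone_Q0_eq_B0)
  then show ?thesis unfolding cone_Q_def by (rule someI2) (use uniq in blast)
qed

abbreviation "DC \<equiv> cone_dom K N M D E"
abbreviation "EC \<equiv> cone_E K N M D E"

lemma T_DC: "u \<in> T \<Longrightarrow> u \<in> DC"
  using approx_seq_const T_L2 by (auto simp: cone_dom_def)

lemma EC_eq_B0:
  assumes "u \<in> T" "v \<in> T"
  shows "EC u v = B0 u v"
  using B0_diff_expand[OF assms] cone_Q_eq_B0[OF tensor_dom_add[OF assms]] cone_Q_eq_B0[OF tensor_dom_diff[OF assms]]
  by (simp add: cone_E_def)

text \<open>An approximating sequence sees its target only through an L2 distance. This is needed
  because chosen generators and carres du champ agree with tensors only almost everywhere.\<close>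

lemma cone_Q_AE_cong:
  assumes "u \<in> borel_measurable mC" "v \<in> borel_measurable mC" "AE z in mC. u z = v z"
  shows "cone_Q K N M D E u = cone_Q K N M D E v"
proof -
  have "approx_seq K N M D E u s \<longleftrightarrow> approx_seq K N M D E v s" for s
  proof -
    have "integral\<^sup>L mC (\<lambda>z. (s n z - u z)\<^sup>2) = integral\<^sup>L mC (\<lambda>z. (s n z - v z)\<^sup>2)" if "s n \<in> T" for n
    proof (rule integral_cong_AE)
      show "AE z in mC. (s n z - u z)\<^sup>2 = (s n z - v z)\<^sup>2" using assms(3) by eventually_elim simp
    qed (use assms L2_measurable[OF T_L2[OF that]] in auto)
    then show ?thesis unfolding approx_seq_def by (auto cong: conj_cong)
  qed
  then show ?thesis by (simp add: cone_Q_def)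
qed

lemma EC_AE_cong:
  assumes "u \<in> borel_measurable mC" "u' \<in> borel_measurable mC" "AE z in mC. u z = u' z"
    and "v \<in> borel_measurable mC" "v' \<in> borel_measurable mC" "AE z in mC. v z = v' z"
  shows "EC u v = EC u' v'"
proof -
  have "AE z in mC. u z + v z = u' z + v' z" "AE z in mC. u z - v z = u' z - v' z"
    using assms(3,6) by (eventually_elim, simp)+
  with assms show ?thesis unfolding cone_E_def
    using cone_Q_AE_cong[of "\<lambda>z. u z + v z" "\<lambda>z. u' z + v' z"] cone_Q_AE_cong[of "\<lambda>z. u z - v z" "\<lambda>z. u' z - v' z"]
    by simp
qed

end

section \<open>Tensors as test functions\<close>

text \<open>On the sets where \<open>k\<close> is positive or negative the integrand has one sign,
  so a zero integral makes it null.\<close>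

lemma AE_zero_if_set_integrals_zero:
  fixes k :: "'b \<Rightarrow> real"
  assumes k: "integrable m k" and z: "\<And>A. A \<in> sets m \<Longrightarrow> (LINT x:A|m. k x) = 0"
  shows "AE x in m. k x = 0"
proof -
  have [measurable]: "k \<in> borel_measurable m" using k by simp
  let ?P = "{x \<in> space m. 0 < k x}" and ?Q = "{x \<in> space m. k x < 0}"
  have *: "AE x in m. g x = 0" if "integrable m g" "\<And>x. x \<in> space m \<Longrightarrow> 0 \<le> g x" "integral\<^sup>L m g = 0" for g :: "'b \<Rightarrow> real"
    using integral_nonneg_eq_0_iff_AE[OF that(1) AE_I2[OF that(2)]] that(3) by simp
  have P: "?P \<in> sets m" and Q: "?Q \<in> sets m" by measurable
  have 1: "AE x in m. indicator ?P x *\<^sub>R k x = 0"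
  proof (rule *)
    show "integrable m (\<lambda>x. indicator ?P x *\<^sub>R k x)" using integrable_mult_indicator[OF P k] .
  qed (use z[OF P] in \<open>auto simp: set_lebesgue_integral_def indicator_def\<close>)
  have 2: "AE x in m. - (indicator ?Q x *\<^sub>R k x) = 0"
  proof (rule *)
    show "integrable m (\<lambda>x. - (indicator ?Q x *\<^sub>R k x))" using integrable_mult_indicator[OF Q k] by simp
  qed (use z[OF Q] in \<open>auto simp: set_lebesgue_integral_def indicator_def\<close>)
  from 1 2 AE_space show ?thesis
  proof eventually_elim
    case (elim x)
    then show ?case by (cases "k x" "0::real" rule: linorder_cases) auto
  qed
qed

text \<open>The sets over which the integral of \<open>k\<close> vanishes form a Dynkin system;
  \<open>tot\<close> provides the complements, as the whole space need not belong to the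
  generator.\<close>

lemma set_integral_zero_dynkin:
  fixes k :: "'b \<Rightarrow> real"
  assumes k: "integrable m k" and G: "Int_stable G" "G \<subseteq> Pow (space m)" "sets m = sigma_sets (space m) G"
    and z: "\<And>A. A \<in> G \<Longrightarrow> (LINT x:A|m. k x) = 0" and tot: "integral\<^sup>L m k = 0"
    and A: "A \<in> sets m"
  shows "(LINT x:A|m. k x) = 0"
  using G(1,2) A[unfolded G(3)]
proof (induction rule: sigma_sets_induct_disjoint)
  case (basic A)
  then show ?case by (rule z)
next
  case empty
  then show ?case by (simp add: set_lebesgue_integral_def)
next
  case (compl A)
  then have A: "A \<in> sets m" using G by simp
  have "(LINT x:(space m - A)|m. k x) = (LINT x|m. k x - indicator A x *\<^sub>R k x)"
    unfolding set_lebesgue_integral_def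
    by (intro Bochner_Integration.integral_cong refl) (auto simp: indicator_def)
  also have "\<dots> = integral\<^sup>L m k - (LINT x:A|m. k x)"
    unfolding set_lebesgue_integral_def
    by (rule Bochner_Integration.integral_diff[OF k integrable_mult_indicator[OF A k]])
  finally show ?case using compl tot by simp
next
  case (union A)
  then have A: "A i \<in> sets m" for i using G by auto
  have "(LINT x:(\<Union>i. A i)|m. k x) = (\<Sum>i. (LINT x:(A i)|m. k x))"
  proof (rule lebesgue_integral_countable_add[OF A])
    show "A i \<inter> A j = {}" if "i \<noteq> j" for i j using union(1) that by (auto simp: disjoint_family_on_def)
    show "set_integrable m (\<Union>i. A i) k"
      unfolding set_integrable_def using A by (intro integrable_mult_indicator k) auto
  qed
  with union show ?case by simp
qed

text \<open>Differentiation turns the sine into a sine with another amplitude and a phase shifted by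
  \<pi>/2, so amplitude and phase are left general for the induction. The sine is a bounded smooth
  function vanishing at 0, as composition in the algebra requires.\<close>

lemma Ck_fun_sin: "Ck_fun (Suc 0) k (\<lambda>y. c * sin (t * y 0 + s))"
proof -
  have co: "continuous_on (fin_coords (Suc 0)) (\<lambda>y. c * sin (t * y 0 + s))" for c s :: real
    by (intro continuous_intros continuous_on_product_coordinates[THEN continuous_on_subset]) auto
  show ?thesis
  proof (induction k arbitrary: c s)
    case 0 then show ?case using co by simp
  next
    case (Suc k)
    have d: "((\<lambda>u. c * sin (t * (y(0 := u)) 0 + s)) has_real_derivative c * t * sin (t * x + (s + pi/2))) (at x)" for y :: "nat \<Rightarrow> real" and x
      by (auto intro!: derivative_eq_intros simp: sin_add cos_add algebra_simps)
    have "partial_deriv 0 (\<lambda>y. c * sin (t * y 0 + s)) = (\<lambda>y. c * t * sin (t * y 0 + (s + pi/2)))"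
      unfolding partial_deriv_def using DERIV_imp_deriv[OF d] by simp
    moreover have "(\<lambda>u. c * sin (t * (y(0 := u)) 0 + s)) differentiable (at x)" for y :: "nat \<Rightarrow> real" and x
      using d real_differentiable_def by blast
    ultimately show ?case using Suc co by (simp del: fun_upd_apply)
  qed
qed

locale cone_algebra = cone_form +
  fixes A :: "('a \<Rightarrow> real) set"
  assumes alg: "admissible_algebra M D E A"
begin

lemma A_bounded: "u \<in> A \<Longrightarrow> \<exists>C. \<forall>x. \<bar>u x\<bar> \<le> C"
  using alg unfolding admissible_algebra_def by (elim conjE) blast

lemma A_D: "u \<in> A \<Longrightarrow> u \<in> D"
  using alg unfolding admissible_algebra_def gen_dom_def is_gen_def by (elim conjE) blast

lemma A_L2: "u \<in> A \<Longrightarrow> u \<in> L2 M"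
  using A_D D_L2 by blast

lemma A_measurable: "u \<in> A \<Longrightarrow> u \<in> borel_measurable M"
  using A_L2 L2_measurable by blast

lemma A_add: "u \<in> A \<Longrightarrow> v \<in> A \<Longrightarrow> (\<lambda>x. u x + v x) \<in> A"
  using alg unfolding admissible_algebra_def by (elim conjE) blast

lemma A_mult: "u \<in> A \<Longrightarrow> v \<in> A \<Longrightarrow> (\<lambda>x. u x * v x) \<in> A"
  using alg unfolding admissible_algebra_def by (elim conjE) blast

lemma A_cmult: "u \<in> A \<Longrightarrow> (\<lambda>x. a * u x) \<in> A"
  using alg unfolding admissible_algebra_def by (elim conjE) blast

lemma A_L1_dense:
  assumes "f \<in> borel_measurable M" "integrable M f" "\<epsilon> > 0"
  shows "\<exists>a\<in>A. integrable M (\<lambda>x. f x - a x) \<and> (\<integral>x. \<bar>f x - a x\<bar> \<partial>M) < \<epsilon>"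
proof -
  have "\<forall>p::real. p \<ge> 1 \<longrightarrow> (\<forall>f\<in>borel_measurable M. integrable M (\<lambda>x. \<bar>f x\<bar> powr p) \<longrightarrow>
        (\<forall>\<epsilon>>0. \<exists>a\<in>A. integrable M (\<lambda>x. \<bar>f x - a x\<bar> powr p) \<and>
                     integral\<^sup>L M (\<lambda>x. \<bar>f x - a x\<bar> powr p) < \<epsilon>))"
    using alg unfolding admissible_algebra_def by (elim conjE)
  from this[rule_format, of 1, OF _ assms(1) _ assms(3)] assms(2)
  obtain a where a: "a \<in> A" "integrable M (\<lambda>x. \<bar>f x - a x\<bar>)" "(\<integral>x. \<bar>f x - a x\<bar> \<partial>M) < \<epsilon>" by auto
  have "(\<lambda>x. f x - a x) \<in> borel_measurable M" using assms A_measurable[OF a(1)] by simp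
  from integrable_abs_iff[OF this] a show ?thesis by (intro bexI[of _ a] conjI) auto
qed

lemma A_sin:
  assumes "a \<in> A"
  shows "(\<lambda>x. sin (t * a x)) \<in> A"
proof -
  have "\<forall>n \<Phi> us. smooth_fun n \<Phi> \<and> \<Phi> (\<lambda>i. 0) = 0 \<and> (\<forall>i<n. us i \<in> A) \<longrightarrow>
        (\<lambda>x. \<Phi> (\<lambda>i. if i < n then us i x else 0)) \<in> A"
    using alg unfolding admissible_algebra_def by (elim conjE)
  from this[rule_format, of "Suc 0" "\<lambda>y. sin (t * y 0)" "\<lambda>i. a"]
  show ?thesis using assms Ck_fun_sin[of _ 1 t 0] by (simp add: smooth_fun_def)
qed

text \<open>Composing with \<open>sin (\<pi>/2 \<cdot>)\<close>, which fixes \<open>0\<close> and \<open>1\<close>, makes an \<open>L\<^sup>1\<close>-approximation of an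
  indicator function uniformly bounded.\<close>

lemma A_approx_indicator:
  assumes B: "B \<in> sets M" "emeasure M B < \<infinity>"
  obtains b :: "nat \<Rightarrow> 'a \<Rightarrow> real" where "\<And>n. b n \<in> A" "\<And>n x. \<bar>b n x\<bar> \<le> 1"
    "AE x in M. (\<lambda>n. b n x) \<longlonglongrightarrow> indicator B x"
proof -
  have i: "integrable M (indicator B :: 'a \<Rightarrow> real)" using B by simp
  have "\<forall>n. \<exists>a\<in>A. integrable M (\<lambda>x. indicator B x - a x) \<and> (\<integral>x. \<bar>indicator B x - a x\<bar> \<partial>M) < 1 / Suc n"
    using A_L1_dense[OF _ i] B by auto
  then obtain a where a: "\<And>n. a n \<in> A" "\<And>n::nat. integrable M (\<lambda>x. indicator B x - a n x)"
    "\<And>n. (\<integral>x. \<bar>indicator B x - a n x\<bar> \<partial>M) < 1 / Suc n" by metis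
  have "(\<lambda>n. \<integral>x. norm (indicator B x - a n x) \<partial>M) \<longlonglongrightarrow> 0"
  proof (rule tendsto_sandwich[OF _ _ tendsto_const LIMSEQ_inverse_real_of_nat])
    show "\<forall>\<^sub>F n in sequentially. (\<integral>x. norm (indicator B x - a n x) \<partial>M) \<le> inverse (real (Suc n))"
      using a(3) by (auto simp: inverse_eq_divide less_imp_le intro!: always_eventually)
  qed auto
  from tendsto_L1_AE_subseq[OF a(2) this] obtain r where
    r: "AE x in M. (\<lambda>n. indicator B x - a (r n) x) \<longlonglongrightarrow> 0" by auto
  define b where "b n x = sin (pi / 2 * a (r n) x)" for n x
  have "AE x in M. (\<lambda>n. b n x) \<longlonglongrightarrow> indicator B x"
    using r
  proof eventually_elim
    case (elim x)
    have "(\<lambda>n. indicator B x - (indicator B x - a (r n) x)) \<longlonglongrightarrow> (indicator B x :: real) - 0"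
      by (intro tendsto_intros elim)
    then have "(\<lambda>n. a (r n) x) \<longlonglongrightarrow> (indicator B x :: real)" by simp
    then have "(\<lambda>n. sin (pi / 2 * a (r n) x)) \<longlonglongrightarrow> sin (pi / 2 * (indicator B x :: real))"
      by (intro tendsto_intros)
    then show ?case unfolding b_def by (cases "x \<in> B") auto
  qed
  moreover have "b n \<in> A" for n unfolding b_def[abs_def] by (rule A_sin[OF a(1)])
  ultimately show ?thesis by (intro that[of b]) (auto simp: b_def)
qed

lemma AE_mC_fst: "AE r in muK K N. P r \<Longrightarrow> AE z in mC. P (fst z)"
proof -
  assume "AE r in muK K N. P r"
  then obtain X where X: "X \<in> null_sets (muK K N)" "{r \<in> space (muK K N). \<not> P r} \<subseteq> X" unfolding eventually_ae_filter by blast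
  have "X \<times> space M \<in> null_sets mC" unfolding mC_eq using X by (intro M2.times_in_null_sets1) auto
  then show ?thesis by (rule AE_I') (use X in \<open>auto simp: mC_eq space_pair_measure\<close>)
qed

lemma AE_mC_snd: "AE x in M. P x \<Longrightarrow> AE z in mC. P (snd z)"
proof -
  assume "AE x in M. P x"
  then obtain X where X: "X \<in> null_sets M" "{x \<in> space M. \<not> P x} \<subseteq> X" unfolding eventually_ae_filter by blast
  have "UNIV \<times> X \<in> null_sets mC" unfolding mC_eq using X by (intro M2.times_in_null_sets2) auto
  then show ?thesis by (rule AE_I') (use X in \<open>auto simp: mC_eq space_pair_measure\<close>)
qed

text \<open>Dominated convergence with the integrable \<open>k\<close> enlarges the tests: smooth
  radial factors to indicators of half-lines, algebra elements to indicators of sets of finite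
  measure and then of all measurable sets. This reaches an intersection-stable generator.\<close>

lemma tensor_tests_integrable_zero:
  fixes k :: "real \<times> 'a \<Rightarrow> real"
  assumes k: "integrable mC k"
    and z: "\<And>g a. smooth_real UNIV g \<Longrightarrow> a \<in> A \<Longrightarrow> integral\<^sup>L mC (\<lambda>z. k z * (g (fst z) * a (snd z))) = 0"
  shows "AE z in mC. k z = 0"
proof -
  have km[measurable]: "k \<in> borel_measurable (muK K N \<Otimes>\<^sub>M M)" using k by (simp add: mC_eq)
  have dct: "(\<lambda>n. integral\<^sup>L mC (\<lambda>z. k z * q n z)) \<longlonglongrightarrow> integral\<^sup>L mC (\<lambda>z. k z * q' z)"
    if "\<And>n. q n \<in> borel_measurable mC" "q' \<in> borel_measurable mC" "\<And>n z. z \<in> space mC \<Longrightarrow> \<bar>q n z\<bar> \<le> C"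
      "AE z in mC. (\<lambda>n. q n z) \<longlonglongrightarrow> q' z"
    for q :: "nat \<Rightarrow> real \<times> 'a \<Rightarrow> real" and q' C
  proof (rule integral_dominated_convergence[where w = "\<lambda>z. C * \<bar>k z\<bar>"])
    show "AE z in mC. (\<lambda>n. k z * q n z) \<longlonglongrightarrow> k z * q' z"
      using that(4) by eventually_elim (intro tendsto_intros)
    show "AE z in mC. norm (k z * q n z) \<le> C * \<bar>k z\<bar>" for n
    proof (rule AE_I2)
      fix z assume "z \<in> space mC"
      from mult_left_mono[OF that(3)[OF this, of n], of "\<bar>k z\<bar>"]
      show "norm (k z * q n z) \<le> C * \<bar>k z\<bar>" by (simp add: abs_mult mult.commute)
    qed
  qed (use k that in auto)
  have 1: "integral\<^sup>L mC (\<lambda>z. k z * (indicator {c<..} (fst z) * a (snd z))) = 0" if a: "a \<in> A" for a c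
  proof -
    have [measurable]: "a \<in> borel_measurable M" using A_measurable[OF a] .
    obtain C where C: "\<And>x. \<bar>a x\<bar> \<le> C" using A_bounded[OF a] by blast
    \<comment> \<open>e is 1 up to c and lies in [0, 1) beyond c, so the smooth functions 1 - e^n
      tend to the indicator of the half-line beyond c and stay between 0 and 1.\<close>
    define e where "e r = 1 - flat_exp 0 (r - c)" for r
    have e: "0 \<le> e r" "e r \<le> 1" "r > c \<Longrightarrow> e r < 1" "\<not> r > c \<Longrightarrow> e r = 1" for r
      by (auto simp: e_def flat_exp_def)
    have se: "smooth_real UNIV (\<lambda>r. 1 + (-1) * e r ^ n)" for n
    proof -
      have "ndiff UNIV m (\<lambda>r. flat_exp 0 (1 * r + (- c)))" for m
        by (intro ndiff_affine) (use smooth_flat_exp in \<open>simp add: smooth_real_def\<close>)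
      then have "smooth_real UNIV (\<lambda>r. 1 + (-1) * flat_exp 0 (r - c))"
        by (intro smooth_real_add smooth_real_mult smooth_real_const) (simp add: smooth_real_def)
      then have e': "smooth_real UNIV e" by (simp add: e_def[abs_def])
      have "smooth_real UNIV (\<lambda>r. e r ^ n)"
        by (induction n) (auto intro!: smooth_real_mult e' smooth_real_const)
      then show ?thesis by (intro smooth_real_add smooth_real_mult smooth_real_const)
    qed
    have em[measurable]: "e \<in> borel_measurable borel"
    proof -
      have "continuous_on UNIV (flat_exp 0)"
        using flat_exp_has_deriv by (meson DERIV_isCont continuous_at_imp_continuous_on)
      then have [measurable]: "flat_exp 0 \<in> borel_measurable borel" by (rule borel_measurable_continuous_onI)
      show ?thesis unfolding e_def[abs_def] by measurable
    qed
    have "(\<lambda>n. integral\<^sup>L mC (\<lambda>z. k z * ((1 + (-1) * e (fst z) ^ n) * a (snd z))))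
      \<longlonglongrightarrow> integral\<^sup>L mC (\<lambda>z. k z * (indicator {c<..} (fst z) * a (snd z)))"
    proof (rule dct[where C = C])
      fix n and y :: "real \<times> 'a"
      have "\<bar>1 + (-1) * e (fst y) ^ n\<bar> \<le> 1" using e(1,2)[of "fst y"] power_le_one[of "e (fst y)" n] by auto
      then show "\<bar>(1 + (-1) * e (fst y) ^ n) * a (snd y)\<bar> \<le> C"
        using mult_mono[of "\<bar>1 + (-1) * e (fst y) ^ n\<bar>" 1 "\<bar>a (snd y)\<bar>" C] C[of "snd y"] by (simp add: abs_mult)
    next
      show "AE y in mC. (\<lambda>n. (1 + (-1) * e (fst y) ^ n) * a (snd y)) \<longlonglongrightarrow> indicator {c<..} (fst y) * a (snd y)"
      proof (rule AE_I2)
        fix y :: "real \<times> 'a"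
        have "(\<lambda>n. 1 + (-1) * e (fst y) ^ n) \<longlonglongrightarrow> indicator {c<..} (fst y)"
        proof (cases "fst y > c")
          case True
          have "(\<lambda>n. 1 + (-1) * e (fst y) ^ n) \<longlonglongrightarrow> 1 + (-1) * 0"
            by (intro tendsto_intros LIMSEQ_realpow_zero e(1) e(3)[OF True])
          with True show ?thesis by simp
        qed (simp add: e(4))
        then show "(\<lambda>n. (1 + (-1) * e (fst y) ^ n) * a (snd y)) \<longlonglongrightarrow> indicator {c<..} (fst y) * a (snd y)"
          by (intro tendsto_intros)
      qed
    qed (simp_all add: mC_eq)
    moreover have "integral\<^sup>L mC (\<lambda>z. k z * ((1 + (-1) * e (fst z) ^ n) * a (snd z))) = 0" for n
      by (rule z[OF se a])
    ultimately show ?thesis by (simp add: LIMSEQ_const_iff)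
  qed
  have 2: "integral\<^sup>L mC (\<lambda>z. k z * (indicator {c<..} (fst z) * indicator B (snd z))) = 0"
    if B: "B \<in> sets M" "emeasure M B < \<infinity>" for B c
  proof -
    obtain b where b: "\<And>n. b n \<in> A" "\<And>n x. \<bar>b n x\<bar> \<le> 1"
      "AE x in M. (\<lambda>n. b n x) \<longlonglongrightarrow> indicator B x" using A_approx_indicator[OF B] by blast
    have [measurable]: "b n \<in> borel_measurable M" "B \<in> sets M" for n using A_measurable[OF b(1)] B by auto
    have "(\<lambda>n. integral\<^sup>L mC (\<lambda>z. k z * (indicator {c<..} (fst z) * b n (snd z))))
      \<longlonglongrightarrow> integral\<^sup>L mC (\<lambda>z. k z * (indicator {c<..} (fst z) * indicator B (snd z)))"
    proof (rule dct[where C = 1])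
      show "AE z in mC. (\<lambda>n. indicator {c<..} (fst z) * b n (snd z)) \<longlonglongrightarrow> indicator {c<..} (fst z) * indicator B (snd z)"
        using AE_mC_snd[OF b(3)] by eventually_elim (intro tendsto_intros)
    qed (use b(2) in \<open>auto simp: mC_eq indicator_def\<close>)
    then show ?thesis using 1[OF b(1)] by (simp add: LIMSEQ_const_iff)
  qed
  have 3: "integral\<^sup>L mC (\<lambda>z. k z * (indicator {c<..} (fst z) * indicator B (snd z))) = 0"
    if B: "B \<in> sets M" for B c
  proof -
    obtain F :: "nat \<Rightarrow> 'a set" where F: "range F \<subseteq> sets M" "(\<Union>i. F i) = space M" "\<And>i. emeasure M (F i) \<noteq> \<infinity>" "incseq F"
      using M2.sigma_finite_incseq by blast
    have [measurable]: "B \<in> sets M" "F n \<in> sets M" for n using F B by auto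
    have "(\<lambda>n. integral\<^sup>L mC (\<lambda>z. k z * (indicator {c<..} (fst z) * indicator (B \<inter> F n) (snd z))))
      \<longlonglongrightarrow> integral\<^sup>L mC (\<lambda>z. k z * (indicator {c<..} (fst z) * indicator B (snd z)))"
    proof (rule dct[where C = 1])
      show "AE z in mC. (\<lambda>n. indicator {c<..} (fst z) * indicator (B \<inter> F n) (snd z)) \<longlonglongrightarrow>
          indicator {c<..} (fst z) * (indicator B (snd z) :: real)"
      proof (rule AE_I2)
        fix z assume "z \<in> space mC"
        have "incseq (\<lambda>n. B \<inter> F n)" using F(4) by (auto simp: incseq_def)
        from LIMSEQ_indicator_incseq[OF this, of "snd z"]
        have "(\<lambda>n. indicator (B \<inter> F n) (snd z)) \<longlonglongrightarrow> (indicator (\<Union>n. B \<inter> F n) (snd z) :: real)" .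
        moreover have "(\<Union>n. B \<inter> F n) = B" using F(2) sets.sets_into_space[OF B] by auto
        ultimately show "(\<lambda>n. indicator {c<..} (fst z) * indicator (B \<inter> F n) (snd z)) \<longlonglongrightarrow>
          indicator {c<..} (fst z) * (indicator B (snd z) :: real)" by (simp add: tendsto_mult_left)
      qed
    qed (auto simp: mC_eq indicator_def)
    moreover have "emeasure M (B \<inter> F n) < \<infinity>" for n
      using emeasure_mono[of "B \<inter> F n" "F n" M] F by (auto simp: less_top order_le_less_trans)
    ultimately show ?thesis using 2[of "B \<inter> F n" c for n] by (simp add: LIMSEQ_const_iff)
  qed
  have 4: "integral\<^sup>L mC k = 0"
  proof -
    have "(\<lambda>n. integral\<^sup>L mC (\<lambda>z. k z * (indicator {- real n<..} (fst z) * indicator (space M) (snd z))))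
      \<longlonglongrightarrow> integral\<^sup>L mC (\<lambda>z. k z * 1)"
    proof (rule dct[where C = 1])
      show "AE z in mC. (\<lambda>n. indicator {- real n<..} (fst z) * indicator (space M) (snd z)) \<longlonglongrightarrow> (1::real)"
      proof (rule AE_I2)
        fix z assume z: "z \<in> space mC"
        obtain n0 :: nat where "- fst z < real n0" using reals_Archimedean2 by blast
        then have "\<forall>\<^sub>F n in sequentially. indicator {- real n<..} (fst z) * indicator (space M) (snd z) = (1::real)"
          using z by (auto simp: eventually_sequentially mC_eq space_pair_measure intro!: exI[of _ n0])
        then show "(\<lambda>n. indicator {- real n<..} (fst z) * indicator (space M) (snd z)) \<longlonglongrightarrow> (1::real)"
          by (rule tendsto_eventually)
      qed
    qed (auto simp: mC_eq indicator_def)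
    then show ?thesis using 3[OF sets.top] by (simp add: LIMSEQ_const_iff)
  qed
  \<comment> \<open>No half-line is all of the line, hence the separate treatment of the total
    integral just before.\<close>
  let ?G = "{a \<times> b |a b. a \<in> range (greaterThan :: real \<Rightarrow> _) \<and> b \<in> sets M}"
  have sets: "sets mC = sigma_sets (space mC) ?G"
  proof -
    have "sets (muK K N \<Otimes>\<^sub>M M) = sets (sigma (space (muK K N) \<times> space M) ?G)"
    proof (rule sets_pair_eq)
      show "sets (muK K N) = sigma_sets (space (muK K N)) (range greaterThan)"
        by (simp add: borel_Ioi)
      show "sets M = sigma_sets (space M) (sets M)" by (simp add: sets.sigma_sets_eq)
      show "countable (range (\<lambda>n::nat. {- real n<..}))" "countable {space M}" by auto
      show "(\<Union>(range (\<lambda>n::nat. {- real n<..}))) = space (muK K N)"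
        by (auto, metis minus_less_iff reals_Archimedean2)
    qed (auto simp: sets.space_closed)
    then show ?thesis unfolding mC_eq
      by (subst (asm) sets_measure_of) (auto simp: space_pair_measure dest: sets.sets_into_space)
  qed
  have st: "Int_stable ?G"
  proof (rule Int_stableI)
    fix X Y assume "X \<in> ?G" "Y \<in> ?G"
    then obtain c d B C where "X = {c<..} \<times> B" "B \<in> sets M" "Y = {d<..} \<times> C" "C \<in> sets M" by auto
    then have "X \<inter> Y = {max c d<..} \<times> (B \<inter> C)" "B \<inter> C \<in> sets M" by auto
    then show "X \<inter> Y \<in> ?G" by blast
  qed
  have sub: "?G \<subseteq> Pow (space mC)" by (auto simp: mC_eq space_pair_measure dest: sets.sets_into_space)
  have G0: "(LINT z:X|mC. k z) = 0" if "X \<in> ?G" for X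
  proof -
    from that obtain c B where X: "X = {c<..} \<times> B" "B \<in> sets M" by auto
    have "(\<lambda>z. indicator X z *\<^sub>R k z) = (\<lambda>z. k z * (indicator {c<..} (fst z) * indicator B (snd z)))"
      by (auto simp: X fun_eq_iff indicator_def)
    then show ?thesis using 3[OF X(2), of c] by (simp add: set_lebesgue_integral_def)
  qed
  show ?thesis
    by (rule AE_zero_if_set_integrals_zero[OF k set_integral_zero_dynkin[OF k st sub sets G0 4]])
qed

text \<open>Here \<open>h\<close> is only integrable after multiplication by a tensor, so the
  previous lemma is applied to \<open>h\<close> times \<phi> \<otimes> a; products of tests are
  again tests because \<open>A\<close> is an algebra. It remains to find countably many tensors
  without common zeros.\<close>

lemma tensor_tests_zero:
  assumes h[measurable]: "h \<in> borel_measurable mC"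
    and i: "\<And>\<phi> a. \<phi> \<in> CS K \<Longrightarrow> a \<in> A \<Longrightarrow> integrable mC (\<lambda>z. h z * (\<phi> (fst z) * a (snd z)))"
    and z: "\<And>\<phi> a. \<phi> \<in> CS K \<Longrightarrow> a \<in> A \<Longrightarrow> integral\<^sup>L mC (\<lambda>z. h z * (\<phi> (fst z) * a (snd z))) = 0"
  shows "AE z in mC. h z = 0"
proof -
  have *: "AE z in mC. h z * (\<phi> (fst z) * a (snd z)) = 0" if p: "\<phi> \<in> CS K" "a \<in> A" for \<phi> a
  proof (rule tensor_tests_integrable_zero[OF i[OF p]])
    fix g b assume g: "smooth_real UNIV g" "b \<in> A"
    have "(\<lambda>r. g r * \<phi> r) \<in> CS K"
      by (rule Cc_smooth_on_mult_smooth[OF open_IK_int smooth_real_mono[OF g(1)] p(1)]) simp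
    from z[OF this A_mult[OF p(2) g(2)]]
    show "integral\<^sup>L mC (\<lambda>z. h z * (\<phi> (fst z) * a (snd z)) * (g (fst z) * b (snd z))) = 0"
      by (simp add: mult_ac)
  qed
  obtain F :: "nat \<Rightarrow> 'a set" where F: "range F \<subseteq> sets M" "(\<Union>i. F i) = space M" "\<And>i. emeasure M (F i) \<noteq> \<infinity>"
    using M2.sigma_finite by metis
  have "\<forall>i. \<exists>b. (\<forall>n. b n \<in> A) \<and> (AE x in M. (\<lambda>n. b n x) \<longlonglongrightarrow> indicator (F i) x)"
  proof
    fix i
    have "F i \<in> sets M" "emeasure M (F i) < \<infinity>" using F by (auto simp: less_top)
    from A_approx_indicator[OF this]
    show "\<exists>b. (\<forall>n. b n \<in> A) \<and> (AE x in M. (\<lambda>n. b n x) \<longlonglongrightarrow> indicator (F i) x)" by metis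
  qed
  then obtain b where b: "\<And>i n. b i n \<in> A" "\<And>i::nat. AE x in M. (\<lambda>n::nat. b i n x) \<longlonglongrightarrow> indicator (F i) x"
    by metis
  have 1: "AE z in mC. \<forall>i. (\<lambda>n. b i n (snd z)) \<longlonglongrightarrow> indicator (F i) (snd z)"
    unfolding AE_all_countable using AE_mC_snd[OF b(2)] by blast
  \<comment> \<open>Rational endpoints keep the family of tests countable, so that the exceptional
    null sets can be united.\<close>
  let ?R = "{pq :: rat \<times> rat. {real_of_rat (fst pq) .. real_of_rat (snd pq)} \<subseteq> IK_int K}"
  have 2: "AE z in mC. \<forall>pq\<in>?R. \<forall>i n. h z * (bump (real_of_rat (fst pq)) (real_of_rat (snd pq)) (fst z) * b i n (snd z)) = 0"
    by (subst AE_ball_countable, simp, intro ballI, unfold AE_all_countable, intro allI *)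
       (auto intro!: bump_Cc_smooth b)
  have 3: "AE z in mC. fst z \<in> IK_int K"
    by (rule AE_mC_fst, subst AE_muK_iff) auto
  have 4: "AE z in mC. z \<in> space mC" by (rule AE_space)
  from 1 2 3 4 show ?thesis
  proof eventually_elim
    case (elim z)
    from elim(4) have "snd z \<in> space M" by (auto simp: mC_eq space_pair_measure)
    then obtain i where "snd z \<in> F i" using F by blast
    then have "(\<lambda>n. b i n (snd z)) \<longlonglongrightarrow> 1" using elim(1)[rule_format, of i] by simp
    from order_tendstoD(1)[OF this, of 0] obtain n where n: "b i n (snd z) > 0"
      by (auto simp: eventually_sequentially)
    obtain e where e: "e > 0" "ball (fst z) e \<subseteq> IK_int K"
      using elim(3) open_IK_int open_contains_ball by blast
    obtain p where p: "fst z - e < real_of_rat p" "real_of_rat p < fst z" using of_rat_dense[of "fst z - e" "fst z"] e by auto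
    obtain q where q: "fst z < real_of_rat q" "real_of_rat q < fst z + e" using of_rat_dense[of "fst z" "fst z + e"] e by auto
    have "{real_of_rat p..real_of_rat q} \<subseteq> ball (fst z) e" using p q by (auto simp: dist_real_def)
    then have "(p, q) \<in> ?R" using e by auto
    from elim(2)[rule_format, OF this, of i n]
    have "h z * (bump (real_of_rat p) (real_of_rat q) (fst z) * b i n (snd z)) = 0" by simp
    moreover have "bump (real_of_rat p) (real_of_rat q) (fst z) > 0" using p q by (simp add: bump_bounds(3))
    ultimately show "h z = 0" using n by simp
  qed
qed

end

section \<open>The cone generator and carre du champ on tensors\<close>

text \<open>The generator on the fibre is linear only up to null sets, so the cone operators are defined on
  lists of factors rather than on functions; all algebraic identities then hold pointwise.\<close>

definition tens :: "((real \<Rightarrow> real) \<times> ('a \<Rightarrow> real)) list \<Rightarrow> real \<times> 'a \<Rightarrow> real" where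
  "tens l z = (\<Sum>(\<phi>, f)\<leftarrow>l. \<phi> (fst z) * f (snd z))"

lemma tens_simps[simp]:
  "tens [] z = 0" "tens ((\<phi>, f) # l) z = \<phi> (fst z) * f (snd z) + tens l z" "tens (l @ m) z = tens l z + tens m z"
  by (simp_all add: tens_def)

lemma tens_tensor_dom: "set l \<subseteq> CS K \<times> B \<Longrightarrow> tens l \<in> tensor_dom K B"
proof (induction l)
  case Nil
  then show ?case using tensor_dom_zero by (simp add: tens_def)
next
  case (Cons p l)
  obtain \<phi> f where p: "p = (\<phi>, f)" by force
  have "tens (p # l) = (\<lambda>z. \<phi> (fst z) * f (snd z) + tens l z)" by (simp add: fun_eq_iff p)
  with Cons p show ?case using tensor_dom_Cons[of \<phi> K f B] by simp
qed

fun tens_mult_pure :: "(real \<Rightarrow> real) \<Rightarrow> ('a \<Rightarrow> real) \<Rightarrow> ((real \<Rightarrow> real) \<times> ('a \<Rightarrow> real)) list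
    \<Rightarrow> ((real \<Rightarrow> real) \<times> ('a \<Rightarrow> real)) list" where
  "tens_mult_pure \<phi> f [] = []"
| "tens_mult_pure \<phi> f ((\<psi>, g) # m) = (\<lambda>r. \<phi> r * \<psi> r, \<lambda>x. f x * g x) # tens_mult_pure \<phi> f m"

fun tens_mult_list :: "((real \<Rightarrow> real) \<times> ('a \<Rightarrow> real)) list \<Rightarrow> ((real \<Rightarrow> real) \<times> ('a \<Rightarrow> real)) list
    \<Rightarrow> ((real \<Rightarrow> real) \<times> ('a \<Rightarrow> real)) list" where
  "tens_mult_list [] m = []"
| "tens_mult_list ((\<phi>, f) # l) m = tens_mult_pure \<phi> f m @ tens_mult_list l m"

lemma tens_mult_pure_eq: "tens (tens_mult_pure \<phi> f m) z = \<phi> (fst z) * f (snd z) * tens m z"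
  by (induction m) (auto simp: algebra_simps)

lemma tens_mult_list_eq: "tens (tens_mult_list l m) z = tens l z * tens m z"
  by (induction l) (auto simp: algebra_simps tens_mult_pure_eq)

lemma deriv_CS_mult:
  assumes "\<phi> \<in> CS K" "\<psi> \<in> CS K"
  shows "deriv (\<lambda>r. \<phi> r * \<psi> r) = (\<lambda>r. deriv \<phi> r * \<psi> r + \<phi> r * deriv \<psi> r)"
  using DERIV_imp_deriv[OF DERIV_mult[OF Cc_smooth_on_has_deriv[OF assms(1)] Cc_smooth_on_has_deriv[OF assms(2)]]]
  by (auto simp: fun_eq_iff algebra_simps)

lemma deriv_CS_add:
  assumes "\<phi> \<in> CS K" "\<psi> \<in> CS K"
  shows "deriv (\<lambda>r. \<phi> r + \<psi> r) = (\<lambda>r. deriv \<phi> r + deriv \<psi> r)"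
  using DERIV_imp_deriv[OF DERIV_add[OF Cc_smooth_on_has_deriv[OF assms(1)] Cc_smooth_on_has_deriv[OF assms(2)]]]
  by auto

lemma deriv2_CS_mult:
  assumes "\<phi> \<in> CS K" "\<psi> \<in> CS K"
  shows "deriv (deriv (\<lambda>r. \<phi> r * \<psi> r)) =
    (\<lambda>r. deriv (deriv \<phi>) r * \<psi> r + 2 * (deriv \<phi> r * deriv \<psi> r) + \<phi> r * deriv (deriv \<psi>) r)"
proof -
  note d = Cc_smooth_on_deriv[OF assms(1)] Cc_smooth_on_deriv[OF assms(2)]
  show ?thesis unfolding deriv_CS_mult[OF assms]
    using deriv_CS_add[OF CS_closed(2)[OF d(1) assms(2)] CS_closed(2)[OF assms(1) d(2)]]
      deriv_CS_mult[OF d(1) assms(2)] deriv_CS_mult[OF assms(1) d(2)] by auto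
qed

section \<open>Explicit operators on lists of factors and their identification\<close>

context cone_algebra
begin

text \<open>A representative chosen inside the algebra: the value of \<open>gen\<close> is an
  arbitrary representative and may leave \<open>A\<close> on a null set, whereas this one can be
  multiplied and iterated pointwise.\<close>

definition genA :: "('a \<Rightarrow> real) \<Rightarrow> 'a \<Rightarrow> real" where
  "genA f = (SOME w. w \<in> A \<and> is_gen M D E f w)"

definition cdcA :: "('a \<Rightarrow> real) \<Rightarrow> ('a \<Rightarrow> real) \<Rightarrow> 'a \<Rightarrow> real" where
  "cdcA f g = (\<lambda>x. (genA (\<lambda>y. f y * g y) x - f x * genA g x - g x * genA f x) / 2)"

lemma genA:
  assumes "f \<in> A"
  shows "genA f \<in> A" "is_gen M D E f (genA f)"
proof -
  have "\<forall>u\<in>A. \<exists>w\<in>A. is_gen M D E u w"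
    using alg unfolding admissible_algebra_def by (elim conjE)
  with assms have "\<exists>w. w \<in> A \<and> is_gen M D E f w" by blast
  from someI_ex[OF this] show "genA f \<in> A" "is_gen M D E f (genA f)" by (auto simp: genA_def)
qed

lemma genA_form: "f \<in> A \<Longrightarrow> g \<in> D \<Longrightarrow> E f g = - (\<integral>x. genA f x * g x \<partial>M)"
  using genA(2) by (auto simp: is_gen_def)

lemma cdcA_A:
  assumes "f \<in> A" "g \<in> A"
  shows "cdcA f g \<in> A"
proof -
  have "(\<lambda>x. (1/2) * (genA (\<lambda>y. f y * g y) x + ((-1) * (f x * genA g x) + (-1) * (g x * genA f x)))) \<in> A"
    by (intro A_cmult A_add A_mult genA assms)
  also have "(\<lambda>x. (1/2) * (genA (\<lambda>y. f y * g y) x + ((-1) * (f x * genA g x) + (-1) * (g x * genA f x)))) = cdcA f g"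
    by (simp add: cdcA_def fun_eq_iff)
  finally show ?thesis .
qed

lemma cdcA_sym: "cdcA g f = cdcA f g"
proof -
  have "(\<lambda>y. g y * f y) = (\<lambda>y. f y * g y)" by (simp add: mult.commute)
  from arg_cong[OF this, of genA] show ?thesis unfolding cdcA_def by (auto simp: fun_eq_iff)
qed

text \<open>Two entries per factor, as the radial part keeps the fibre function and the fibre part
  replaces it by its generator. The result is again a list over the algebra and can be
  iterated.\<close>

fun cone_gen :: "((real \<Rightarrow> real) \<times> ('a \<Rightarrow> real)) list \<Rightarrow> ((real \<Rightarrow> real) \<times> ('a \<Rightarrow> real)) list" where
  "cone_gen [] = []"
| "cone_gen ((\<phi>, f) # l) = (\<lambda>r. deriv (deriv \<phi>) r + bK K N r * deriv \<phi> r, f) # (\<lambda>r. wK K r * \<phi> r, genA f) # cone_gen l"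

fun cone_cdc1 :: "(real \<Rightarrow> real) \<Rightarrow> ('a \<Rightarrow> real) \<Rightarrow> ((real \<Rightarrow> real) \<times> ('a \<Rightarrow> real)) list
    \<Rightarrow> ((real \<Rightarrow> real) \<times> ('a \<Rightarrow> real)) list" where
  "cone_cdc1 \<phi> f [] = []"
| "cone_cdc1 \<phi> f ((\<psi>, g) # m) = (\<lambda>r. deriv \<phi> r * deriv \<psi> r, \<lambda>x. f x * g x) #
     (\<lambda>r. wK K r * (\<phi> r * \<psi> r), cdcA f g) # cone_cdc1 \<phi> f m"

fun cone_cdc :: "((real \<Rightarrow> real) \<times> ('a \<Rightarrow> real)) list \<Rightarrow> ((real \<Rightarrow> real) \<times> ('a \<Rightarrow> real)) list
    \<Rightarrow> ((real \<Rightarrow> real) \<times> ('a \<Rightarrow> real)) list" where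
  "cone_cdc [] m = []"
| "cone_cdc ((\<phi>, f) # l) m = cone_cdc1 \<phi> f m @ cone_cdc l m"

abbreviation "repA \<equiv> {l. set l \<subseteq> CS K \<times> A}"

lemma repA_cone_gen: "l \<in> repA \<Longrightarrow> cone_gen l \<in> repA"
proof (induction l)
  case (Cons p l)
  obtain \<phi> f where p: "p = (\<phi>, f)" by force
  with Cons have c: "\<phi> \<in> CS K" "f \<in> A" "cone_gen l \<in> repA" by auto
  have "(\<lambda>r. deriv (deriv \<phi>) r + bK K N r * deriv \<phi> r) \<in> CS K" "(\<lambda>r. wK K r * \<phi> r) \<in> CS K"
    by (intro CS_closed c)+
  with c genA(1) show ?case by (simp add: p)
qed auto

lemma repA_tens_mult_pure: "\<phi> \<in> CS K \<Longrightarrow> f \<in> A \<Longrightarrow> m \<in> repA \<Longrightarrow> tens_mult_pure \<phi> f m \<in> repA"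
proof (induction m)
  case (Cons q m)
  obtain \<psi> g where q: "q = (\<psi>, g)" by force
  with Cons have c: "\<psi> \<in> CS K" "g \<in> A" "tens_mult_pure \<phi> f m \<in> repA" by auto
  have "(\<lambda>r. \<phi> r * \<psi> r) \<in> CS K" by (intro CS_closed c Cons)
  with c A_mult[OF Cons.prems(2) c(2)] show ?case by (simp add: q)
qed auto

lemma repA_tens_mult_list: "l \<in> repA \<Longrightarrow> m \<in> repA \<Longrightarrow> tens_mult_list l m \<in> repA"
proof (induction l)
  case (Cons p l)
  then show ?case using repA_tens_mult_pure[of "fst p" "snd p" m] by (cases p) auto
qed auto

lemma repA_cone_cdc1: "\<phi> \<in> CS K \<Longrightarrow> f \<in> A \<Longrightarrow> m \<in> repA \<Longrightarrow> cone_cdc1 \<phi> f m \<in> repA"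
proof (induction m)
  case (Cons q m)
  obtain \<psi> g where q: "q = (\<psi>, g)" by force
  with Cons have c: "\<psi> \<in> CS K" "g \<in> A" "cone_cdc1 \<phi> f m \<in> repA" by auto
  have "(\<lambda>r. deriv \<phi> r * deriv \<psi> r) \<in> CS K" "(\<lambda>r. wK K r * (\<phi> r * \<psi> r)) \<in> CS K"
    by (intro CS_closed c Cons)+
  with c A_mult[OF Cons.prems(2) c(2)] cdcA_A[OF Cons.prems(2) c(2)] show ?case by (simp add: q)
qed auto

lemma repA_cone_cdc: "l \<in> repA \<Longrightarrow> m \<in> repA \<Longrightarrow> cone_cdc l m \<in> repA"
proof (induction l)
  case (Cons p l)
  then show ?case using repA_cone_cdc1[of "fst p" "snd p" m] by (cases p) auto
qed auto

lemma cone_gen_append: "cone_gen (l @ m) = cone_gen l @ cone_gen m"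
  by (induction l) auto

text \<open>The product rule defining the carre du champ, at every point: the drift is a derivation
  and cancels, the second radial derivative leaves twice the product of first derivatives, and the
  fibre part is the definition of \<open>cdcA\<close>.\<close>

lemma tens_cone_cdc1:
  assumes p: "\<phi> \<in> CS K" and m: "m \<in> repA"
  shows "tens (cone_gen (tens_mult_pure \<phi> f m)) z = \<phi> (fst z) * f (snd z) * tens (cone_gen m) z
    + tens m z * tens (cone_gen [(\<phi>, f)]) z + 2 * tens (cone_cdc1 \<phi> f m) z"
  using m
proof (induction m)
  case (Cons q m)
  obtain \<psi> g where q: "q = (\<psi>, g)" by force
  with Cons have psi: "\<psi> \<in> CS K" by auto
  have "tens (cone_gen (tens_mult_pure \<phi> f m)) z = \<phi> (fst z) * f (snd z) * tens (cone_gen m) z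
    + tens m z * tens (cone_gen [(\<phi>, f)]) z + 2 * tens (cone_cdc1 \<phi> f m) z" using Cons by simp
  then show ?case
    apply (simp only: q tens_mult_pure.simps cone_cdc1.simps cone_gen.simps tens_simps deriv2_CS_mult[OF p psi] fst_conv)
    apply (simp add: deriv_CS_mult[OF p psi] cdcA_def)
    apply (simp add: field_simps)
    done
qed auto

lemma tens_cone_cdc:
  assumes "l \<in> repA" "m \<in> repA"
  shows "tens (cone_gen (tens_mult_list l m)) z = tens l z * tens (cone_gen m) z + tens m z * tens (cone_gen l) z + 2 * tens (cone_cdc l m) z"
  using assms(1)
proof (induction l)
  case (Cons p l)
  obtain \<phi> f where p: "p = (\<phi>, f)" by force
  with Cons have "\<phi> \<in> CS K" by auto
  from tens_cone_cdc1[OF this assms(2), of f z] Cons show ?case by (simp add: p cone_gen_append algebra_simps)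
qed auto

abbreviation "TA \<equiv> tensor_dom K A"

lemma TA_T: "u \<in> TA \<Longrightarrow> u \<in> T"
  using tensor_dom_mono[of A D K] A_D by (meson subsetD subsetI)

lemma tens_repA:
  assumes "l \<in> repA"
  shows "tens l \<in> TA" "tens l \<in> T" "tens l \<in> L2 mC" "tens l \<in> borel_measurable mC"
proof -
  show 1: "tens l \<in> TA" using assms tens_tensor_dom[of l K A] by simp
  show 2: "tens l \<in> T" by (rule TA_T[OF 1])
  show 3: "tens l \<in> L2 mC" by (rule T_L2[OF 2])
  show "tens l \<in> borel_measurable mC" by (rule L2_measurable[OF 3])
qed

text \<open>The radial part is integrated by parts. For the fibre part, v is averaged against the
  weighted radial factor, the fibre generator is applied to f, and adjointness undoes the
  averaging.\<close>

lemma B0_pure: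
  assumes "\<phi> \<in> CS K" "f \<in> A" "v \<in> T"
  shows "B0 (\<lambda>z. \<phi> (fst z) * f (snd z)) v = - integral\<^sup>L mC (\<lambda>z. tens (cone_gen [(\<phi>, f)]) z * v z)"
proof -
  have f: "f \<in> D" "f \<in> L2 M" "genA f \<in> L2 M" using assms A_D A_L2 genA by auto
  let ?u = "\<lambda>z. \<phi> (fst z) * f (snd z)" and ?p = "\<lambda>r. deriv (deriv \<phi>) r + bK K N r * deriv \<phi> r"
    and ?w = "\<lambda>r. wK K r * \<phi> r"
  have p: "?p \<in> CS K" "?w \<in> CS K" "deriv \<phi> \<in> CS K" by (intro CS_closed assms)+
  have u: "?u \<in> T" by (intro tensor_dom_pure assms f)
  have d: "dr ?u = (\<lambda>z. deriv \<phi> (fst z) * f (snd z))"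
    using dr_Cons[OF assms(1) tensor_dom_zero, of f] by (simp add: dr_zero)
  have du: "dr ?u \<in> T" by (intro dr_tensor_dom u)
  have "rad (dr ?u) = (\<lambda>z. ?p (fst z) * f (snd z))"
    using rad_Cons[OF p(3) tensor_dom_zero, of f] by (simp add: d rad_def dr_zero)
  then have 1: "integral\<^sup>L mC (\<lambda>z. dr ?u z * dr v z) = - integral\<^sup>L mC (\<lambda>z. (?p (fst z) * f (snd z)) * v z)"
    using radial_by_parts[OF assms(3) du] by (simp add: mult.commute)
  have "(\<integral>r. wK K r * E (\<lambda>x. \<phi> r * f x) (\<lambda>x. v (r, x)) \<partial>muK K N) = (\<integral>r. ?w r * E (\<lambda>x. v (r, x)) f \<partial>muK K N)"
    using E_cmult[OF f(1) T_slice[OF assms(3)]] E_sym[OF f(1) T_slice[OF assms(3)]] by (simp add: mult.assoc)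
  also have "\<dots> = E f (radial_avg ?w v)"
    using radial_avg_form[OF p(2) assms(3) f(1)] E_sym[OF f(1) radial_avg_D[OF p(2) assms(3)]] by simp
  also have "\<dots> = - (\<integral>x. radial_avg ?w v x * genA f x \<partial>M)"
    using genA_form[OF assms(2) radial_avg_D[OF p(2) assms(3)]] by (simp add: mult.commute)
  also have "\<dots> = - integral\<^sup>L mC (\<lambda>z. (?w (fst z) * genA f (snd z)) * v z)"
    using radial_avg_L2[OF p(2) assms(3) f(3)] by (simp add: mult.commute)
  finally have 2: "(\<integral>r. wK K r * E (\<lambda>x. \<phi> r * f x) (\<lambda>x. v (r, x)) \<partial>muK K N) =
    - integral\<^sup>L mC (\<lambda>z. (?w (fst z) * genA f (snd z)) * v z)" .
  from 1 2 L2_integral_add(1)[OF pure_L2[OF p(1) f(2)] pure_L2[OF p(2) f(3)] T_L2[OF assms(3)]]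
  show ?thesis by (simp add: B0_def)
qed

lemma B0_tens:
  assumes "l \<in> repA" "v \<in> T"
  shows "B0 (tens l) v = - integral\<^sup>L mC (\<lambda>z. tens (cone_gen l) z * v z)"
  using assms(1)
proof (induction l)
  case Nil
  have "B0 (\<lambda>z. 0) v = 0" using B0_cmult[OF tensor_dom_zero assms(2), of 0] by simp
  then show ?case by (simp add: tens_def)
next
  case (Cons p l)
  obtain \<phi> f where p: "p = (\<phi>, f)" by force
  with Cons have pf: "\<phi> \<in> CS K" "f \<in> A" "l \<in> repA" by auto
  have u: "(\<lambda>z. \<phi> (fst z) * f (snd z)) \<in> T" using tensor_dom_pure pf A_D by blast
  have "tens (p # l) = (\<lambda>z. \<phi> (fst z) * f (snd z) + tens l z)" by (simp add: p fun_eq_iff)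
  then have "B0 (tens (p # l)) v = B0 (\<lambda>z. \<phi> (fst z) * f (snd z)) v + B0 (tens l) v"
    using B0_add[OF u tens_repA(2)[OF pf(3)] assms(2)] by simp
  also have "\<dots> = - (integral\<^sup>L mC (\<lambda>z. tens (cone_gen [(\<phi>, f)]) z * v z) + integral\<^sup>L mC (\<lambda>z. tens (cone_gen l) z * v z))"
    using B0_pure[OF pf(1,2) assms(2)] Cons.IH[OF pf(3)] by simp
  also have "\<dots> = - integral\<^sup>L mC (\<lambda>z. (tens (cone_gen [(\<phi>, f)]) z + tens (cone_gen l) z) * v z)"
    using L2_integral_add(1)[OF tens_repA(3)[OF repA_cone_gen] tens_repA(3)[OF repA_cone_gen] T_L2[OF assms(2)], of "[(\<phi>, f)]" l] pf
    by simp
  also have "(\<lambda>z. (tens (cone_gen [(\<phi>, f)]) z + tens (cone_gen l) z) * v z) = (\<lambda>z. tens (cone_gen (p # l)) z * v z)"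
    by (simp add: p add.assoc)
  finally show ?case .
qed

text \<open>Square integrability is asked of \<open>G\<close> alone: a carre du champ is just
  integrable, but its products with bounded tensors are integrable too.\<close>

lemma L2_tests_eq:
  assumes h: "h \<in> borel_measurable mC" and G: "G \<in> L2 mC"
    and i: "\<And>v. v \<in> TA \<Longrightarrow> integrable mC (\<lambda>z. h z * v z)"
    and z: "\<And>v. v \<in> TA \<Longrightarrow> integral\<^sup>L mC (\<lambda>z. h z * v z) = integral\<^sup>L mC (\<lambda>z. G z * v z)"
  shows "AE z in mC. h z = G z"
proof -
  have "AE z in mC. h z - G z = 0"
  proof (rule tensor_tests_zero)
    fix \<phi> a assume "\<phi> \<in> CS K" "a \<in> A"
    then have v: "(\<lambda>z. \<phi> (fst z) * a (snd z)) \<in> TA" by (rule tensor_dom_pure)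
    note j = L2_mult_integrable[OF G T_L2[OF TA_T[OF v]]]
    show "integrable mC (\<lambda>z. (h z - G z) * (\<phi> (fst z) * a (snd z)))"
      using i[OF v] j by (simp add: left_diff_distrib)
    show "integral\<^sup>L mC (\<lambda>z. (h z - G z) * (\<phi> (fst z) * a (snd z))) = 0"
      using i[OF v] j z[OF v] by (simp add: left_diff_distrib)
  qed (use h L2_measurable[OF G] in simp)
  then show ?thesis by simp
qed

text \<open>Tensors serve as tests, where the form is \<open>B0\<close> and \<open>B0_tens\<close>
  produces the list operator. Almost everywhere equality of u with a tensor suffices, so that the
  lemma also covers the chosen carre du champ.\<close>

lemma gen_cone_AE:
  assumes u: "u \<in> gen_dom mC DC EC" and l: "l \<in> repA" and ae: "AE z in mC. u z = tens l z"
    and um: "u \<in> borel_measurable mC"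
  shows "gen mC DC EC u \<in> borel_measurable mC" "AE z in mC. gen mC DC EC u z = tens (cone_gen l) z"
proof -
  have g: "is_gen mC DC EC u (gen mC DC EC u)"
    using u someI_ex[of "is_gen mC DC EC u"] unfolding gen_dom_def gen_def by simp
  then have L2: "gen mC DC EC u \<in> L2 mC" by (simp add: is_gen_def)
  then show m: "gen mC DC EC u \<in> borel_measurable mC" by (rule L2_measurable)
  show "AE z in mC. gen mC DC EC u z = tens (cone_gen l) z"
  proof (rule L2_tests_eq[OF m tens_repA(3)[OF repA_cone_gen[OF l]]])
    fix v assume "v \<in> TA"
    then have v: "v \<in> T" by (rule TA_T)
    show "integrable mC (\<lambda>z. gen mC DC EC u z * v z)" by (intro L2_mult_integrable L2 T_L2 v)
    have vm: "v \<in> borel_measurable mC" by (intro L2_measurable T_L2 v)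
    have "EC u v = EC (tens l) v" by (rule EC_AE_cong[OF um tens_repA(4)[OF l] ae vm vm]) simp
    also have "\<dots> = - integral\<^sup>L mC (\<lambda>z. tens (cone_gen l) z * v z)"
      using EC_eq_B0[OF tens_repA(2)[OF l] v] B0_tens[OF l v] by simp
    finally show "integral\<^sup>L mC (\<lambda>z. gen mC DC EC u z * v z) = integral\<^sup>L mC (\<lambda>z. tens (cone_gen l) z * v z)"
      using g T_DC[OF v] by (simp add: is_gen_def)
  qed
qed

lemma TA_bounded: "v \<in> TA \<Longrightarrow> \<exists>C. \<forall>z. \<bar>v z\<bar> \<le> C"
proof (induction rule: tensor_dom_induct)
  case (Cons \<phi> f u)
  obtain a b c where "\<And>r. \<bar>\<phi> r\<bar> \<le> a" "\<And>x. \<bar>f x\<bar> \<le> b" "\<And>z. \<bar>u z\<bar> \<le> c"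
    using CS_bounded[OF Cons(1)] A_bounded[OF Cons(2)] Cons(4) by blast
  then have "\<bar>\<phi> (fst z) * f (snd z) + u z\<bar> \<le> a * b + c" for z
    using mult_mono[of "\<bar>\<phi> (fst z)\<bar>" a "\<bar>f (snd z)\<bar>" b] order_trans[OF abs_ge_zero, of "\<phi> (fst z)" a]
    by (intro order_trans[OF abs_triangle_ineq] add_mono) (auto simp: abs_mult)
  then show ?case by blast
qed (auto intro: exI[of _ 0])

lemma TA_tens:
  assumes "v \<in> TA"
  obtains l where "l \<in> repA" "v = tens l"
proof -
  have "\<exists>l\<in>repA. v = tens l" using assms
  proof (induction rule: tensor_dom_induct)
    case zero
    then show ?case by (intro bexI[of _ "[]"]) (auto simp: tens_def)
  next
    case (Cons \<phi> f u)
    then obtain l where "l \<in> repA" "u = tens l" by blast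
    with Cons show ?case by (intro bexI[of _ "(\<phi>, f) # l"]) (auto simp: fun_eq_iff)
  qed
  with that show ?thesis by blast
qed

text \<open>Tensors over the algebra are bounded elements of the cone domain and hence admissible in
  \<open>is_cdc\<close>. Each of the three form values becomes an integral against a list generator,
  and \<open>tens_cone_cdc\<close> collects them.\<close>

lemma cdc_cone_AE:
  assumes ex: "\<exists>g. is_cdc mC DC EC u v g" and l: "l \<in> repA" and m: "m \<in> repA"
    and u: "u \<in> borel_measurable mC" "AE z in mC. u z = tens l z"
    and v: "v \<in> borel_measurable mC" "AE z in mC. v z = tens m z"
  shows "cdc mC DC EC u v \<in> borel_measurable mC" "AE z in mC. cdc mC DC EC u v z = tens (cone_cdc l m) z"
proof -
  let ?g = "cdc mC DC EC u v"
  have g: "is_cdc mC DC EC u v ?g" using ex unfolding cdc_def by (rule someI_ex)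
  then have gi: "integrable mC ?g" by (simp add: is_cdc_def)
  then show gm: "?g \<in> borel_measurable mC" by simp
  show "AE z in mC. ?g z = tens (cone_cdc l m) z"
  proof (rule L2_tests_eq[OF gm tens_repA(3)[OF repA_cone_cdc[OF l m]]])
    fix \<phi> assume ph: "\<phi> \<in> TA"
    then have phT: "\<phi> \<in> T" by (rule TA_T)
    have pm: "\<phi> \<in> borel_measurable mC" by (intro L2_measurable T_L2 phT)
    obtain C where C: "\<And>z. \<bar>\<phi> z\<bar> \<le> C" using TA_bounded[OF ph] by blast
    \<comment> \<open>A list for the test function turns its products with u and v into lists as
      well.\<close>
    obtain k where k: "k \<in> repA" "\<phi> = tens k" using TA_tens[OF ph] by blast
    show "integrable mC (\<lambda>z. ?g z * \<phi> z)"
    proof (rule Bochner_Integration.integrable_bound[OF integrable_mult_right[OF integrable_abs[OF gi], of C]])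
      show "AE z in mC. norm (?g z * \<phi> z) \<le> norm (C * \<bar>?g z\<bar>)"
      proof (rule AE_I2)
        fix z
        have "\<bar>?g z\<bar> * \<bar>\<phi> z\<bar> \<le> C * \<bar>?g z\<bar>" using mult_left_mono[OF C[of z] abs_ge_zero[of "?g z"]] by (simp add: mult.commute)
        also have "\<dots> \<le> \<bar>C\<bar> * \<bar>?g z\<bar>" by (intro mult_right_mono) auto
        finally show "norm (?g z * \<phi> z) \<le> norm (C * \<bar>?g z\<bar>)" by (simp add: abs_mult)
      qed
    qed (use gm pm in simp)
    have p1: "tens (tens_mult_list m k) \<in> T" "tens (tens_mult_list l k) \<in> T" by (intro tens_repA repA_tens_mult_list l m k)+
    have lm: "tens_mult_list l m \<in> repA" by (intro repA_tens_mult_list l m)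
    have e1: "EC u (\<lambda>z. v z * \<phi> z) = - integral\<^sup>L mC (\<lambda>z. tens (cone_gen l) z * tens (tens_mult_list m k) z)"
    proof -
      have "AE z in mC. v z * \<phi> z = tens (tens_mult_list m k) z" using v(2) by eventually_elim (simp add: tens_mult_list_eq k)
      then have "EC u (\<lambda>z. v z * \<phi> z) = EC (tens l) (tens (tens_mult_list m k))"
        by (intro EC_AE_cong[OF u(1) tens_repA(4)[OF l] u(2)] borel_measurable_times v pm L2_measurable[OF T_L2[OF p1(1)]])
      then show ?thesis using EC_eq_B0[OF tens_repA(2)[OF l] p1(1)] B0_tens[OF l p1(1)] by simp
    qed
    have e2: "EC v (\<lambda>z. u z * \<phi> z) = - integral\<^sup>L mC (\<lambda>z. tens (cone_gen m) z * tens (tens_mult_list l k) z)"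
    proof -
      have "AE z in mC. u z * \<phi> z = tens (tens_mult_list l k) z" using u(2) by eventually_elim (simp add: tens_mult_list_eq k)
      then have "EC v (\<lambda>z. u z * \<phi> z) = EC (tens m) (tens (tens_mult_list l k))"
        by (intro EC_AE_cong[OF v(1) tens_repA(4)[OF m] v(2)] borel_measurable_times u pm L2_measurable[OF T_L2[OF p1(2)]])
      then show ?thesis using EC_eq_B0[OF tens_repA(2)[OF m] p1(2)] B0_tens[OF m p1(2)] by simp
    qed
    have e3: "EC (\<lambda>z. u z * v z) \<phi> = - integral\<^sup>L mC (\<lambda>z. tens (cone_gen (tens_mult_list l m)) z * \<phi> z)"
    proof -
      have "AE z in mC. u z * v z = tens (tens_mult_list l m) z" using u(2) v(2) by eventually_elim (simp add: tens_mult_list_eq)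
      then have "EC (\<lambda>z. u z * v z) \<phi> = EC (tens (tens_mult_list l m)) \<phi>"
        by (intro EC_AE_cong[OF _ tens_repA(4)[OF lm] _ pm pm] borel_measurable_times u v) auto
      then show ?thesis using EC_eq_B0[OF tens_repA(2)[OF lm] phT] B0_tens[OF lm phT] by simp
    qed
    have "(integral\<^sup>L mC (\<lambda>z. ?g z * \<phi> z)) = (EC u (\<lambda>z. v z * \<phi> z) + EC v (\<lambda>z. u z * \<phi> z) - EC (\<lambda>z. u z * v z) \<phi>) / 2"
    proof -
      have "ess_bounded mC \<phi>" unfolding ess_bounded_def by (intro exI[of _ C] AE_I2 C)
      with g T_DC[OF phT] show ?thesis unfolding is_cdc_def by blast
    qed
    also have "\<dots> = (integral\<^sup>L mC (\<lambda>z. tens (cone_gen (tens_mult_list l m)) z * \<phi> z) - integral\<^sup>L mC (\<lambda>z. tens (cone_gen l) z * tens (tens_mult_list m k) z)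
        - integral\<^sup>L mC (\<lambda>z. tens (cone_gen m) z * tens (tens_mult_list l k) z)) / 2"
      by (simp add: e1 e2 e3)
    also have "\<dots> = integral\<^sup>L mC (\<lambda>z. (tens (cone_gen (tens_mult_list l m)) z * \<phi> z - tens (cone_gen l) z * tens (tens_mult_list m k) z
        - tens (cone_gen m) z * tens (tens_mult_list l k) z) / 2)"
      using L2_mult_integrable[OF tens_repA(3)[OF repA_cone_gen[OF lm]] T_L2[OF phT]]
        L2_mult_integrable[OF tens_repA(3)[OF repA_cone_gen[OF l]] T_L2[OF p1(1)]]
        L2_mult_integrable[OF tens_repA(3)[OF repA_cone_gen[OF m]] T_L2[OF p1(2)]]
      by simp
    also have "\<dots> = integral\<^sup>L mC (\<lambda>z. tens (cone_cdc l m) z * \<phi> z)"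
      by (intro Bochner_Integration.integral_cong refl)
        (simp add: tens_cone_cdc[OF l m] tens_mult_list_eq k field_simps)
    finally show "integral\<^sup>L mC (\<lambda>z. ?g z * \<phi> z) = integral\<^sup>L mC (\<lambda>z. tens (cone_cdc l m) z * \<phi> z)" .
  qed
qed

text \<open>Two candidates for the generator differ by some d orthogonal to \<open>D\<close>. As
  \<open>D\<close> is dense, d has approximants v in \<open>D\<close>, and |d|^2 + |v|^2 = |d - v|^2
  makes d null.\<close>

lemma gen_fibre_AE:
  assumes "f \<in> A" "u \<in> borel_measurable M" "AE x in M. f x = u x"
  shows "gen M D E u \<in> borel_measurable M" "AE x in M. gen M D E u x = genA f x"
proof -
  have f: "f \<in> D" using A_D assms by blast
  have u: "u \<in> D" by (rule D_AE_cong(1)[OF f assms(2,3)])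
  have "is_gen M D E u (genA f)"
    using genA(2)[OF assms(1)] D_AE_cong(2)[OF f assms(2,3)] u unfolding is_gen_def by auto
  then have g: "is_gen M D E u (gen M D E u)" unfolding gen_def by (rule someI[of "is_gen M D E u"])
  let ?d = "\<lambda>x. gen M D E u x - genA f x"
  have L: "gen M D E u \<in> L2 M" "genA f \<in> L2 M" using g A_L2 genA assms by (auto simp: is_gen_def)
  then show "gen M D E u \<in> borel_measurable M" using L2_measurable by blast
  have d: "?d \<in> L2 M" by (rule L2_diff[OF L])
  have orth: "(\<integral>x. ?d x * v x \<partial>M) = 0" if v: "v \<in> D" for v
  proof -
    have "(\<integral>x. gen M D E u x * v x \<partial>M) = (\<integral>x. genA f x * v x \<partial>M)"
      using g \<open>is_gen M D E u (genA f)\<close> v unfolding is_gen_def by fastforce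
    then show ?thesis using L2_mult_integrable[OF L(1) D_L2[OF v]] L2_mult_integrable[OF L(2) D_L2[OF v]]
      by (simp add: left_diff_distrib)
  qed
  have "integral\<^sup>L M (\<lambda>x. (?d x)\<^sup>2) \<le> 0 + \<epsilon>" if e: "\<epsilon> > 0" for \<epsilon>
  proof -
    obtain v where v: "v \<in> D" "integral\<^sup>L M (\<lambda>x. (?d x - v x)\<^sup>2) < \<epsilon>" using D_dense[OF d e] by blast
    have i: "integrable M (\<lambda>x. (?d x)\<^sup>2)" "integrable M (\<lambda>x. (v x)\<^sup>2)" "integrable M (\<lambda>x. ?d x * v x)"
      using d D_L2[OF v(1)] L2_mult_integrable[OF d D_L2[OF v(1)]] unfolding L2_def by simp_all
    have "integral\<^sup>L M (\<lambda>x. (?d x - v x)\<^sup>2) = integral\<^sup>L M (\<lambda>x. (?d x)\<^sup>2 + (v x)\<^sup>2 - 2 * (?d x * v x))"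
      by (intro Bochner_Integration.integral_cong refl) (simp add: power2_eq_square algebra_simps)
    also have "\<dots> = integral\<^sup>L M (\<lambda>x. (?d x)\<^sup>2) + integral\<^sup>L M (\<lambda>x. (v x)\<^sup>2) - 2 * (\<integral>x. ?d x * v x \<partial>M)"
      using i by (simp del: mult_minus_left)
    finally have "integral\<^sup>L M (\<lambda>x. (?d x)\<^sup>2) + integral\<^sup>L M (\<lambda>x. (v x)\<^sup>2) < \<epsilon>" using v(2) orth[OF v(1)] by simp
    moreover have "0 \<le> integral\<^sup>L M (\<lambda>x. (v x)\<^sup>2)" by simp
    ultimately show ?thesis by linarith
  qed
  then have "integral\<^sup>L M (\<lambda>x. (?d x)\<^sup>2) \<le> 0" by (rule field_le_epsilon)
  then have "integral\<^sup>L M (\<lambda>x. (?d x)\<^sup>2) = 0" by (simp add: order_antisym)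
  from AE_zero_if_integral_square_zero[OF d this]
  show "AE x in M. gen M D E u x = genA f x" by simp
qed

end

section \<open>From the cone to the fibre\<close>

lemma wK_has_deriv:
  assumes "r \<in> IK_int K"
  shows "(wK K has_real_derivative (- 2 * cosK K r * inverse (sinK K r) ^ 3)) (at r)"
    and "((\<lambda>r. - 2 * cosK K r * inverse (sinK K r) ^ 3) has_real_derivative
      (6 * (cosK K r)\<^sup>2 * inverse (sinK K r) ^ 4 + 2 * K * inverse (sinK K r) ^ 2)) (at r)"
proof -
  have s: "sinK K r \<noteq> 0" using sinK_pos[OF assms] by simp
  show "(wK K has_real_derivative (- 2 * cosK K r * inverse (sinK K r) ^ 3)) (at r)"
    unfolding wK_def[abs_def]
    by (rule derivative_eq_intros sinK_has_deriv s refl)+ (use s in \<open>auto simp: field_simps eval_nat_numeral\<close>)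
  show "((\<lambda>r. - 2 * cosK K r * inverse (sinK K r) ^ 3) has_real_derivative
      (6 * (cosK K r)\<^sup>2 * inverse (sinK K r) ^ 4 + 2 * K * inverse (sinK K r) ^ 2)) (at r)"
    by (rule derivative_eq_intros sinK_has_deriv cosK_has_deriv s refl)+ (use s in \<open>auto simp: field_simps eval_nat_numeral\<close>)
qed

lemma bK_has_deriv:
  assumes "r \<in> IK_int K"
  shows "(bK K N has_real_derivative (- N * (K + (cosK K r)\<^sup>2 * inverse (sinK K r) ^ 2))) (at r)"
proof -
  have s: "sinK K r \<noteq> 0" using sinK_pos[OF assms] by simp
  show ?thesis unfolding bK_def[abs_def]
    by (rule derivative_eq_intros sinK_has_deriv cosK_has_deriv s refl)+ (use s in \<open>auto simp: field_simps eval_nat_numeral\<close>)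
qed

lemma deriv_wK_mult:
  assumes p: "\<phi> \<in> CS K" and r: "r \<in> IK_int K"
  shows "deriv (\<lambda>r. wK K r * \<phi> r) r = - 2 * cosK K r * inverse (sinK K r) ^ 3 * \<phi> r + wK K r * deriv \<phi> r"
  using DERIV_imp_deriv[OF DERIV_mult[OF wK_has_deriv(1)[OF r] Cc_smooth_on_has_deriv[OF p]]]
  by (simp add: algebra_simps)

lemma deriv2_wK_mult:
  assumes p: "\<phi> \<in> CS K" and r: "r \<in> IK_int K"
  shows "deriv (deriv (\<lambda>r. wK K r * \<phi> r)) r =
    (6 * (cosK K r)\<^sup>2 * inverse (sinK K r) ^ 4 + 2 * K * inverse (sinK K r) ^ 2) * \<phi> r
    + 2 * (- 2 * cosK K r * inverse (sinK K r) ^ 3) * deriv \<phi> r + wK K r * deriv (deriv \<phi>) r"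
proof -
  let ?w' = "\<lambda>r. - 2 * cosK K r * inverse (sinK K r) ^ 3"
  let ?w'' = "6 * (cosK K r)\<^sup>2 * inverse (sinK K r) ^ 4 + 2 * K * inverse (sinK K r) ^ 2"
  have "((\<lambda>r. ?w' r * \<phi> r + wK K r * deriv \<phi> r) has_real_derivative
      (?w'' * \<phi> r + deriv \<phi> r * ?w' r) + (?w' r * deriv \<phi> r + deriv (deriv \<phi>) r * wK K r)) (at r)"
    by (intro DERIV_add DERIV_mult wK_has_deriv r Cc_smooth_on_has_deriv[OF p]
        Cc_smooth_on_has_deriv[OF Cc_smooth_on_deriv[OF p]])
  then have "(deriv (\<lambda>r. wK K r * \<phi> r) has_real_derivative
      (?w'' * \<phi> r + deriv \<phi> r * ?w' r) + (?w' r * deriv \<phi> r + deriv (deriv \<phi>) r * wK K r)) (at r)"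
    by (rule has_field_derivative_transform_within_open[OF _ open_IK_int r])
       (simp add: deriv_wK_mult[OF p])
  from DERIV_imp_deriv[OF this] show ?thesis by (simp add: algebra_simps)
qed

lemma deriv_radial_laplacian:
  assumes p: "\<phi> \<in> CS K" and r: "r \<in> IK_int K"
  shows "deriv (\<lambda>r. deriv (deriv \<phi>) r + bK K N r * deriv \<phi> r) r = deriv (deriv (deriv \<phi>)) r
     - N * (K + (cosK K r)\<^sup>2 * inverse (sinK K r) ^ 2) * deriv \<phi> r + bK K N r * deriv (deriv \<phi>) r"
proof -
  note d = Cc_smooth_on_deriv[OF p] Cc_smooth_on_deriv[OF Cc_smooth_on_deriv[OF p]]
  from DERIV_imp_deriv[OF DERIV_add[OF Cc_smooth_on_has_deriv[OF d(2)]
      DERIV_mult[OF bK_has_deriv[OF r] Cc_smooth_on_has_deriv[OF d(1)]]], of N]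
  show ?thesis by (simp add: algebra_simps)
qed

text \<open>\<open>ineq\<close> is the cone inequality for \<open>\<phi> \<otimes> f + \<psi> \<otimes> g\<close> at a radius where \<open>\<phi>, \<phi>', \<phi>'', \<phi>'''\<close> take the values
  \<open>s, c, p2, p3\<close> and \<open>\<psi>, \<psi>', \<psi>'', \<psi>'''\<close> the values \<open>0, 0, 1, q3\<close>.\<close>

lemma jet_algebra:
  fixes s c K N F :: real
  assumes s: "s > 0" and N: "N > 0" and pyth: "c\<^sup>2 + K * s\<^sup>2 = 1"
    and i: "i = inverse s" and w: "w = i * i" and b: "b = N * (c * i)"
    and Lff: "Lff = 2 * Gff + 2 * (F * L)" and Ggf: "Ggf = Gfg"
    and G: "G = (N * c\<^sup>2 * F + L) * i / N - p2 * F"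
    and ineq: "N * K * (c * c * (F * F) + w * (s * s) * Gff) + ((p2 + b * c) * F + (w * s * L + G))\<^sup>2 /
      (N + 1) \<le> ((2 * (c * p3) + 2 * (p2 * p2) + b * (2 * (c * p2))) * (F * F) + (w * (c * c) *
      Lff + (((6 * c\<^sup>2 * i ^ 4 + 2 * K * i\<^sup>2) * (s * s) - 8 * (c * (i ^ 3 * (s * c)))
      + w * (2 * (s * p2) + 2 * (c * c)) + b * (w * (2 * (s * c)) - 2 * c * i ^ 3 * (s * s))) * Gff +
      (w * (w * (s * s)) * LG + ((2 * p2 + c * q3 + b * c) * (F * G) + (w * s * Gfg + ((q3 * c + 2 *
      p2 + b * c) * (G * F) + (w * s * Ggf + 2 * (G * G))))))))) / 2 - (c * (p3 - N * (K +
      c\<^sup>2 * i\<^sup>2) * c + b * p2) * (F * F) + (w * (s * (p2 + b * c)) * Gff + (c * (w *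
      c - 2 * c * i ^ 3 * s) * (F * L) + (w * (s * (w * s)) * GL + (c * (q3 + b) * (F * G) + w * s *
      Gfg)))))" (is "?l \<le> ?r")
  shows "LG / 2 - GL \<ge> (N - 1) * Gff + L\<^sup>2 / N"
proof -
  \<comment> \<open>h is the second radial derivative of the tensor and t the rest of its cone
    generator; the assumption \<open>G\<close> says exactly that h = t/N.\<close>
  define h where "h = p2 * F + G"
  define t where "t = (N * c\<^sup>2 * F + L) * i"
  have si: "s * i = 1" using s i by simp
  have h: "h = t / N" by (simp add: h_def G t_def)
  \<comment> \<open>The third derivatives p3 and q3 and the mixed terms Gfg cancel, and the second
    factor enters only through h.\<close>
  have rhs: "h\<^sup>2 + Gff * (K + (1 - N) * c\<^sup>2 * i\<^sup>2) + N * (K + c\<^sup>2 * i\<^sup>2) * c\<^sup>2 * F\<^sup>2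
      + 2 * i\<^sup>2 * c\<^sup>2 * F * L + i\<^sup>2 * (LG / 2 - GL) \<ge> N * K * (c\<^sup>2 * F\<^sup>2 + Gff) + (h + t)\<^sup>2 / (N + 1)"
  proof (rule order_trans[OF _ order_trans[OF ineq]]; rule eq_refl)
    have "w * (s * s) = 1" "w * s = i" using si w by algebra+
    then show "N * K * (c\<^sup>2 * F\<^sup>2 + Gff) + (h + t)\<^sup>2 / (N + 1) = ?l"
      by (simp add: h_def t_def b power2_eq_square algebra_simps)
  next
    show "?r = h\<^sup>2 + Gff * (K + (1 - N) * c\<^sup>2 * i\<^sup>2) + N * (K + c\<^sup>2 * i\<^sup>2) * c\<^sup>2 * F\<^sup>2
      + 2 * i\<^sup>2 * c\<^sup>2 * F * L + i\<^sup>2 * (LG / 2 - GL)"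
      unfolding Lff Ggf w b h_def i using s by (simp add: field_simps eval_nat_numeral)
  qed
  \<comment> \<open>The equality case of Cauchy-Schwarz with weights 1 and N.\<close>
  have "(h + t)\<^sup>2 / (N + 1) = h\<^sup>2 + t\<^sup>2 / N" 
  proof -
    have "h + t = t * (N + 1) / N" using N by (simp add: h field_simps)
    then show ?thesis using N by (simp add: h divide_simps) (simp add: power2_eq_square algebra_simps)
  qed
  moreover have "t\<^sup>2 / N = i\<^sup>2 * (N * c\<^sup>2 * c\<^sup>2 * F\<^sup>2 + 2 * c\<^sup>2 * F * L + L\<^sup>2 / N)"
    using N by (simp add: t_def field_simps power2_eq_square)
  ultimately have "i\<^sup>2 * (LG / 2 - GL) \<ge> (N - 1) * Gff * (K + c\<^sup>2 * i\<^sup>2) + i\<^sup>2 * (L\<^sup>2 / N)"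
    using rhs by (simp add: algebra_simps)
  \<comment> \<open>Here the Pythagorean identity turns the curvature term into the factor 1/s^2
    common to all remaining terms.\<close>
  also have "K + c\<^sup>2 * i\<^sup>2 = i\<^sup>2" using pyth si by algebra
  finally have "i\<^sup>2 * ((N - 1) * Gff + L\<^sup>2 / N) \<le> i\<^sup>2 * (LG / 2 - GL)" by (simp add: algebra_simps)
  moreover have "i\<^sup>2 > 0" using s i by simp
  ultimately show ?thesis by simp
qed

text \<open>Otherwise an open interval around r0 would consist of points of \<open>S\<close> where
  \<open>Q\<close> fails, yet it has positive length.\<close>

lemma AE_lborel_imp_closure:
  fixes S :: "real set"
  assumes "AE r in lborel. r \<in> S \<longrightarrow> Q r" "open S" "r0 \<in> S"
  shows "r0 \<in> closure {r \<in> S. Q r}"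
proof (rule ccontr)
  assume "r0 \<notin> closure {r \<in> S. Q r}"
  then have "open (S - closure {r \<in> S. Q r})" "r0 \<in> S - closure {r \<in> S. Q r}" using assms by auto
  then obtain e where e: "e > 0" "ball r0 e \<subseteq> S - closure {r \<in> S. Q r}" using open_contains_ball by blast
  from assms(1) have "AE r in lborel. r \<notin> {r0 - e<..<r0 + e}"
  proof eventually_elim
    case (elim r)
    show ?case
    proof
      assume "r \<in> {r0 - e<..<r0 + e}"
      then have "r \<in> ball r0 e" by (auto simp: dist_real_def)
      with e elim closure_subset[of "{r \<in> S. Q r}"] show False by blast
    qed
  qed
  then have "{r0 - e<..<r0 + e} \<in> null_sets lborel" by (subst AE_iff_null_sets) auto
  then have "emeasure lborel {r0 - e<..<r0 + e} = 0" by auto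
  with e(1) show False by simp
qed

section \<open>Evaluation at a fixed radius\<close>

context cone_algebra
begin

lemma tens_continuous: "l \<in> repA \<Longrightarrow> continuous_on UNIV (\<lambda>r. tens l (r, x))"
  by (rule Cc_smooth_on_continuous[OF tensor_dom_radial_CS[OF tens_repA(1)]])

definition cone_BE :: bool where
  "cone_BE \<longleftrightarrow> (\<forall>u\<in>tensor_dom K A.
      (let LCu = gen mC DC EC u; GCu = cdc mC DC EC u u
       in u \<in> gen_dom mC DC EC \<and> (\<exists>g. is_cdc mC DC EC u u g) \<and> GCu \<in> gen_dom mC DC EC \<and>
          (\<exists>g. is_cdc mC DC EC u LCu g) \<and>
          (AE z in mC. gen mC DC EC GCu z / 2 - cdc mC DC EC u LCu z
                       \<ge> N * K * GCu z + (LCu z)\<^sup>2 / (N + 1))))"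

text \<open>The chosen operators are replaced from the inside out: first generator and carre du
  champ of the tensor, then the operators applied to these, whose arguments are tensors only almost
  everywhere.\<close>

lemma cone_BE_tens:
  assumes be: cone_BE and l: "l \<in> repA"
  shows "AE z in mC. tens (cone_gen (cone_cdc l l)) z / 2 - tens (cone_cdc l (cone_gen l)) z
    \<ge> N * K * tens (cone_cdc l l) z + (tens (cone_gen l) z)\<^sup>2 / (N + 1)"
proof -
  let ?u = "tens l"
  let ?L = "gen mC DC EC ?u" and ?G = "cdc mC DC EC ?u ?u"
  have h: "?u \<in> gen_dom mC DC EC" "\<exists>g. is_cdc mC DC EC ?u ?u g" "?G \<in> gen_dom mC DC EC"
    "\<exists>g. is_cdc mC DC EC ?u ?L g"
    "AE z in mC. gen mC DC EC ?G z / 2 - cdc mC DC EC ?u ?L z \<ge> N * K * ?G z + (?L z)\<^sup>2 / (N + 1)"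
    using be tens_repA(1)[OF l] unfolding cone_BE_def Let_def by blast+
  have um: "?u \<in> borel_measurable mC" by (rule tens_repA(4)[OF l])
  note L = gen_cone_AE[OF h(1) l AE_I2[OF refl] um]
  note G = cdc_cone_AE[OF h(2) l l um AE_I2[OF refl] um AE_I2[OF refl]]
  note LG = gen_cone_AE[OF h(3) repA_cone_cdc[OF l l] G(2) G(1)]
  note GL = cdc_cone_AE[OF h(4) l repA_cone_gen[OF l] um AE_I2[OF refl] L]
  from L(2) G(2) LG(2) GL(2) h(5) show ?thesis by eventually_elim simp
qed

text \<open>By Fubini the inequality holds on almost every radial slice, hence for radii arbitrarily
  close to r0, and both sides are continuous in r.\<close>

lemma cone_BE_slice:
  assumes be: cone_BE and l: "l \<in> repA" and r0: "r0 \<in> IK_int K"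
  shows "AE x in M. tens (cone_gen (cone_cdc l l)) (r0, x) / 2 - tens (cone_cdc l (cone_gen l)) (r0, x)
    \<ge> N * K * tens (cone_cdc l l) (r0, x) + (tens (cone_gen l) (r0, x))\<^sup>2 / (N + 1)"
proof -
  define P where "P r x \<longleftrightarrow> tens (cone_gen (cone_cdc l l)) (r, x) / 2 - tens (cone_cdc l (cone_gen l)) (r, x)
    \<ge> N * K * tens (cone_cdc l l) (r, x) + (tens (cone_gen l) (r, x))\<^sup>2 / (N + 1)" for r x
  have "AE z in muK K N \<Otimes>\<^sub>M M. P (fst z) (snd z)"
    using cone_BE_tens[OF be l] unfolding mC_eq P_def by simp
  then have "AE r in muK K N. AE x in M. P r x" using AE_pair[of "\<lambda>z. P (fst z) (snd z)"] by simp
  then have "r0 \<in> closure {r \<in> IK_int K. AE x in M. P r x}"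
    by (intro AE_lborel_imp_closure open_IK_int r0) (simp add: AE_muK_iff)
  then obtain q where q: "\<And>n. AE x in M. P (q n) x" "q \<longlonglongrightarrow> r0"
    unfolding closure_sequential by auto
  \<comment> \<open>Only countably many radii are involved, so one null set of fibre points serves
    the whole sequence.\<close>
  have "AE x in M. \<forall>n. P (q n) x" unfolding AE_all_countable using q by blast
  then have "AE x in M. P r0 x"
  proof eventually_elim
    case (elim x)
    have t: "(\<lambda>n. tens k (q n, x)) \<longlonglongrightarrow> tens k (r0, x)" if "k \<in> repA" for k
    proof -
      have "isCont (\<lambda>r. tens k (r, x)) r0"
        using tens_continuous[OF that] by (simp add: continuous_on_eq_continuous_at)
      then show ?thesis using q(2) isCont_tendsto_compose by fast
    qed
    show ?case unfolding P_def
    proof (rule tendsto_le[OF sequentially_bot])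
      show "(\<lambda>n. tens (cone_gen (cone_cdc l l)) (q n, x) / 2 - tens (cone_cdc l (cone_gen l)) (q n, x)) \<longlonglongrightarrow>
        tens (cone_gen (cone_cdc l l)) (r0, x) / 2 - tens (cone_cdc l (cone_gen l)) (r0, x)"
        by (intro tendsto_intros t repA_cone_gen repA_cone_cdc l) simp
      show "(\<lambda>n. N * K * tens (cone_cdc l l) (q n, x) + (tens (cone_gen l) (q n, x))\<^sup>2 / (N + 1)) \<longlonglongrightarrow>
        N * K * tens (cone_cdc l l) (r0, x) + (tens (cone_gen l) (r0, x))\<^sup>2 / (N + 1)"
        unfolding divide_inverse by (intro tendsto_intros t repA_cone_gen repA_cone_cdc l)
    qed (use elim in \<open>simp add: P_def\<close>)
  qed
  then show ?thesis by (simp add: P_def)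
qed

lemma jet_inequality:
  assumes p: "\<phi> \<in> CS K" "\<phi> r0 = sinK K r0" "deriv \<phi> r0 = cosK K r0"
    and q: "\<psi> \<in> CS K" "\<psi> r0 = 0" "deriv \<psi> r0 = 0" "deriv (deriv \<psi>) r0 = 1"
    and r0: "r0 \<in> IK_int K"
    and ineq: "tens (cone_gen (cone_cdc [(\<phi>, f), (\<psi>, g)] [(\<phi>, f), (\<psi>, g)])) (r0, x) / 2
        - tens (cone_cdc [(\<phi>, f), (\<psi>, g)] (cone_gen [(\<phi>, f), (\<psi>, g)])) (r0, x)
    \<ge> N * K * tens (cone_cdc [(\<phi>, f), (\<psi>, g)] [(\<phi>, f), (\<psi>, g)]) (r0, x)
       + (tens (cone_gen [(\<phi>, f), (\<psi>, g)]) (r0, x))\<^sup>2 / (N + 1)"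
    and N: "N > 0"
    and g: "g x = (N * (cosK K r0)\<^sup>2 * f x + genA f x) * inverse (sinK K r0) / N - deriv (deriv \<phi>) r0 * f x"
  shows "genA (cdcA f f) x / 2 - cdcA f (genA f) x \<ge> (N - 1) * cdcA f f x + (genA f x)\<^sup>2 / N"
proof -
  note d1 = Cc_smooth_on_deriv[OF p(1)] Cc_smooth_on_deriv[OF q(1)]
  note m = CS_closed(2)[OF p(1) p(1)] CS_closed(2)[OF p(1) q(1)] CS_closed(2)[OF q(1) p(1)] CS_closed(2)[OF q(1) q(1)]
  \<comment> \<open>The product rules require the factors to be in \<open>CS K\<close>; they are
    instantiated for every pair that occurs so that they can be used for unfolding.\<close>
  note D = fun_cong[OF deriv_CS_mult, of _ K _ r0] fun_cong[OF deriv2_CS_mult, of _ K _ r0]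
  note D1 = D(1)[OF d1(1) d1(1)] D(1)[OF d1(1) d1(2)] D(1)[OF d1(2) d1(1)] D(1)[OF d1(2) d1(2)]
    D(1)[OF p(1) p(1)] D(1)[OF p(1) q(1)] D(1)[OF q(1) p(1)] D(1)[OF q(1) q(1)]
  note D2 = D(2)[OF d1(1) d1(1)] D(2)[OF d1(1) d1(2)] D(2)[OF d1(2) d1(1)] D(2)[OF d1(2) d1(2)]
    D(2)[OF p(1) p(1)] D(2)[OF p(1) q(1)] D(2)[OF q(1) p(1)] D(2)[OF q(1) q(1)]
  note W = deriv_wK_mult[OF m(1) r0] deriv_wK_mult[OF m(2) r0] deriv_wK_mult[OF m(3) r0] deriv_wK_mult[OF m(4) r0]
    deriv_wK_mult[OF p(1) r0] deriv_wK_mult[OF q(1) r0]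
    deriv2_wK_mult[OF m(1) r0] deriv2_wK_mult[OF m(2) r0] deriv2_wK_mult[OF m(3) r0] deriv2_wK_mult[OF m(4) r0]
    deriv_radial_laplacian[OF p(1) r0] deriv_radial_laplacian[OF q(1) r0]
  \<comment> \<open>With the jets inserted, the inequality has the shape of the premise
    \<open>ineq\<close> of \<open>jet_algebra\<close>.\<close>
  note X = ineq[unfolded cone_cdc.simps cone_cdc1.simps cone_gen.simps append.simps tens_simps fst_conv snd_conv D1 D2 W p(2,3) q(2-4),
      simplified]
  show ?thesis
  proof (rule jet_algebra[OF sinK_pos[OF r0] N cosK_sinK_pythagoras refl _ _ _ _ g X])
    show "wK K r0 = inverse (sinK K r0) * inverse (sinK K r0)" by (simp add: wK_def)
    show "bK K N r0 = N * (cosK K r0 * inverse (sinK K r0))" by (simp add: bK_def)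
    show "genA (\<lambda>x. f x * f x) x = 2 * cdcA f f x + 2 * (f x * genA f x)" by (simp add: cdcA_def field_simps)
    show "cdcA g f x = cdcA f g x" by (simp add: cdcA_sym)
  qed
qed

lemma fibre_BE:
  assumes be: cone_BE and N: "N > 0" and f: "f \<in> A"
  shows "AE x in M. genA (cdcA f f) x / 2 - cdcA f (genA f) x \<ge> (N - 1) * cdcA f f x + (genA f x)\<^sup>2 / N"
proof -
  obtain r0 where r0: "r0 \<in> IK_int K" using IK_int_nonempty by blast
  obtain \<phi> where p: "\<phi> \<in> CS K" "\<phi> r0 = sinK K r0" "deriv \<phi> r0 = cosK K r0"
    using Cc_smooth_on_jet(1)[OF open_IK_int r0] by blast
  obtain \<psi> where q: "\<psi> \<in> CS K" "\<psi> r0 = 0" "deriv \<psi> r0 = 0" "deriv (deriv \<psi>) r0 = 1"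
    using Cc_smooth_on_jet(2)[OF open_IK_int r0] by blast
  \<comment> \<open>The solution of h = t/N. As r0 is fixed, its coefficients are constants, so it
    is a linear combination of f and \<open>genA f\<close>; the grouping follows
    \<open>A_add\<close> and \<open>A_cmult\<close>.\<close>
  define g where "g x = (cosK K r0)\<^sup>2 * inverse (sinK K r0) * f x + ((inverse (sinK K r0) / N) * genA f x
    + (- deriv (deriv \<phi>) r0) * f x)" for x
  have gA: "g \<in> A" unfolding g_def[abs_def] by (intro A_add A_cmult f genA)
  have g: "g x = (N * (cosK K r0)\<^sup>2 * f x + genA f x) * inverse (sinK K r0) / N - deriv (deriv \<phi>) r0 * f x" for x
    using N sinK_pos[OF r0] by (simp add: g_def field_simps)
  have "[(\<phi>, f), (\<psi>, g)] \<in> repA" using p q f gA by simp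
  from cone_BE_slice[OF be this r0] show ?thesis
    by eventually_elim (rule jet_inequality[OF p q r0 _ N g])
qed

text \<open>Representatives may change because \<open>Gamma2A\<close> uses the chosen
  \<open>gen M D E f\<close> as an argument, while the algebra is only known to contain
  \<open>genA f\<close>.\<close>

lemma GammaA_AE:
  assumes u: "u \<in> A" "u' \<in> borel_measurable M" "AE x in M. u x = u' x"
    and v: "v \<in> A" "v' \<in> borel_measurable M" "AE x in M. v x = v' x"
  shows "GammaA M D E u' v' \<in> borel_measurable M" "AE x in M. cdcA u v x = GammaA M D E u' v' x"
proof -
  have uv: "(\<lambda>x. u' x * v' x) \<in> borel_measurable M" using u v by simp
  have ae: "AE x in M. u x * v x = u' x * v' x" using u(3) v(3) by eventually_elim simp
  note g = gen_fibre_AE[OF u] gen_fibre_AE[OF v] gen_fibre_AE[OF A_mult[OF u(1) v(1)] uv ae]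
  show "GammaA M D E u' v' \<in> borel_measurable M" unfolding GammaA_def using g u v by simp
  from g(2,4,6) u(3) v(3) show "AE x in M. cdcA u v x = GammaA M D E u' v' x"
    by eventually_elim (simp add: cdcA_def GammaA_def)
qed

lemma Gamma2A_BE:
  assumes be: cone_BE and N: "N > 0" and f: "f \<in> A"
  shows "AE x in M. Gamma2A M D E f x \<ge> (N - 1) * GammaA M D E f f x + (gen M D E f x)\<^sup>2 / N"
proof -
  note fm = A_measurable[OF f]
  have L: "gen M D E f \<in> borel_measurable M" "AE x in M. gen M D E f x = genA f x"
    using gen_fibre_AE[OF f fm] by simp_all
  have L': "AE x in M. genA f x = gen M D E f x" using L(2) by eventually_elim simp
  note G = GammaA_AE[OF f fm AE_I2[OF refl] f fm AE_I2[OF refl]]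
  note GL = GammaA_AE[OF f fm AE_I2[OF refl] genA(1)[OF f] L(1) L']
  note LG = gen_fibre_AE[OF cdcA_A[OF f f] G]
  from fibre_BE[OF be N f] L(2) G(2) GL(2) LG(2) show ?thesis
    by eventually_elim (simp add: Gamma2A_def)
qed

end

theorem theorem3p10:
  fixes mF :: "'a::t2_space measure"
    and DF :: "('a \<Rightarrow> real) set"
    and EF :: "('a \<Rightarrow> real) \<Rightarrow> ('a \<Rightarrow> real) \<Rightarrow> real"
    and A :: "('a \<Rightarrow> real) set"
    and K N :: real
  assumes "radon_full_support mF"
    and "dirichlet_form mF DF EF"
    and "regular_form mF DF EF"
    and "strongly_local mF DF EF"
    and "admits_cdc mF DF EF"
    and "admissible_algebra mF DF EF A"
    and "N \<ge> 1"
    and cone_BE: "\<forall>u\<in>tensor_dom K A.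
      (let mC = cone_measure K N mF; DC = cone_dom K N mF DF EF; EC = cone_E K N mF DF EF;
           LCu = gen mC DC EC u; GCu = cdc mC DC EC u u
       in u \<in> gen_dom mC DC EC \<and> (\<exists>g. is_cdc mC DC EC u u g) \<and> GCu \<in> gen_dom mC DC EC \<and>
          (\<exists>g. is_cdc mC DC EC u LCu g) \<and>
          (AE z in mC. gen mC DC EC GCu z / 2 - cdc mC DC EC u LCu z
                       \<ge> N * K * GCu z + (LCu z)\<^sup>2 / (N + 1)))"
  shows "\<forall>u\<in>A. AE x in mF. Gamma2A mF DF EF u x
            \<ge> (N - 1) * GammaA mF DF EF u u x + (gen mF DF EF u x)\<^sup>2 / N"
proof -
  have "sigma_finite_measure mF" using assms(1) by (simp add: radon_full_support_def)
  then interpret cone_algebra mF DF EF K N A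
    by unfold_locales (use assms in \<open>simp_all add: sigma_finite_measure_def\<close>)
  have be: cone_BE using assms(8) unfolding cone_BE_def Let_def .
  show ?thesis using Gamma2A_BE[OF be] assms(7) by simp
qed

end
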